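(* Let $G$ be a finite group. We have $\mathrm{tp}(G) = 1/2$ if, and only if, $G$ is isomorphic to one of the following groups: (i) $C_3 \rtimes C_{2^n} = \langle a,b \mid a^3=b^{2^n}=1,\ a^b=a^{-1}\rangle$ for some integer $n\geq 1$; (ii) $D_4$, the dihedral group of order $8$; (iii) $Q_{16}$, the generalised quaternion group of order $16$; (iv) $C_4 \rtimes C_4 = \langle a,b\mid a^4=b^4=1,\ a^b=a^{-1}\rangle$.
   Context: For a subgroup $H$ of index $n$ in a finite group $G$, $P_G(H) := |\mathrm{DT}_G(H)|/|H|^n$, where $\mathrm{DT}_G(H)$ is the set of all subsets of $G$ that are simultaneously a left transversal (exactly one element of each left coset $gH$) and a right transversal (exactly one element of each right coset $Hg$) of $H$ in $G$. The common transversal probability of $G$ is $\mathrm{tp}(G) := \min_{H\leq G} P_G(H)$, the minimum over all subgroups $H$ of $G$. $C_m$ is the cyclic group of order $m$ and $a^b=b^{-1}ab$. *)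

theory Defs
  imports "HOL-Algebra.Algebra"
begin

section \<open>Common transversals\<close>

definition left_transversal :: "('a, 'b) monoid_scheme \<Rightarrow> 'a set \<Rightarrow> 'a set \<Rightarrow> bool" where
  "left_transversal G H T \<longleftrightarrow> T \<subseteq> carrier G \<and> (\<forall>C \<in> lcosets\<^bsub>G\<^esub> H. \<exists>!x. x \<in> T \<and> x \<in> C)"

definition right_transversal :: "('a, 'b) monoid_scheme \<Rightarrow> 'a set \<Rightarrow> 'a set \<Rightarrow> bool" where
  "right_transversal G H T \<longleftrightarrow> T \<subseteq> carrier G \<and> (\<forall>C \<in> rcosets\<^bsub>G\<^esub> H. \<exists>!x. x \<in> T \<and> x \<in> C)"

definition DT :: "('a, 'b) monoid_scheme \<Rightarrow> 'a set \<Rightarrow> 'a set set" where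
  "DT G H = {T. left_transversal G H T \<and> right_transversal G H T}"

definition transversal_prob :: "('a, 'b) monoid_scheme \<Rightarrow> 'a set \<Rightarrow> real" where
  "transversal_prob G H = real (card (DT G H)) / real (card H) ^ card (rcosets\<^bsub>G\<^esub> H)"

definition tp :: "('a, 'b) monoid_scheme \<Rightarrow> real" where
  "tp G = Min {transversal_prob G H | H. subgroup H G}"


section \<open>Groups given by generators and relations\<close>

text \<open>
  Words are lists of letters \<open>Pos x\<close> (the generator \<open>x\<close>) and \<open>Neg x\<close> (its formal inverse);
  every element of the type \<open>'g\<close> is a generator.  A set of relations \<open>u = v\<close> is a set of pairs
  \<open>(u, v)\<close> of words.
\<close>

datatype 'g letter = Pos 'g | Neg 'g

inductive word_eq :: "('g letter list \<times> 'g letter list) set \<Rightarrow> 'g letter list \<Rightarrow> 'g letter list \<Rightarrow> bool"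
  for R where
  rel: "(u, v) \<in> R \<Longrightarrow> word_eq R u v"
| Pos_Neg: "word_eq R [Pos x, Neg x] []"
| Neg_Pos: "word_eq R [Neg x, Pos x] []"
| refl: "word_eq R u u"
| sym: "word_eq R u v \<Longrightarrow> word_eq R v u"
| trans: "word_eq R u v \<Longrightarrow> word_eq R v w \<Longrightarrow> word_eq R u w"
| append: "word_eq R u v \<Longrightarrow> word_eq R u' v' \<Longrightarrow> word_eq R (u @ u') (v @ v')"

definition word_class :: "('g letter list \<times> 'g letter list) set \<Rightarrow> 'g letter list \<Rightarrow> 'g letter list set" where
  "word_class R u = {v. word_eq R u v}"

definition presented_group :: "('g letter list \<times> 'g letter list) set \<Rightarrow> 'g letter list set monoid" where
  "presented_group R =
     \<lparr>carrier = range (word_class R),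
      monoid.mult = (\<lambda>A B. {w. \<exists>u \<in> A. \<exists>v \<in> B. word_eq R (u @ v) w}),
      one = word_class R []\<rparr>"

lemma word_class_eq_iff: "word_class R u = word_class R v \<longleftrightarrow> word_eq R u v"
  unfolding word_class_def by (auto intro: word_eq.intros)

lemma presented_group_mult:
  "word_class R u \<otimes>\<^bsub>presented_group R\<^esub> word_class R v = word_class R (u @ v)"
  unfolding presented_group_def word_class_def
  by (auto intro: word_eq.refl) (meson word_eq.append word_eq.trans)

fun letter_inv :: "'g letter \<Rightarrow> 'g letter" where
  "letter_inv (Pos x) = Neg x"
| "letter_inv (Neg x) = Pos x"

lemma word_eq_inverse: "word_eq R (rev (map letter_inv u) @ u) []"
proof (induction u)
  case Nil
  show ?case by (simp add: word_eq.refl)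
next
  case (Cons l u)
  let ?v = "rev (map letter_inv u)"
  have "word_eq R [letter_inv l, l] []"
    by (cases l) (auto intro: word_eq.intros)
  then have "word_eq R (?v @ [letter_inv l, l] @ u) (?v @ [] @ u)"
    by (intro word_eq.append word_eq.refl)
  with Cons.IH show ?case
    by (auto intro: word_eq.trans)
qed

lemma group_presented_group: "group (presented_group R)"
proof (rule groupI)
  fix x assume "x \<in> carrier (presented_group R)"
  then obtain u where u: "x = word_class R u"
    by (auto simp: presented_group_def)
  have "word_class R (rev (map letter_inv u)) \<otimes>\<^bsub>presented_group R\<^esub> x = \<one>\<^bsub>presented_group R\<^esub>"
    by (simp add: u presented_group_mult word_class_eq_iff word_eq_inverse)
       (simp add: presented_group_def word_class_eq_iff word_eq_inverse)
  then show "\<exists>y\<in>carrier (presented_group R). y \<otimes>\<^bsub>presented_group R\<^esub> x = \<one>\<^bsub>presented_group R\<^esub>"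
    by (auto simp: presented_group_def)
next
  have one: "\<one>\<^bsub>presented_group R\<^esub> = word_class R []"
    and carr: "carrier (presented_group R) = range (word_class R)"
    by (simp_all add: presented_group_def)
  fix x y z
  assume "x \<in> carrier (presented_group R)" "y \<in> carrier (presented_group R)"
  then obtain u v where *: "x = word_class R u" "y = word_class R v"
    by (auto simp: carr)
  show "x \<otimes>\<^bsub>presented_group R\<^esub> y \<in> carrier (presented_group R)"
    by (simp add: * presented_group_mult carr)
  show "\<one>\<^bsub>presented_group R\<^esub> \<otimes>\<^bsub>presented_group R\<^esub> x = x"
    by (simp add: * one presented_group_mult)
  assume "z \<in> carrier (presented_group R)"
  then obtain w where "z = word_class R w"
    by (auto simp: carr)
  with * show "x \<otimes>\<^bsub>presented_group R\<^esub> y \<otimes>\<^bsub>presented_group R\<^esub> z =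
      x \<otimes>\<^bsub>presented_group R\<^esub> (y \<otimes>\<^bsub>presented_group R\<^esub> z)"
    by (simp add: presented_group_mult)
qed (simp add: presented_group_def)


section \<open>The groups in the classification\<close>

datatype gen = a | b

text \<open>In each case the last relation is \<open>b\<^sup>-\<^sup>1 a b = a\<^sup>-\<^sup>1\<close>.\<close>

definition C3_semidirect_C2pow :: "nat \<Rightarrow> gen letter list set monoid" where
  "C3_semidirect_C2pow n = presented_group
     {(replicate 3 (Pos a), []), (replicate (2 ^ n) (Pos b), []), ([Neg b, Pos a, Pos b], [Neg a])}"

definition D4 :: "gen letter list set monoid" where
  "D4 = presented_group
     {(replicate 4 (Pos a), []), (replicate 2 (Pos b), []), ([Neg b, Pos a, Pos b], [Neg a])}"

definition Q16 :: "gen letter list set monoid" where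
  "Q16 = presented_group
     {(replicate 8 (Pos a), []), (replicate 2 (Pos b), replicate 4 (Pos a)),
      ([Neg b, Pos a, Pos b], [Neg a])}"

definition C4_semidirect_C4 :: "gen letter list set monoid" where
  "C4_semidirect_C4 = presented_group
     {(replicate 4 (Pos a), []), (replicate 4 (Pos b), []), ([Neg b, Pos a, Pos b], [Neg a])}"

hide_const (open) a b

end

theory Submission
  imports Defs
begin

text \<open>
  Choosing the representatives of a common transversal one left coset at a time shows that
  \<open>P\<^sub>G(H)\<close> is the product of \<open>m! / m\<^sup>m\<close> over the double cosets \<open>H g H\<close>, where \<open>m\<close> is the number of
  left cosets of \<open>H\<close> in \<open>H g H\<close>. Hence \<open>P\<^sub>G(H) = 1\<close> iff \<open>H\<close> is normal, and a non-normal \<open>H\<close> has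
  \<open>P\<^sub>G(H) \<ge> 1/2\<close> only if exactly one double coset has \<open>m = 2\<close> and all others have \<open>m = 1\<close>. Then
  \<open>|H|\<close> is even, and since the complement of that double coset is the normaliser of \<open>H\<close>, the index
  of \<open>H\<close> is 3 or 4.

  If \<open>tp G = 1/2\<close>, there is therefore a non-normal cyclic subgroup \<open>\<langle>x\<rangle>\<close> of order \<open>2\<^sup>k\<close>. In index 3 a
  Sylow 3-subgroup is normal and inverted by \<open>x\<close>. In index 4 the subgroup \<open>K = \<langle>x\<^sup>2\<rangle>\<close> is normal and
  \<open>G / K\<close> is dihedral of order 8; the preimage of the other class of non-central
  involutions is also cyclic, so its generator centralises \<open>K\<close> too and \<open>K\<close> is central, and then the rotation of \<open>G / K\<close> lifts to some \<open>A\<close> inverted by \<open>x\<close>.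
  For \<open>k \<ge> 3\<close> a non-normal subgroup of order at most 4 appears, so \<open>|G| \<le> 16\<close>.
\<close>

section \<open>Counting common transversals\<close>

text \<open>The product formula is used through two partial counts only. The representative in the
  last left coset of a double coset has |H| / m choices, every other pick has at most |H|.
  Postponing one pick bounds the probability by 1/m; postponing two from different double cosets
  bounds it by 1/(m m'). These bounds already determine the pattern behind a value of at least 1/2.

  All four families share one presentation with parameters: a^m = 1, b^s = a^r, and b inverts a.
  Relations bound the order of a group from above only, so an explicit model on pairs of exponents
  supplies the lower bound m s. Recognising a group then amounts to finding A inverted by x,
  checking that both generate, and counting.

  For the listed groups themselves, the order of every non-normal subgroup is forced, with index 3
  or 4, and counting the elements of its double cosets gives the value 1/2.\<close>

definition partial_transversals :: "('a \<Rightarrow> 'b) \<Rightarrow> 'a set set \<Rightarrow> 'a set set" where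
  "partial_transversals r S = {T. T \<subseteq> \<Union>S \<and> (\<forall>C\<in>S. \<exists>!x. x \<in> T \<and> x \<in> C) \<and> inj_on r T}"

lemma finite_partial_transversals: "finite (\<Union>S) \<Longrightarrow> finite (partial_transversals r S)"
  by (rule finite_subset[of _ "Pow (\<Union>S)"]) (auto simp: partial_transversals_def)

text \<open>Deleting the element chosen from \<open>C\<close> inverts the extension map, so the
  count is a sum over \<open>T\<close>; a constant number of free choices turns it into a product.
  In the application \<open>S\<close> consists of left cosets and \<open>r\<close> sends an element
  to its right coset: injectivity is the part of the right transversal condition that makes sense
  before all left cosets are served.\<close>

lemma card_partial_transversals_insert:
  assumes fin: "finite (\<Union>(insert C S))"
    and disj: "\<And>C'. C' \<in> S \<Longrightarrow> C \<inter> C' = {}"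
    and count: "\<And>T. T \<in> partial_transversals r S \<Longrightarrow> card {x \<in> C. r x \<notin> r ` T} = c"
  shows "card (partial_transversals r (insert C S)) = card (partial_transversals r S) * c"
proof -
  let ?X = "SIGMA T : partial_transversals r S. {x \<in> C. r x \<notin> r ` T}"
  let ?f = "\<lambda>(T, x). insert x T"
  have "bij_betw ?f ?X (partial_transversals r (insert C S))"
  proof (rule bij_betw_imageI)
    have *: "insert x T \<inter> C = {x}" "insert x T - C = T"
      if "T \<in> partial_transversals r S" "x \<in> C" for T x
    proof -
      have "T \<subseteq> \<Union>S" using that by (simp add: partial_transversals_def)
      then have "T \<inter> C = {}" using disj by blast
      then show "insert x T \<inter> C = {x}" "insert x T - C = T" using that by auto
    qed
    show "inj_on ?f ?X"
    proof (rule inj_onI, clarify)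
      fix T x T' x'
      assume "T \<in> partial_transversals r S" "x \<in> C" "T' \<in> partial_transversals r S" "x' \<in> C"
        and eq: "insert x T = insert x' T'"
      with *[of T x] *[of T' x'] have "{x} = {x'}" "T = T'" by simp_all
      then show "T = T' \<and> x = x'" by simp
    qed
    show "?f ` ?X = partial_transversals r (insert C S)"
    proof (intro equalityI subsetI)
      fix T' assume "T' \<in> ?f ` ?X"
      then obtain T x where T: "T \<in> partial_transversals r S" and x: "x \<in> C" "r x \<notin> r ` T"
        and T': "T' = insert x T" by auto
      have "\<exists>!y. y \<in> T' \<and> y \<in> C'" if "C' \<in> S" for C'
      proof -
        have "\<exists>!y. y \<in> T \<and> y \<in> C'" using T that by (auto simp: partial_transversals_def)
        moreover have "x \<notin> C'" using disj that x by auto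
        ultimately show ?thesis unfolding T' by auto
      qed
      moreover have "\<exists>!y. y \<in> T' \<and> y \<in> C"
      proof -
        have "y \<notin> C" if "y \<in> T" for y
          using *[OF T x(1)] that by (metis DiffD2)
        with x show ?thesis unfolding T' by auto
      qed
      moreover have "inj_on r T'"
        using T x by (auto simp: T' partial_transversals_def)
      moreover have "T' \<subseteq> \<Union>(insert C S)"
        using T x by (auto simp: T' partial_transversals_def)
      ultimately show "T' \<in> partial_transversals r (insert C S)"
        by (auto simp: partial_transversals_def)
    next
      fix T' assume T': "T' \<in> partial_transversals r (insert C S)"
      then obtain x where x: "x \<in> T'" "x \<in> C" and ux: "\<And>y. y \<in> T' \<Longrightarrow> y \<in> C \<Longrightarrow> y = x"
        by (auto simp: partial_transversals_def)
      define T where "T = T' - {x}"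
      have "\<exists>!y. y \<in> T \<and> y \<in> C'" if "C' \<in> S" for C'
      proof -
        have "\<exists>!y. y \<in> T' \<and> y \<in> C'" using T' that by (auto simp: partial_transversals_def)
        moreover have "x \<notin> C'" using disj that x by auto
        ultimately show ?thesis unfolding T_def by auto
      qed
      moreover have "T \<subseteq> \<Union>S"
        using T' ux by (auto simp: T_def partial_transversals_def)
      moreover have inj: "inj_on r T'"
        using T' by (auto simp: partial_transversals_def)
      moreover have "inj_on r T" using inj by (rule inj_on_subset) (auto simp: T_def)
      ultimately have "T \<in> partial_transversals r S"
        by (auto simp: partial_transversals_def)
      moreover have "r x \<notin> r ` T"
        using inj x by (auto simp: T_def inj_on_def)
      ultimately have "(T, x) \<in> ?X" using x by auto
      moreover have "T' = ?f (T, x)" using x by (auto simp: T_def)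
      ultimately show "T' \<in> ?f ` ?X" by blast
    qed
  qed
  then have "card (partial_transversals r (insert C S)) = card ?X"
    by (simp add: bij_betw_same_card)
  also have "\<dots> = (\<Sum>T\<in>partial_transversals r S. card {x \<in> C. r x \<notin> r ` T})"
    by (rule card_SigmaI) (use fin in \<open>auto intro: finite_partial_transversals\<close>)
  also have "\<dots> = card (partial_transversals r S) * c"
    by (simp add: count)
  finally show ?thesis .
qed

section \<open>Left and right cosets inside a double coset\<close>

definition double_coset :: "('a, 'b) monoid_scheme \<Rightarrow> 'a set \<Rightarrow> 'a \<Rightarrow> 'a set" where
  "double_coset G H g = {h \<otimes>\<^bsub>G\<^esub> g \<otimes>\<^bsub>G\<^esub> k | h k. h \<in> H \<and> k \<in> H}"

locale subgroup_of_finite_group = group G + subgroup H G for H and G (structure) +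
  assumes fin: "finite (carrier G)"
begin

abbreviation D where "D \<equiv> double_coset G H"

definition lefts :: "'a \<Rightarrow> 'a set set" where "lefts g = (\<lambda>y. y <# H) ` D g"

definition overlap :: "'a \<Rightarrow> nat" where "overlap g = card ((g <# H) \<inter> (H #> g))"

lemma finite_H: "finite H"
  using fin subset by (rule finite_subset[rotated])

lemma card_H_pos: "card H > 0"
  by (metis card_gt_0_iff empty_iff finite_H subgroup.one_closed subgroup_axioms)

lemma D_subset: "g \<in> carrier G \<Longrightarrow> D g \<subseteq> carrier G"
  by (auto simp: double_coset_def)

lemma D_I: "h \<in> H \<Longrightarrow> k \<in> H \<Longrightarrow> h \<otimes> g \<otimes> k \<in> D g"
  by (auto simp: double_coset_def)

lemma D_self: "g \<in> carrier G \<Longrightarrow> g \<in> D g"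
  using D_I[of \<one> \<one> g] by simp

lemma D_mono:
  assumes g: "g \<in> carrier G" and y: "y \<in> D g"
  shows "D y \<subseteq> D g"
proof
  fix z assume "z \<in> D y"
  then obtain h k h' k' where *: "h \<in> H" "k \<in> H" "h' \<in> H" "k' \<in> H" "z = h \<otimes> (h' \<otimes> g \<otimes> k') \<otimes> k"
    using y by (auto simp: double_coset_def)
  then have "z = (h \<otimes> h') \<otimes> g \<otimes> (k' \<otimes> k)"
    using g by (simp add: m_assoc)
  then show "z \<in> D g" using * by (auto intro: D_I)
qed

lemma D_sym:
  assumes g: "g \<in> carrier G" and y: "y \<in> D g"
  shows "g \<in> D y"
proof -
  obtain h k where *: "h \<in> H" "k \<in> H" "y = h \<otimes> g \<otimes> k"
    using y by (auto simp: double_coset_def)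
  then have "g = inv h \<otimes> y \<otimes> inv k"
    using g by (simp add: m_assoc inv_solve_left)
  then show ?thesis using * by (metis D_I m_inv_closed)
qed

lemma D_eq:
  assumes "g \<in> carrier G" "y \<in> D g"
  shows "D y = D g"
  using D_mono[OF assms] D_mono[OF _ D_sym[OF assms]] D_subset assms by blast

lemma D_disjoint:
  assumes "g \<in> carrier G" "y \<in> carrier G" "y \<notin> D g"
  shows "D y \<inter> D g = {}"
  using assms D_eq D_self by blast

lemma mem_lcosetI: "h \<in> H \<Longrightarrow> g \<otimes> h \<in> g <# H"
  by (auto simp: l_coset_def)

lemma mem_rcosetI: "h \<in> H \<Longrightarrow> h \<otimes> g \<in> H #> g"
  by (auto simp: r_coset_def)

lemma lcoset_subset_D: "g \<in> carrier G \<Longrightarrow> g <# H \<subseteq> D g"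
  using D_I[of \<one> _ g] by (auto simp: l_coset_def)

lemma rcoset_subset_D: "g \<in> carrier G \<Longrightarrow> H #> g \<subseteq> D g"
  using D_I[of _ \<one> g] by (auto simp: r_coset_def)

lemma card_lcoset: "g \<in> carrier G \<Longrightarrow> card (g <# H) = card H"
  by (rule l_card_cosets_equal[symmetric]) (use subset fin in \<open>auto simp: LCOSETS_def\<close>)

lemma card_rcoset: "g \<in> carrier G \<Longrightarrow> card (H #> g) = card H"
  using card_cosets_equal[of "H #> g" H] subset rcosetsI[OF subset] by (metis bij_betw_same_card)

lemma lcoset_eq: "g \<in> carrier G \<Longrightarrow> y \<in> g <# H \<Longrightarrow> y <# H = g <# H"
  by (metis l_repr_independence subgroup_axioms)

lemma rcoset_eq: "g \<in> carrier G \<Longrightarrow> y \<in> H #> g \<Longrightarrow> H #> y = H #> g"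
  by (metis repr_independence subgroup_axioms)

text \<open>Left multiplication by \<open>h\<close> moves gH to yH and right multiplication by
  \<open>k'\<close> moves Hg to Ht, because the cosets absorb \<open>k\<close> and
  \<open>h'\<close>. One number therefore governs all intersections of left with right cosets within
  a double coset.\<close>

lemma card_inter_in_D:
  assumes g: "g \<in> carrier G" and y: "y \<in> D g" and t: "t \<in> D g"
  shows "card ((y <# H) \<inter> (H #> t)) = overlap g"
proof -
  obtain h k h' k' where *: "h \<in> H" "k \<in> H" "y = h \<otimes> g \<otimes> k" "h' \<in> H" "k' \<in> H" "t = h' \<otimes> g \<otimes> k'"
    using y t by (auto simp: double_coset_def)
  let ?y = "h \<otimes> g" and ?t = "g \<otimes> k'"
  have y': "y <# H = ?y <# H"
    using * g by (intro lcoset_eq) (auto simp: l_coset_def)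
  have t': "H #> t = H #> ?t"
    using * g by (intro rcoset_eq) (auto simp: r_coset_def m_assoc)
  have [simp]: "h \<in> carrier G" "k' \<in> carrier G" using * by auto
  have "bij_betw (\<lambda>z. h \<otimes> z \<otimes> k') ((g <# H) \<inter> (H #> g)) ((?y <# H) \<inter> (H #> ?t))"
  proof (rule bij_betwI[where g = "\<lambda>z. inv h \<otimes> z \<otimes> inv k'"])
    show "(\<lambda>z. h \<otimes> z \<otimes> k') \<in> (g <# H) \<inter> (H #> g) \<rightarrow> (?y <# H) \<inter> (H #> ?t)"
    proof clarify
      fix z assume "z \<in> g <# H" "z \<in> H #> g"
      then obtain u v where uv: "u \<in> H" "v \<in> H" "z = g \<otimes> u" "z = v \<otimes> g"
        by (auto simp: l_coset_def r_coset_def)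
      have "h \<otimes> z \<otimes> k' = ?y \<otimes> (u \<otimes> k')"
        unfolding uv(3) using uv(1,2) g by (simp add: m_assoc)
      moreover have "h \<otimes> z \<otimes> k' = (h \<otimes> v) \<otimes> ?t"
        unfolding uv(4) using uv(1,2) g by (simp add: m_assoc)
      moreover have "u \<otimes> k' \<in> H" "h \<otimes> v \<in> H" using * uv by auto
      ultimately show "h \<otimes> z \<otimes> k' \<in> (?y <# H) \<inter> (H #> ?t)"
        by (metis IntI mem_lcosetI mem_rcosetI)
    qed
    show "(\<lambda>z. inv h \<otimes> z \<otimes> inv k') \<in> (?y <# H) \<inter> (H #> ?t) \<rightarrow> (g <# H) \<inter> (H #> g)"
    proof clarify
      fix z assume "z \<in> ?y <# H" "z \<in> H #> ?t"
      then obtain u v where uv: "u \<in> H" "v \<in> H" "z = ?y \<otimes> u" "z = v \<otimes> ?t"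
        by (auto simp: l_coset_def r_coset_def)
      have "inv h \<otimes> z \<otimes> inv k' = g \<otimes> (u \<otimes> inv k')"
        using uv(1,2) g by (simp add: uv(3) m_assoc inv_solve_left')
      moreover have "inv h \<otimes> z \<otimes> inv k' = (inv h \<otimes> v) \<otimes> g"
        using uv(1,2) g by (simp add: uv(4) m_assoc)
      moreover have "u \<otimes> inv k' \<in> H" "inv h \<otimes> v \<in> H" using * uv by auto
      ultimately show "inv h \<otimes> z \<otimes> inv k' \<in> (g <# H) \<inter> (H #> g)"
        by (metis IntI mem_lcosetI mem_rcosetI)
    qed
    fix z
    { assume "z \<in> (g <# H) \<inter> (H #> g)"
      then have "z \<in> carrier G" using g by (auto simp: l_coset_def)
      then show "inv h \<otimes> (h \<otimes> z \<otimes> k') \<otimes> inv k' = z"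
        by (simp add: m_assoc inv_solve_left') }
    { assume "z \<in> (?y <# H) \<inter> (H #> ?t)"
      then have "z \<in> carrier G" using g by (auto simp: l_coset_def)
      then show "h \<otimes> (inv h \<otimes> z \<otimes> inv k') \<otimes> k' = z"
        by (simp add: m_assoc inv_solve_left' flip: m_assoc[of h]) }
  qed
  then show ?thesis by (simp add: y' t' overlap_def bij_betw_same_card)
qed

lemma inter_not_in_D:
  assumes g: "g \<in> carrier G" and t: "t \<in> carrier G" "t \<notin> D g"
  shows "(g <# H) \<inter> (H #> t) = {}"
  using lcoset_subset_D[OF g] rcoset_subset_D[OF t(1)] D_disjoint[OF g t] by blast

lemma finite_D: "g \<in> carrier G \<Longrightarrow> finite (D g)"
  using D_subset fin finite_subset by blast

lemma lefts_subset: "g \<in> carrier G \<Longrightarrow> lefts g \<subseteq> lcosets H"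
  using D_subset by (auto simp: lefts_def LCOSETS_def)

lemma lefts_iff:
  assumes g: "g \<in> carrier G" and y: "y \<in> carrier G"
  shows "y <# H \<in> lefts g \<longleftrightarrow> y \<in> D g"
proof
  assume "y <# H \<in> lefts g"
  then obtain z where z: "z \<in> D g" "y <# H = z <# H" by (auto simp: lefts_def)
  then have "y \<in> z <# H" using lcos_self[OF y subgroup_axioms] by auto
  then show "y \<in> D g"
    using lcoset_subset_D[of z] D_eq[OF g z(1)] D_subset[OF g] z(1) by auto
qed (auto simp: lefts_def)

lemma Union_lefts: assumes g: "g \<in> carrier G" shows "\<Union>(lefts g) = D g"
proof (intro equalityI subsetI)
  fix x assume "x \<in> \<Union>(lefts g)"
  then obtain y where "y \<in> D g" "x \<in> y <# H" by (auto simp: lefts_def)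
  then show "x \<in> D g"
    using lcoset_subset_D[of y] D_eq[OF g, of y] D_subset[OF g] by blast
next
  fix x assume x: "x \<in> D g"
  then have "x \<in> x <# H" using lcos_self[OF _ subgroup_axioms] D_subset[OF g] by blast
  with x show "x \<in> \<Union>(lefts g)" by (auto simp: lefts_def)
qed

lemma finite_lefts: "g \<in> carrier G \<Longrightarrow> finite (lefts g)"
  by (simp add: lefts_def finite_D)

lemma lefts_disjoint:
  assumes "g \<in> carrier G" "C \<in> lefts g" "C' \<in> lefts g" "C \<noteq> C'"
  shows "C \<inter> C' = {}"
  using assms lcos_disjoint[OF subgroup_axioms] lefts_subset by blast

lemma card_D: assumes g: "g \<in> carrier G" shows "card (D g) = card H * card (lefts g)"
proof -
  have "card H * card (lefts g) = card (\<Union>(lefts g))"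
    using lefts_subset[OF g] lefts_disjoint[OF g] finite_lefts[OF g]
    by (intro card_partition)
       (auto simp: Union_lefts[OF g] finite_D[OF g] intro!: l_card_cosets_equal[symmetric] subset[THEN subsetD] fin)
  then show ?thesis by (simp add: Union_lefts[OF g])
qed

text \<open>The left cosets in the double coset cut the right coset Hg into pieces of equal
  size.\<close>

lemma overlap_lefts: assumes g: "g \<in> carrier G" shows "overlap g * card (lefts g) = card H"
proof -
  have "H #> g = (\<Union>C\<in>lefts g. C \<inter> (H #> g))"
    using Union_lefts[OF g] rcoset_subset_D[OF g] by blast
  then have "card H = card (\<Union>C\<in>lefts g. C \<inter> (H #> g))"
    using card_rcoset[OF g] by simp
  also have "\<dots> = (\<Sum>C\<in>lefts g. card (C \<inter> (H #> g)))"
  proof (rule card_UN_disjoint)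
    show "\<forall>C\<in>lefts g. finite (C \<inter> (H #> g))"
      using fin rcosetsI[OF subset g] rcosets_carrier[OF group_axioms, of "H #> g"]
      by (auto intro: finite_subset)
  qed (use finite_lefts[OF g] lefts_disjoint[OF g] in auto)
  also have "\<dots> = (\<Sum>C\<in>lefts g. overlap g)"
    by (rule sum.cong) (auto simp: lefts_def card_inter_in_D[OF g _ D_self[OF g]])
  finally show ?thesis by (simp add: mult.commute)
qed

lemma overlap_pos: "g \<in> carrier G \<Longrightarrow> overlap g > 0"
  using overlap_lefts[of g] card_H_pos by (cases "overlap g") auto

lemma lefts_pos: "g \<in> carrier G \<Longrightarrow> card (lefts g) > 0"
  using overlap_lefts[of g] card_H_pos by (cases "card (lefts g)") auto

lemma lefts_1_iff:
  assumes g: "g \<in> carrier G"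
  shows "card (lefts g) = 1 \<longleftrightarrow> g <# H = H #> g"
proof
  have f: "finite (g <# H)" "finite (H #> g)"
    using lcoset_subset_D[OF g] rcoset_subset_D[OF g] finite_D[OF g] finite_subset by auto
  { assume "card (lefts g) = 1"
    then have "card ((g <# H) \<inter> (H #> g)) = card H"
      using overlap_lefts[OF g] by (simp add: overlap_def)
    then have "(g <# H) \<inter> (H #> g) = g <# H" "(g <# H) \<inter> (H #> g) = H #> g"
      using f card_lcoset[OF g] card_rcoset[OF g]
      by (metis Int_lower1 card_subset_eq, metis Int_lower2 card_subset_eq)
    then show "g <# H = H #> g" by simp }
  { assume "g <# H = H #> g"
    then have "overlap g = card H" using card_lcoset[OF g] by (simp add: overlap_def)
    then show "card (lefts g) = 1" using overlap_lefts[OF g] card_H_pos by auto }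
qed

lemma normal_iff: "H \<lhd> G \<longleftrightarrow> (\<forall>g\<in>carrier G. card (lefts g) = 1)"
  using lefts_1_iff by (auto simp: normal_def normal_axioms_def group_axioms subgroup_axioms)

lemma lefts_eq: "g \<in> carrier G \<Longrightarrow> y \<in> D g \<Longrightarrow> lefts y = lefts g"
  by (simp add: lefts_def D_eq)

section \<open>Counting common transversals one left coset at a time\<close>

abbreviation PT where "PT \<equiv> partial_transversals (\<lambda>x. H #> x)"

text \<open>An element of gH is blocked exactly when some \<open>t\<close> in \<open>T\<close> has
  the same right coset. Such \<open>t\<close> lie in HgH; they correspond to the left cosets of
  \<open>lefts g\<close> already in \<open>S\<close>, and they block disjoint sets of
  \<open>overlap g\<close> elements each. So the number of free elements depends on \<open>S\<close>
  alone, as the counting recursion requires.\<close>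

lemma card_free:
  assumes g: "g \<in> carrier G" and S: "S \<subseteq> lcosets H" and T: "T \<in> PT S"
  shows "card {x \<in> g <# H. H #> x \<notin> (\<lambda>x. H #> x) ` T} = card H - overlap g * card (lefts g \<inter> S)"
proof -
  have TG: "T \<subseteq> carrier G"
  proof -
    have "T \<subseteq> \<Union>S" using T by (simp add: partial_transversals_def)
    also have "\<dots> \<subseteq> carrier G" using S lcosets_part_G[OF subgroup_axioms] by blast
    finally show ?thesis .
  qed
  have finT: "finite T" using TG fin finite_subset by blast
  let ?B = "\<Union>t\<in>T \<inter> D g. (g <# H) \<inter> (H #> t)"
  have gH: "g <# H \<subseteq> carrier G" using lcoset_subset_D[OF g] D_subset[OF g] by auto
  have fing: "finite (g <# H)" using gH fin finite_subset by blast
  have "{x \<in> g <# H. H #> x \<notin> (\<lambda>x. H #> x) ` T} = (g <# H) - ?B"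
  proof (intro equalityI subsetI)
    fix x assume "x \<in> {x \<in> g <# H. H #> x \<notin> (\<lambda>x. H #> x) ` T}"
    then show "x \<in> (g <# H) - ?B" using rcoset_eq TG by blast
  next
    fix x assume x: "x \<in> (g <# H) - ?B"
    have "H #> x \<noteq> H #> t" if t: "t \<in> T" for t
    proof
      assume "H #> x = H #> t"
      then have "x \<in> H #> t" using rcos_self[OF _ subgroup_axioms] x gH by blast
      then show False using x t inter_not_in_D[OF g] TG by blast
    qed
    then show "x \<in> {x \<in> g <# H. H #> x \<notin> (\<lambda>x. H #> x) ` T}" using x by auto
  qed
  moreover have "card ?B = overlap g * card (lefts g \<inter> S)"
  proof -
    have "card ?B = (\<Sum>t\<in>T \<inter> D g. card ((g <# H) \<inter> (H #> t)))"
    proof (rule card_UN_disjoint)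
      show "\<forall>t\<in>T \<inter> D g. \<forall>t'\<in>T \<inter> D g. t \<noteq> t' \<longrightarrow> (g <# H) \<inter> (H #> t) \<inter> ((g <# H) \<inter> (H #> t')) = {}"
      proof (intro ballI impI)
        fix t t' assume t: "t \<in> T \<inter> D g" "t' \<in> T \<inter> D g" "t \<noteq> t'"
        then have "H #> t \<noteq> H #> t'" using T by (auto simp: partial_transversals_def inj_on_def)
        then have "(H #> t) \<inter> (H #> t') = {}"
          using rcoset_eq t TG by blast
        then show "(g <# H) \<inter> (H #> t) \<inter> ((g <# H) \<inter> (H #> t')) = {}" by auto
      qed
    qed (use finT fing in auto)
    also have "\<dots> = overlap g * card (T \<inter> D g)"
      using card_inter_in_D[OF g D_self[OF g]] by simp
    also have "card (T \<inter> D g) = card (lefts g \<inter> S)"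
    proof (rule bij_betw_same_card[of "\<lambda>t. t <# H"], rule bij_betw_imageI)
      have inS: "t <# H \<in> S" if "t \<in> T" for t
      proof -
        obtain C where "C \<in> S" "t \<in> C" using T \<open>t \<in> T\<close> by (auto simp: partial_transversals_def)
        moreover obtain y where "y \<in> carrier G" "C = y <# H"
          using S \<open>C \<in> S\<close> by (auto simp: LCOSETS_def)
        ultimately show ?thesis using lcoset_eq by simp
      qed
      show "inj_on (\<lambda>t. t <# H) (T \<inter> D g)"
      proof (rule inj_onI)
        fix t t' assume t: "t \<in> T \<inter> D g" "t' \<in> T \<inter> D g" "t <# H = t' <# H"
        then have "t \<in> t <# H" "t' \<in> t <# H"
          using lcos_self[OF _ subgroup_axioms] TG by blast+
        moreover have "\<exists>!x. x \<in> T \<and> x \<in> t <# H"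
          using T inS t by (auto simp: partial_transversals_def)
        ultimately show "t = t'" using t by blast
      qed
      show "(\<lambda>t. t <# H) ` (T \<inter> D g) = lefts g \<inter> S"
      proof (intro equalityI subsetI)
        fix C assume C: "C \<in> lefts g \<inter> S"
        then obtain x where x: "x \<in> T" "x \<in> C" using T by (auto simp: partial_transversals_def)
        obtain y where y: "y \<in> D g" "C = y <# H" using C by (auto simp: lefts_def)
        then have "x <# H = C" using lcoset_eq x D_subset[OF g] by blast
        moreover have "x \<in> D g" using x C Union_lefts[OF g] by auto
        ultimately show "C \<in> (\<lambda>t. t <# H) ` (T \<inter> D g)" using x by blast
      qed (use inS in \<open>auto simp: lefts_def\<close>)
    qed
    finally show ?thesis .
  qed
  moreover have "?B \<subseteq> g <# H" by auto
  ultimately show ?thesis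
    using fing by (simp add: card_Diff_subset finite_subset card_lcoset[OF g])
qed

lemma card_PT_insert:
  assumes g: "g \<in> carrier G" and S: "S \<subseteq> lcosets H" "g <# H \<notin> S"
  shows "card (PT (insert (g <# H) S)) = card (PT S) * (card H - overlap g * card (lefts g \<inter> S))"
proof (rule card_partial_transversals_insert)
  have L: "insert (g <# H) S \<subseteq> lcosets H" using S g by (auto simp: LCOSETS_def)
  then show "finite (\<Union>(insert (g <# H) S))"
    using fin lcosets_part_G[OF subgroup_axioms] by (metis Union_mono finite_subset)
  show "(g <# H) \<inter> C = {}" if "C \<in> S" for C
    using lcos_disjoint[OF subgroup_axioms, of "g <# H" C] that L S by auto
qed (rule card_free[OF g S(1)])

lemma finite_lcosets: "finite (lcosets H)"
  using fin by (simp add: LCOSETS_def)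

lemma card_PT_le:
  assumes S: "S \<subseteq> lcosets H"
  shows "card (PT S) \<le> card H ^ card S"
proof -
  have "finite S" using finite_lcosets S finite_subset by blast
  then show ?thesis using S
  proof (induction S)
    case empty
    have "PT {} = {{}}" by (auto simp: partial_transversals_def)
    then show ?case by simp
  next
    case (insert C S)
    then obtain g where "g \<in> carrier G" "C = g <# H" by (auto simp: LCOSETS_def)
    then have "card (PT (insert C S)) \<le> card (PT S) * card H"
      using card_PT_insert[of g S] insert by (auto intro: mult_left_mono)
    also have "\<dots> \<le> card H ^ card (insert C S)"
      using insert by simp
    finally show ?case .
  qed
qed

text \<open>With at most one left coset from each double coset, no earlier choice blocks a later
  one, so each pick has |H| options.\<close>

lemma card_PT_eq:
  assumes S: "S \<subseteq> lcosets H"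
    and one: "\<And>g. g \<in> carrier G \<Longrightarrow> card (lefts g \<inter> S) \<le> 1"
  shows "card (PT S) = card H ^ card S"
proof -
  have "finite S" using finite_lcosets S finite_subset by blast
  then show ?thesis using S one
  proof (induction S)
    case empty
    have "PT {} = {{}}" by (auto simp: partial_transversals_def)
    then show ?case by simp
  next
    case (insert C S)
    then obtain g where g: "g \<in> carrier G" "C = g <# H" by (auto simp: LCOSETS_def)
    have fi: "finite (lefts g \<inter> S)" using finite_lefts[OF g(1)] by simp
    have "C \<in> lefts g" using g D_self lefts_iff by simp
    then have "card (lefts g \<inter> insert C S) = Suc (card (lefts g \<inter> S))"
      using insert(2) fi by simp
    then have "card (lefts g \<inter> S) = 0" using insert.prems(2)[OF g(1)] by simp
    then have "card (PT (insert C S)) = card (PT S) * card H"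
      using card_PT_insert[of g S] g insert by auto
    also have "card (PT S) = card H ^ card S"
    proof (rule insert.IH)
      fix y assume "y \<in> carrier G"
      then show "card (lefts y \<inter> S) \<le> 1"
        using insert.prems(2)[of y] card_mono[of "lefts y \<inter> insert C S" "lefts y \<inter> S"] finite_lefts[of y]
        by (meson Int_mono finite_Int le_trans order_refl subset_insertI)
    qed (use insert in auto)
    finally show ?case using insert by simp
  qed
qed

text \<open>By \<open>overlap_lefts\<close>, gH consists of \<open>card (lefts g)\<close> blocks of
  size \<open>overlap g\<close>; all but one of them are blocked when gH is the last left coset of
  its double coset.\<close>

lemma card_PT_last:
  assumes g: "g \<in> carrier G" and S: "S \<subseteq> lcosets H" "g <# H \<notin> S"
    and last: "lefts g \<subseteq> insert (g <# H) S"
  shows "card (PT (insert (g <# H) S)) = card (PT S) * overlap g"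
proof -
  have "lefts g \<inter> S = lefts g - {g <# H}" using S last by auto
  moreover have "g <# H \<in> lefts g" using g D_self lefts_iff by simp
  ultimately have "card (lefts g \<inter> S) = card (lefts g) - 1"
    using finite_lefts[OF g] by simp
  then have "card H - overlap g * card (lefts g \<inter> S) = overlap g"
    using overlap_lefts[OF g] lefts_pos[OF g]
    by (metis One_nat_def Suc_pred add_diff_cancel_right' mult_Suc_right)
  then show ?thesis using card_PT_insert[OF g S] by simp
qed

lemma card_rcosets_lcosets: "card (rcosets H) = card (lcosets H)"
  using lagrange_finite[OF fin subgroup_axioms] l_lagrange[OF fin subgroup_axioms] card_H_pos
  by (metis mult_cancel2 less_numeral_extra(3))

text \<open>A left transversal has as many elements as there are left cosets, hence as many as there
  are right cosets. An injective map from it to the right cosets is thus onto.\<close>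

lemma DT_eq_PT: "DT G H = PT (lcosets H)"
proof (intro equalityI subsetI)
  fix T assume T: "T \<in> DT G H"
  then have TG: "T \<subseteq> carrier G" by (simp add: DT_def left_transversal_def)
  have "inj_on (\<lambda>x. H #> x) T"
  proof (rule inj_onI)
    fix x y assume xy: "x \<in> T" "y \<in> T" "H #> x = H #> y"
    then have "\<exists>!z. z \<in> T \<and> z \<in> H #> x"
      using T TG unfolding DT_def right_transversal_def RCOSETS_def by blast
    moreover have "x \<in> H #> x" "y \<in> H #> x"
      using xy TG rcos_self[OF _ subgroup_axioms] by auto
    ultimately show "x = y" using xy by blast
  qed
  then show "T \<in> PT (lcosets H)"
    using T lcosets_part_G[OF subgroup_axioms]
    by (auto simp: DT_def left_transversal_def partial_transversals_def)
next
  fix T assume T: "T \<in> PT (lcosets H)"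
  then have TG: "T \<subseteq> carrier G"
    using lcosets_part_G[OF subgroup_axioms] by (auto simp: partial_transversals_def)
  have one: "\<exists>!x. x \<in> T \<and> x \<in> C" if "C \<in> lcosets H" for C
    using T that by (auto simp: partial_transversals_def)
  have inj: "inj_on (\<lambda>x. H #> x) T" using T by (auto simp: partial_transversals_def)
  have "bij_betw (\<lambda>x. x <# H) T (lcosets H)"
  proof (rule bij_betw_imageI)
    have xH: "x <# H \<in> lcosets H" "x \<in> x <# H" if "x \<in> T" for x
      using that TG lcos_self[OF _ subgroup_axioms] by (auto simp: LCOSETS_def)
    show "inj_on (\<lambda>x. x <# H) T"
      using one xH by (metis (no_types, lifting) inj_onI)
    show "(\<lambda>x. x <# H) ` T = lcosets H"
    proof (intro equalityI subsetI)
      fix C assume C: "C \<in> lcosets H"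
      then obtain x where "x \<in> T" "x \<in> C" using one by blast
      moreover obtain y where "y \<in> carrier G" "C = y <# H" using C by (auto simp: LCOSETS_def)
      ultimately show "C \<in> (\<lambda>x. x <# H) ` T" using lcoset_eq by auto
    qed (use xH in auto)
  qed
  then have "card ((\<lambda>x. H #> x) ` T) = card (rcosets H)"
    using card_image[OF inj] card_rcosets_lcosets by (simp add: bij_betw_same_card)
  moreover have "(\<lambda>x. H #> x) ` T \<subseteq> rcosets H" using TG by (auto simp: RCOSETS_def)
  moreover have "finite (rcosets H)" using fin by (simp add: RCOSETS_def)
  ultimately have im: "(\<lambda>x. H #> x) ` T = rcosets H" by (simp add: card_subset_eq)
  have "\<exists>!x. x \<in> T \<and> x \<in> C" if "C \<in> rcosets H" for C
  proof -
    from that im obtain x where x: "x \<in> T" "C = H #> x" by auto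
    then have "x \<in> C" using rcos_self[OF _ subgroup_axioms] TG by blast
    moreover have "y = x" if "y \<in> T" "y \<in> C" for y
      using that x inj rcoset_eq TG by (metis (no_types, lifting) inj_onD subsetD)
    ultimately show ?thesis using x by blast
  qed
  then show "T \<in> DT G H"
    using one TG by (auto simp: DT_def left_transversal_def right_transversal_def)
qed

lemma transversal_prob_eq:
  "transversal_prob G H = real (card (PT (lcosets H))) / real (card H) ^ card (lcosets H)"
  by (simp add: transversal_prob_def DT_eq_PT card_rcosets_lcosets)

lemma transversal_prob_normal:
  assumes "H \<lhd> G" shows "transversal_prob G H = 1"
proof -
  have "card (lefts g \<inter> lcosets H) \<le> 1" if g: "g \<in> carrier G" for g
    using assms g normal_iff card_mono[OF finite_lefts[OF g], of "lefts g \<inter> lcosets H"] by auto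
  then have "card (PT (lcosets H)) = card H ^ card (lcosets H)"
    by (intro card_PT_eq) auto
  then show ?thesis using card_H_pos by (simp add: transversal_prob_eq)
qed

lemma insert_lcoset:
  assumes "g \<in> carrier G"
  shows "insert (g <# H) (lcosets H - {g <# H}) = lcosets H"
    "card (lcosets H) = Suc (card (lcosets H - {g <# H}))"
proof -
  have "g <# H \<in> lcosets H" using assms by (auto simp: LCOSETS_def)
  then show "insert (g <# H) (lcosets H - {g <# H}) = lcosets H"
    "card (lcosets H) = Suc (card (lcosets H - {g <# H}))"
    using finite_lcosets card.remove[of "lcosets H" "g <# H"] by (simp_all add: insert_absorb)
qed

text \<open>Without gH there is at most one left coset per double coset, so all these picks are
  unrestricted; gH comes last and has \<open>overlap g\<close> options, half of |H|.\<close>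

lemma transversal_prob_half:
  assumes g: "g \<in> carrier G" and two: "card (lefts g) = 2"
    and others: "\<And>y. y \<in> carrier G \<Longrightarrow> y \<notin> D g \<Longrightarrow> card (lefts y) = 1"
  shows "transversal_prob G H = 1 / 2"
proof -
  let ?S = "lcosets H - {g <# H}"
  have "card (lefts y \<inter> ?S) \<le> 1" if y: "y \<in> carrier G" for y
  proof (cases "y \<in> D g")
    case True
    have "g <# H \<in> lefts g" using g D_self lefts_iff by simp
    then have "card (lefts g - {g <# H}) = 1" using two finite_lefts[OF g] by simp
    moreover have "lefts y \<inter> ?S \<subseteq> lefts g - {g <# H}" using lefts_eq[OF g True] by auto
    ultimately show ?thesis using finite_lefts[OF g] by (metis card_mono finite_Diff)
  next
    case False
    then show ?thesis
      using others[OF y] card_mono[OF finite_lefts[OF y], of "lefts y \<inter> ?S"] by auto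
  qed
  then have "card (PT ?S) = card H ^ card ?S" by (intro card_PT_eq) auto
  then have "card (PT (lcosets H)) = card H ^ card ?S * overlap g"
    using card_PT_last[OF g, of ?S] insert_lcoset(1)[OF g] lefts_subset[OF g] by auto
  moreover have "card H = 2 * overlap g" using overlap_lefts[OF g] two by simp
  ultimately show ?thesis
    using card_H_pos by (simp add: transversal_prob_eq insert_lcoset(2)[OF g] field_simps)
qed

text \<open>Picking from gH last bounds the probability by 1 / \<open>card (lefts g)\<close>, so
  this number is at most 2. Picking from some yH of another double coset just before bounds it by 1
  / (2 * \<open>card (lefts y)\<close>), so the second number is 1.\<close>

lemma transversal_prob_ge_half:
  assumes half: "transversal_prob G H \<ge> 1 / 2" and g: "g \<in> carrier G" and ne: "card (lefts g) \<noteq> 1"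
  shows "card (lefts g) = 2"
    and "\<And>y. y \<in> carrier G \<Longrightarrow> y \<notin> D g \<Longrightarrow> card (lefts y) = 1"
proof -
  let ?S = "lcosets H - {g <# H}"
  let ?h = "card H"
  have ge: "?h ^ card (lcosets H) \<le> 2 * card (PT (lcosets H))"
    using half card_H_pos
    by (simp add: transversal_prob_eq divide_simps del: of_nat_power flip: of_nat_power)
  have PT: "card (PT (lcosets H)) = card (PT ?S) * overlap g"
    using card_PT_last[OF g, of ?S] insert_lcoset(1)[OF g] lefts_subset[OF g] by auto
  have "?h ^ card ?S * ?h \<le> 2 * (card (PT ?S) * overlap g)"
    using ge unfolding PT insert_lcoset(2)[OF g] power_Suc2 .
  also have "\<dots> \<le> 2 * (?h ^ card ?S * overlap g)"
    by (intro mult_le_mono card_PT_le) auto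
  finally have "?h ^ card ?S * ?h \<le> ?h ^ card ?S * (2 * overlap g)"
    by (simp only: mult.left_commute[of 2])
  then have "?h \<le> 2 * overlap g" using card_H_pos by simp
  then have "card (lefts g) \<le> 2"
    using overlap_lefts[OF g] overlap_pos[OF g] by (metis mult.commute mult_le_cancel2)
  then show two: "card (lefts g) = 2" using ne lefts_pos[OF g] by linarith
  fix y assume y: "y \<in> carrier G" "y \<notin> D g"
  let ?S' = "?S - {y <# H}"
  have "y <# H \<noteq> g <# H" using y lefts_iff[OF g] D_self[OF g] g by metis
  then have yS: "y <# H \<in> ?S" using y by (auto simp: LCOSETS_def)
  \<comment> \<open>Removing gH takes nothing from HyH, so yH is still the last left coset of its
    double coset within \<open>?S\<close>.\<close>
  have gy: "g <# H \<notin> lefts y" using lefts_iff[OF y(1) g] y D_sym D_self g by blast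
  have "card (PT ?S) = card (PT ?S') * overlap y"
    using card_PT_last[OF y(1), of ?S'] insert_Diff[OF yS] lefts_subset[OF y(1)] gy by auto
  moreover have "card (PT ?S') \<le> ?h ^ card ?S'" by (rule card_PT_le) auto
  moreover have "card ?S = Suc (card ?S')" using card.remove[OF _ yS] finite_lcosets by simp
  ultimately have "?h ^ card ?S' * (?h * ?h) \<le> 2 * (card (PT ?S') * overlap y * overlap g)"
    using ge unfolding PT insert_lcoset(2)[OF g] by (simp only: power_Suc2 mult.assoc)
  also have "\<dots> \<le> 2 * (?h ^ card ?S' * overlap y * overlap g)"
    by (intro mult_le_mono card_PT_le) auto
  also have "\<dots> = ?h ^ card ?S' * (2 * overlap y * overlap g)"
    by (simp only: mult_ac)
  finally have "?h * ?h \<le> 2 * overlap y * overlap g" using card_H_pos by simp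
  also have "?h * ?h = (overlap y * card (lefts y)) * (overlap g * 2)"
    using overlap_lefts[OF g] overlap_lefts[OF y(1)] two by simp
  also have "\<dots> = (2 * overlap y * overlap g) * card (lefts y)"
    by (simp only: mult_ac)
  finally have "(2 * overlap y * overlap g) * card (lefts y) \<le> (2 * overlap y * overlap g) * 1"
    by simp
  then have "card (lefts y) \<le> 1"
    using overlap_pos[OF g] overlap_pos[OF y(1)] by (subst (asm) mult_le_cancel1) simp
  then show "card (lefts y) = 1" using lefts_pos[OF y(1)] by simp
qed

section \<open>The index of a non-normal subgroup and the value 1/2\<close>

lemma D_disjoint_subgroup:
  assumes "g \<in> carrier G" "g \<notin> H" shows "D g \<inter> H = {}"
proof -
  have "D \<one> = H"
  proof (intro equalityI subsetI)
    fix x assume "x \<in> H" then show "x \<in> D \<one>" using D_I[of x \<one> \<one>] by simp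
  qed (auto simp: double_coset_def)
  then show ?thesis using D_disjoint[of \<one> g] assms by simp
qed

text \<open>|H| is twice \<open>overlap g\<close>, hence even. The normaliser has |G| - 2|H|
  elements and its order divides |G|, so it divides 2|H|; being also a multiple of |H|, it is |H| or
  2|H|. Adding 2|H| gives |G|.\<close>

lemma nonnormal_ge_half:
  assumes half: "transversal_prob G H \<ge> 1 / 2" and nonnormal: "\<not> H \<lhd> G"
  shows "even (card H)" and "order G = 3 * card H \<or> order G = 4 * card H"
proof -
  obtain g where g: "g \<in> carrier G" "card (lefts g) \<noteq> 1" using nonnormal normal_iff by auto
  note two = transversal_prob_ge_half(1)[OF half g]
  note others = transversal_prob_ge_half(2)[OF half g]
  show "even (card H)" using overlap_lefts[OF g(1)] two by (metis dvd_triv_right)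
  let ?N = "carrier G - D g"
  have Neq: "?N = {y \<in> carrier G. y <# H = H #> y}"
  proof (intro equalityI subsetI)
    fix y assume "y \<in> ?N"
    then show "y \<in> {y \<in> carrier G. y <# H = H #> y}" using others[of y] lefts_1_iff[of y] by simp
  next
    fix y assume "y \<in> {y \<in> carrier G. y <# H = H #> y}"
    then show "y \<in> ?N" using lefts_eq[OF g(1), of y] lefts_1_iff[of y] two by auto
  qed
  have "subgroup ?N G"
  proof (unfold Neq, rule subgroupI)
    show "{y \<in> carrier G. y <# H = H #> y} \<noteq> {}"
      using lcos_mult_one[OF subset] coset_mult_one[OF subset] by auto
    fix y assume y: "y \<in> {y \<in> carrier G. y <# H = H #> y}"
    then have "inv y <# (y <# H) #> inv y = inv y <# (H #> y) #> inv y" by simp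
    moreover have "inv y <# (y <# H) = H"
      using y lcos_m_assoc[OF subset, of "inv y" y] lcos_mult_one[OF subset] by auto
    moreover have "inv y <# (H #> y) #> inv y = inv y <# ((H #> y) #> inv y)"
      using y subset by (intro coset_assoc[symmetric] r_coset_subset_G) auto
    moreover have "(H #> y) #> inv y = H"
      using y coset_mult_assoc[OF subset, of y "inv y"] coset_mult_one[OF subset] by auto
    ultimately show "inv y \<in> {y \<in> carrier G. y <# H = H #> y}" using y by simp
    fix z assume z: "z \<in> {y \<in> carrier G. y <# H = H #> y}"
    have "y \<otimes> z <# H = y <# (z <# H)" using y z lcos_m_assoc[OF subset, of y z] by auto
    also have "\<dots> = y <# (H #> z)" using z by simp
    also have "\<dots> = (y <# H) #> z" using y z coset_assoc[OF _ _ subset, of y z] by auto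
    also have "\<dots> = H #> (y \<otimes> z)" using y z coset_mult_assoc[OF subset, of y z] by auto
    finally show "y \<otimes> z \<in> {y \<in> carrier G. y <# H = H #> y}" using y z by simp
  qed auto
  then interpret N: subgroup ?N G .
  have ord: "order G = card ?N + 2 * card H"
    using card_D[OF g(1)] two card_Diff_subset[OF finite_D D_subset] g(1) card_mono[OF fin D_subset[OF g(1)]]
    by (simp add: order_def)
  have "card ?N dvd order G" using lagrange_finite[OF fin N.subgroup_axioms] by (metis dvd_triv_right)
  then have "card ?N dvd 2 * card H" by (simp only: ord dvd_add_triv_left_iff)
  moreover have "card H dvd card ?N"
  proof -
    have "H \<subseteq> ?N"
    proof
      fix x assume "x \<in> H"
      then show "x \<in> ?N"
        unfolding Neq using coset_join2[OF _ subgroup_axioms, of x] coset_join3[OF _ subgroup_axioms, of x] by simp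
    qed
    then have "subgroup H (G \<lparr>carrier := ?N\<rparr>)"
      using subgroup_incl N.subgroup_axioms subgroup_axioms by blast
    then have "card (rcosets\<^bsub>G \<lparr>carrier := ?N\<rparr>\<^esub> H) * card H = card ?N"
      using group.lagrange_finite[OF N.subgroup_is_group[OF group_axioms], of H] fin
      by (simp add: order_def)
    then show ?thesis by (metis dvd_triv_right)
  qed
  then obtain c where c: "card ?N = card H * c" ..
  ultimately have "c dvd 2" using card_H_pos by (simp add: mult.commute)
  then have "c = 1 \<or> c = 2" by (metis prime_nat_iff two_is_prime_nat)
  then show "order G = 3 * card H \<or> order G = 4 * card H" using ord c by auto
qed

lemma card_Un_D:
  assumes g: "g \<in> carrier G" and K: "K \<subseteq> carrier G" "D g \<inter> K = {}"
  shows "card H * card (lefts g) + card K \<le> order G"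
    and "card H * card (lefts g) + card K = order G \<Longrightarrow> carrier G = D g \<union> K"
proof -
  have "card (D g \<union> K) = card H * card (lefts g) + card K"
    using K fin by (subst card_Un_disjoint) (auto simp: finite_D g card_D intro: finite_subset)
  moreover have "D g \<union> K \<subseteq> carrier G" using K D_subset g by auto
  note card_mono[OF fin this] card_subset_eq[OF fin this]
  ultimately show "card H * card (lefts g) + card K \<le> order G"
    "card H * card (lefts g) + card K = order G \<Longrightarrow> carrier G = D g \<union> K"
    by (simp_all add: order_def)
qed

lemma lefts_1_in_H: "y \<in> H \<Longrightarrow> card (lefts y) = 1"
  using lefts_1_iff coset_join2 coset_join3 subset subgroup_axioms mem_carrier by auto

lemma nonnormal_lefts:
  assumes nonnormal: "\<not> H \<lhd> G"
  obtains g where "g \<in> carrier G" "card (lefts g) \<ge> 2" "D g \<inter> H = {}"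
proof -
  obtain g where g: "g \<in> carrier G" "card (lefts g) \<noteq> 1" using nonnormal normal_iff by auto
  moreover have "g \<notin> H" using lefts_1_in_H g by blast
  ultimately show ?thesis using that D_disjoint_subgroup lefts_pos[of g] by force
qed

lemma normal_of_index_2:
  assumes "order G = 2 * card H" shows "H \<lhd> G"
proof (rule ccontr)
  assume "\<not> H \<lhd> G"
  then obtain g where g: "g \<in> carrier G" "card (lefts g) \<ge> 2" "D g \<inter> H = {}"
    by (rule nonnormal_lefts)
  have "card H * 2 \<le> card H * card (lefts g)" using g by simp
  then show False
    using card_Un_D(1)[OF g(1) subset g(3)] assms card_H_pos by linarith
qed

text \<open>A double coset outside H with at least two left cosets already fills the complement of
  H.\<close>

lemma nonnormal_index_3:
  assumes "\<not> H \<lhd> G" "order G = 3 * card H"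
  shows "transversal_prob G H = 1 / 2"
proof -
  obtain g where g: "g \<in> carrier G" "card (lefts g) \<ge> 2" "D g \<inter> H = {}"
    by (rule nonnormal_lefts[OF assms(1)])
  have "card H * card (lefts g) \<le> card H * 2"
    using card_Un_D(1)[OF g(1) subset g(3)] assms by linarith
  then have two: "card (lefts g) = 2" using g card_H_pos by simp
  then have "carrier G = D g \<union> H"
    using card_Un_D(2)[OF g(1) subset g(3)] assms by simp
  then show ?thesis using transversal_prob_half[OF g(1) two] lefts_1_in_H by blast
qed

text \<open>A double coset outside H with more than one left coset has 2 or 3 of them, and 3 would
  divide |H| by \<open>overlap_lefts\<close>. With 2, the remaining |H| elements form one double
  coset that is a single left coset.\<close>

lemma nonnormal_index_4:
  assumes "\<not> H \<lhd> G" "order G = 4 * card H" "\<not> 3 dvd card H"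
  shows "transversal_prob G H = 1 / 2"
proof -
  obtain g where g: "g \<in> carrier G" "card (lefts g) \<ge> 2" "D g \<inter> H = {}"
    by (rule nonnormal_lefts[OF assms(1)])
  have "card H * card (lefts g) \<le> card H * 3"
    using card_Un_D(1)[OF g(1) subset g(3)] assms by linarith
  then have "card (lefts g) \<le> 3" using card_H_pos by simp
  moreover have "card (lefts g) \<noteq> 3" using overlap_lefts[OF g(1)] assms(3) by (metis dvd_triv_right)
  ultimately have two: "card (lefts g) = 2" using g by simp
  have cK: "card (D g \<union> H) = 3 * card H"
    using g finite_D finite_H card_D two by (subst card_Un_disjoint) auto
  have "D g \<union> H \<noteq> carrier G"
    using cK assms card_H_pos by (auto simp: order_def)
  then obtain z where z: "z \<in> carrier G" "z \<notin> D g" "z \<notin> H"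
    using D_subset[OF g(1)] subset by auto
  have dz: "D z \<inter> (D g \<union> H) = {}"
    using D_disjoint[OF g(1) z(1,2)] D_disjoint_subgroup[OF z(1,3)] by auto
  have K: "D g \<union> H \<subseteq> carrier G" using D_subset[OF g(1)] subset by auto
  have "card H * card (lefts z) \<le> card H * 1"
    using card_Un_D(1)[OF z(1) K dz] assms cK by linarith
  then have onez: "card (lefts z) = 1" using lefts_pos[OF z(1)] card_H_pos by simp
  then have "carrier G = D z \<union> (D g \<union> H)"
    using card_Un_D(2)[OF z(1) K dz] assms cK by simp
  then have "card (lefts y) = 1" if "y \<in> carrier G" "y \<notin> D g" for y
    using that lefts_1_in_H onez lefts_eq[OF z(1)] by auto
  then show ?thesis using transversal_prob_half[OF g(1) two] by blast
qed

end

section \<open>Groups with a cyclic subgroup inverted by a second generator\<close>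

text \<open>The common shape of the four families: (m, s, r) is (3, 2^n, 0), (4, 2, 0), (8, 2, 4) or
  (4, 4, 0). The power a^r accommodates the quaternion relation b^2 = a^4; for r = 0 it is the empty
  word.\<close>

definition inverting_rels :: "nat \<Rightarrow> nat \<Rightarrow> nat \<Rightarrow> (gen letter list \<times> gen letter list) set" where
  "inverting_rels m s r = {(replicate m (Pos gen.a), []),
     (replicate s (Pos gen.b), replicate r (Pos gen.a)),
     ([Neg gen.b, Pos gen.a, Pos gen.b], [Neg gen.a])}"

definition inverting_pair ::
    "('a, 'b) monoid_scheme \<Rightarrow> nat \<Rightarrow> nat \<Rightarrow> nat \<Rightarrow> 'a \<Rightarrow> 'a \<Rightarrow> bool" where
  "inverting_pair G m s r A B \<longleftrightarrow> A \<in> carrier G \<and> B \<in> carrier G \<and> A [^]\<^bsub>G\<^esub> m = \<one>\<^bsub>G\<^esub> \<and>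
     B [^]\<^bsub>G\<^esub> s = A [^]\<^bsub>G\<^esub> r \<and> A \<otimes>\<^bsub>G\<^esub> B = B \<otimes>\<^bsub>G\<^esub> inv\<^bsub>G\<^esub> A"

text \<open>The infinite group \<open>\<langle>a, b | b\<^sup>-\<^sup>1 a b = a\<^sup>-\<^sup>1\<rangle>\<close> on pairs \<open>(i, j)\<close> standing for \<open>b\<^sup>i a\<^sup>j\<close>, and the
  congruence on it that the remaining two relations generate.\<close>

definition exp_mult :: "int \<times> int \<Rightarrow> int \<times> int \<Rightarrow> int \<times> int" where
  "exp_mult p q = (fst p + fst q, (if even (fst q) then snd p else - snd p) + snd q)"

fun letter_exp :: "gen letter \<Rightarrow> int \<times> int" where
  "letter_exp (Pos gen.a) = (0, 1)"
| "letter_exp (Neg gen.a) = (0, -1)"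
| "letter_exp (Pos gen.b) = (1, 0)"
| "letter_exp (Neg gen.b) = (-1, 0)"

fun word_exp :: "gen letter list \<Rightarrow> int \<times> int" where
  "word_exp [] = (0, 0)"
| "word_exp (l # w) = exp_mult (letter_exp l) (word_exp w)"

definition exp_cong :: "nat \<Rightarrow> nat \<Rightarrow> nat \<Rightarrow> int \<times> int \<Rightarrow> int \<times> int \<Rightarrow> bool" where
  "exp_cong m s r p q \<longleftrightarrow>
     (\<exists>t. fst q = fst p + int s * t \<and> int m dvd snd q - snd p + int r * t)"

lemma exp_mult_assoc: "exp_mult (exp_mult p q) w = exp_mult p (exp_mult q w)"
  by (auto simp: exp_mult_def)

lemma word_exp_append: "word_exp (u @ v) = exp_mult (word_exp u) (word_exp v)"
  by (induction u) (auto simp: exp_mult_assoc, simp add: exp_mult_def)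

lemma word_exp_replicate_a: "word_exp (replicate n (Pos gen.a)) = (0, int n)"
  by (induction n) (auto simp: exp_mult_def)

lemma word_exp_replicate_b: "word_exp (replicate n (Pos gen.b)) = (int n, 0)"
  by (induction n) (auto simp: exp_mult_def)

lemma exp_cong_refl: "exp_cong m s r p p"
  by (auto simp: exp_cong_def intro: exI[of _ 0])

lemma exp_cong_sym:
  assumes "exp_cong m s r p q" shows "exp_cong m s r q p"
proof -
  obtain t where t: "fst q = fst p + int s * t" "int m dvd snd q - snd p + int r * t"
    using assms by (auto simp: exp_cong_def)
  have "int m dvd - (snd q - snd p + int r * t)" using t(2) by (simp only: dvd_minus_iff)
  then show ?thesis
    unfolding exp_cong_def using t(1) by (intro exI[of _ "-t"]) (simp add: algebra_simps)
qed

lemma exp_cong_trans: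
  assumes "exp_cong m s r p q" "exp_cong m s r q w" shows "exp_cong m s r p w"
proof -
  obtain t t' where t: "fst q = fst p + int s * t" "int m dvd snd q - snd p + int r * t"
    "fst w = fst q + int s * t'" "int m dvd snd w - snd q + int r * t'"
    using assms unfolding exp_cong_def by blast
  have "int m dvd (snd q - snd p + int r * t) + (snd w - snd q + int r * t')"
    using t by (simp only: dvd_add)
  then show ?thesis
    unfolding exp_cong_def using t(1,3) by (intro exI[of _ "t + t'"]) (simp add: algebra_simps)
qed

text \<open>The parity of the first exponent decides a sign, so shifts by multiples of
  \<open>s\<close> must preserve it, whence \<open>even s\<close>. Where the sign is -1, the shift
  \<open>r * t\<close> of the second exponent is negated; the discrepancy \<open>2 * r * t\<close>
  is absorbed by \<open>m dvd 2 * r\<close>.\<close>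

lemma exp_cong_mult:
  assumes s: "even s" and r: "m dvd 2 * r"
    and "exp_cong m s r p q" "exp_cong m s r p' q'"
  shows "exp_cong m s r (exp_mult p p') (exp_mult q q')"
proof -
  obtain t t' where t: "fst q = fst p + int s * t" "int m dvd snd q - snd p + int r * t"
    "fst q' = fst p' + int s * t'" "int m dvd snd q' - snd p' + int r * t'"
    using assms unfolding exp_cong_def by blast
  have par: "even (fst q') \<longleftrightarrow> even (fst p')" using t(3) s by simp
  have r2: "int m dvd 2 * int r * t"
    using r by (metis dvd_mult2 int_dvd_int_iff of_nat_mult of_nat_numeral)
  have "int m dvd snd (exp_mult q q') - snd (exp_mult p p') + int r * (t + t')"
  proof (cases "even (fst p')")
    case True
    have "int m dvd (snd q - snd p + int r * t) + (snd q' - snd p' + int r * t')"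
      using t by (simp only: dvd_add)
    then show ?thesis using True par by (simp add: exp_mult_def algebra_simps)
  next
    case False
    have "int m dvd (snd q' - snd p' + int r * t') - (snd q - snd p + int r * t) + 2 * int r * t"
      using t r2 by (simp only: dvd_add dvd_diff)
    then show ?thesis using False par by (simp add: exp_mult_def algebra_simps)
  qed
  then show ?thesis
    unfolding exp_cong_def using t(1,3)
    by (intro exI[of _ "t + t'"]) (simp add: exp_mult_def algebra_simps)
qed

text \<open>The invariant that keeps the presentation from collapsing: words with incongruent
  exponents represent different elements.\<close>

lemma word_eq_exp_cong:
  assumes s: "even s" and r: "m dvd 2 * r" and "word_eq (inverting_rels m s r) u v"
  shows "exp_cong m s r (word_exp u) (word_exp v)"
  using assms(3)
proof (induction rule: word_eq.induct)
  case (rel u v)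
  then consider "u = replicate m (Pos gen.a)" "v = []"
    | "u = replicate s (Pos gen.b)" "v = replicate r (Pos gen.a)"
    | "u = [Neg gen.b, Pos gen.a, Pos gen.b]" "v = [Neg gen.a]"
    by (auto simp: inverting_rels_def)
  then show ?case
  proof cases
    case 1
    then show ?thesis
      by (simp only: word_exp_replicate_a) (auto simp: exp_cong_def intro: exI[of _ 0])
  next
    case 2
    then show ?thesis
      by (simp only: word_exp_replicate_a word_exp_replicate_b)
         (auto simp: exp_cong_def intro: exI[of _ "-1"])
  next
    case 3
    then show ?thesis by (simp add: exp_mult_def exp_cong_refl)
  qed
next
  case (Pos_Neg x)
  then show ?case by (cases x) (auto simp: exp_mult_def exp_cong_refl)
next
  case (Neg_Pos x)
  then show ?case by (cases x) (auto simp: exp_mult_def exp_cong_refl)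
next
  case (append u v u' v')
  then show ?case by (simp only: word_exp_append exp_cong_mult[OF s r])
qed (auto intro: exp_cong_refl exp_cong_sym exp_cong_trans)

section \<open>Normal forms B^i A^j\<close>

context group
begin

lemma inverting_commute:
  assumes "A \<in> carrier G" "B \<in> carrier G" "A \<otimes> B = B \<otimes> inv A"
  shows "A [^] (j::int) \<otimes> B [^] (i::nat) = B [^] i \<otimes> A [^] (if even i then j else - j)"
proof -
  have 1: "A [^] j \<otimes> B = B \<otimes> A [^] (- j)" for j :: int
  proof -
    have "inv B \<otimes> A \<otimes> B = inv A"
      using assms by (simp add: m_assoc inv_solve_left')
    have conj: "inv B \<otimes> A [^] n \<otimes> B = inv A [^] n" for n :: nat
    proof (induction n)
      case (Suc n)
      have "inv B \<otimes> A [^] Suc n \<otimes> B = (inv B \<otimes> A [^] n \<otimes> B) \<otimes> (inv B \<otimes> A \<otimes> B)"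
        using assms by (simp add: m_assoc inv_solve_left' flip: m_assoc[of B "inv B"])
      then show ?case using Suc \<open>inv B \<otimes> A \<otimes> B = inv A\<close> by simp
    qed (use assms in simp)
    have conj': "A [^] n \<otimes> B = B \<otimes> inv A [^] n" for n :: nat
    proof -
      have "B \<otimes> (inv B \<otimes> A [^] n \<otimes> B) = A [^] n \<otimes> B"
        using assms by (simp add: m_assoc flip: m_assoc[of B "inv B"])
      then show ?thesis using conj[of n] by simp
    qed
    show ?thesis
    proof (cases j rule: int_cases2)
      case (nonneg n)
      then show ?thesis using conj'[of n] assms by (simp add: int_pow_int int_pow_neg nat_pow_inv)
    next
      case (nonpos n)
      let ?u = "A [^] n"
      have "inv ?u \<otimes> B = inv ?u \<otimes> (B \<otimes> inv ?u) \<otimes> ?u"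
        using assms by (simp add: m_assoc)
      also have "B \<otimes> inv ?u = ?u \<otimes> B"
        using conj'[of n] assms by (simp add: nat_pow_inv)
      also have "inv ?u \<otimes> (?u \<otimes> B) \<otimes> ?u = B \<otimes> ?u"
        using assms by (simp add: m_assoc[symmetric])
      finally have "inv A [^] n \<otimes> B = B \<otimes> A [^] n"
        using assms by (simp add: nat_pow_inv)
      then show ?thesis using nonpos assms by (simp add: int_pow_int int_pow_neg nat_pow_inv)
    qed
  qed
  show ?thesis
  proof (induction i)
    case (Suc i)
    have "A [^] j \<otimes> B [^] Suc i = (A [^] j \<otimes> B [^] i) \<otimes> B"
      using assms by (simp add: m_assoc)
    also have "\<dots> = B [^] i \<otimes> (A [^] (if even i then j else - j) \<otimes> B)"
      using Suc assms by (simp add: m_assoc)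
    also have "\<dots> = B [^] i \<otimes> (B \<otimes> A [^] (if even (Suc i) then j else - j))"
      unfolding 1 by simp
    finally show ?case using assms by (simp add: m_assoc)
  qed (use assms in simp)
qed

lemma inverting_mult_form:
  assumes "A \<in> carrier G" "B \<in> carrier G" "A \<otimes> B = B \<otimes> inv A"
  shows "(B [^] (i::nat) \<otimes> A [^] (j::int)) \<otimes> (B [^] (k::nat) \<otimes> A [^] (l::int)) =
     B [^] (i + k) \<otimes> A [^] ((if even k then j else - j) + l)"
proof -
  have "(B [^] i \<otimes> A [^] j) \<otimes> (B [^] k \<otimes> A [^] l) = B [^] i \<otimes> (A [^] j \<otimes> B [^] k) \<otimes> A [^] l"
    using assms by (simp add: m_assoc)
  also have "A [^] j \<otimes> B [^] k = B [^] k \<otimes> A [^] (if even k then j else - j)"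
    by (rule inverting_commute[OF assms])
  also have "B [^] i \<otimes> (B [^] k \<otimes> A [^] (if even k then j else - j)) \<otimes> A [^] l =
      (B [^] i \<otimes> B [^] k) \<otimes> (A [^] (if even k then j else - j) \<otimes> A [^] l)"
    using assms by (simp add: m_assoc)
  finally show ?thesis using assms(1,2) by (simp only: nat_pow_mult int_pow_mult)
qed

lemma inverting_pair_closed:
  assumes AB: "inverting_pair G m s r A B" and "m > 0"
  obtains k where "B [^] (i::nat) \<otimes> A [^] (j::nat) \<otimes> B = B [^] Suc i \<otimes> A [^] (k::nat)"
proof -
  have c: "A \<in> carrier G" "B \<in> carrier G" "A \<otimes> B = B \<otimes> inv A" "A [^] m = \<one>"
    using AB by (auto simp: inverting_pair_def)
  have mj: "A [^] (int m * int j) = \<one>"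
    using c by (metis int_pow_int int_pow_one int_pow_pow)
  \<comment> \<open>Adding the multiple m j of m turns the exponent -j into the nonnegative (m - 1)
    j, so that normal forms use natural powers throughout.\<close>
  have "A [^] (- int j) = A [^] (int m * int j + (- int j))"
    using c mj by (simp add: int_pow_mult del: of_nat_mult add_uminus_conv_diff)
  also have "int m * int j + (- int j) = int ((m - 1) * j)"
    using \<open>m > 0\<close> by (simp add: of_nat_diff algebra_simps)
  finally have e: "A [^] (- int j) = A [^] ((m - 1) * j)" by (simp only: int_pow_int)
  have "A [^] (int j) \<otimes> B [^] (1::nat) = B [^] (1::nat) \<otimes> A [^] (- int j)"
    using inverting_commute[OF c(1,2,3), of "int j" 1] by simp
  then have "A [^] j \<otimes> B = B \<otimes> A [^] ((m - 1) * j)"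
    using c(2) e by (simp add: int_pow_int)
  then have "B [^] i \<otimes> A [^] j \<otimes> B = B [^] Suc i \<otimes> A [^] ((m - 1) * j)"
    using c by (simp add: m_assoc)
  then show ?thesis by (rule that)
qed

lemma inverting_pair_reduce:
  assumes AB: "inverting_pair G m s r A B" and "m > 0" "s > 0"
  obtains i' j' :: nat where "i' < s" "j' < m" "B [^] (i::nat) \<otimes> A [^] (j::nat) = B [^] i' \<otimes> A [^] j'"
proof -
  have c: "A \<in> carrier G" "B \<in> carrier G" "A [^] m = \<one>" "B [^] s = A [^] r"
    using AB by (auto simp: inverting_pair_def)
  have "B [^] i = B [^] (i mod s) \<otimes> (B [^] s) [^] (i div s)"
    using c(2) by (simp only: nat_pow_mult nat_pow_pow mod_mult_div_eq)
  then have 1: "B [^] i \<otimes> A [^] j = B [^] (i mod s) \<otimes> A [^] (r * (i div s) + j)" (is "_ = _ \<otimes> A [^] ?l")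
    using c by (simp add: m_assoc nat_pow_mult nat_pow_pow)
  have "A [^] ?l = (A [^] m) [^] (?l div m) \<otimes> A [^] (?l mod m)"
    using c(1) by (simp only: nat_pow_mult nat_pow_pow mult_div_mod_eq)
  then have "A [^] ?l = A [^] (?l mod m)" using c by simp
  with 1 show ?thesis using that[of "i mod s" "?l mod m"] assms by simp
qed

end

section \<open>Normal form and order in the presented groups\<close>

lemma presented_group_one: "\<one>\<^bsub>presented_group R\<^esub> = word_class R []"
  by (simp add: presented_group_def)

lemma presented_group_carrier: "carrier (presented_group R) = range (word_class R)"
  by (simp add: presented_group_def)

lemma presented_group_pow: "word_class R [l] [^]\<^bsub>presented_group R\<^esub> (n::nat) = word_class R (replicate n l)"
proof (induction n)
  case (Suc n)
  then show ?case by (simp add: presented_group_mult replicate_append_same)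
qed (simp add: presented_group_one)

lemma presented_group_inv:
  "inv\<^bsub>presented_group R\<^esub> (word_class R [Pos x]) = word_class R [Neg x]"
proof (rule group.inv_equality[OF group_presented_group])
  show "word_class R [Neg x] \<otimes>\<^bsub>presented_group R\<^esub> word_class R [Pos x] = \<one>\<^bsub>presented_group R\<^esub>"
    by (simp add: presented_group_mult presented_group_one word_class_eq_iff word_eq.Neg_Pos)
qed (auto simp: presented_group_carrier)

lemma inverting_pair_presented:
  "inverting_pair (presented_group (inverting_rels m s r)) m s r
     (word_class (inverting_rels m s r) [Pos gen.a]) (word_class (inverting_rels m s r) [Pos gen.b])"
proof -
  let ?R = "inverting_rels m s r"
  let ?P = "presented_group ?R"
  let ?A = "word_class ?R [Pos gen.a]" and ?B = "word_class ?R [Pos gen.b]"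
  interpret P: group ?P by (rule group_presented_group)
  have c: "?A \<in> carrier ?P" "?B \<in> carrier ?P" by (auto simp: presented_group_carrier)
  have "word_class ?R (replicate m (Pos gen.a)) = word_class ?R []"
    "word_class ?R (replicate s (Pos gen.b)) = word_class ?R (replicate r (Pos gen.a))"
    unfolding word_class_eq_iff by (rule word_eq.rel, simp add: inverting_rels_def)+
  moreover have "inv\<^bsub>?P\<^esub> ?B \<otimes>\<^bsub>?P\<^esub> ?A \<otimes>\<^bsub>?P\<^esub> ?B = inv\<^bsub>?P\<^esub> ?A"
    unfolding presented_group_inv presented_group_mult word_class_eq_iff
    by (rule word_eq.rel) (simp add: inverting_rels_def)
  then have "?A \<otimes>\<^bsub>?P\<^esub> ?B = ?B \<otimes>\<^bsub>?P\<^esub> inv\<^bsub>?P\<^esub> ?A"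
    using c by (metis P.inv_closed P.inv_solve_left P.m_assoc P.m_closed)
  ultimately show ?thesis
    using c by (simp add: inverting_pair_def presented_group_pow presented_group_one)
qed

text \<open>Appending a letter to a product of the form B^i A^j gives such a product again, once
  inverse letters are rewritten as natural powers. The bounds on the exponents are imposed at the
  end.\<close>

lemma presented_group_normal_form:
  assumes m: "m > 0" and s: "s > 0" and x: "x \<in> carrier (presented_group (inverting_rels m s r))"
  defines "P \<equiv> presented_group (inverting_rels m s r)"
    and "A \<equiv> word_class (inverting_rels m s r) [Pos gen.a]"
    and "B \<equiv> word_class (inverting_rels m s r) [Pos gen.b]"
  obtains i j :: nat where "i < s" "j < m" "x = B [^]\<^bsub>P\<^esub> i \<otimes>\<^bsub>P\<^esub> A [^]\<^bsub>P\<^esub> j"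
proof -
  interpret P: group P unfolding P_def by (rule group_presented_group)
  have AB: "inverting_pair P m s r A B"
    unfolding P_def A_def B_def by (rule inverting_pair_presented)
  then have c: "A \<in> carrier P" "B \<in> carrier P" "A [^]\<^bsub>P\<^esub> m = \<one>\<^bsub>P\<^esub>" "B [^]\<^bsub>P\<^esub> s = A [^]\<^bsub>P\<^esub> r"
    by (auto simp: inverting_pair_def)
  let ?N = "{B [^]\<^bsub>P\<^esub> i \<otimes>\<^bsub>P\<^esub> A [^]\<^bsub>P\<^esub> j | (i::nat) (j::nat). True}"
  have NA: "y \<otimes>\<^bsub>P\<^esub> A [^]\<^bsub>P\<^esub> (n::nat) \<in> ?N" if "y \<in> ?N" for y n
  proof -
    from that obtain i j :: nat where "y = B [^]\<^bsub>P\<^esub> i \<otimes>\<^bsub>P\<^esub> A [^]\<^bsub>P\<^esub> j" by auto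
    then have "y \<otimes>\<^bsub>P\<^esub> A [^]\<^bsub>P\<^esub> n = B [^]\<^bsub>P\<^esub> i \<otimes>\<^bsub>P\<^esub> A [^]\<^bsub>P\<^esub> (j + n)"
      using c by (simp add: P.m_assoc P.nat_pow_mult)
    then show ?thesis by blast
  qed
  have NB1: "y \<otimes>\<^bsub>P\<^esub> B \<in> ?N" if y: "y \<in> ?N" for y
  proof -
    from y obtain i j :: nat where y: "y = B [^]\<^bsub>P\<^esub> i \<otimes>\<^bsub>P\<^esub> A [^]\<^bsub>P\<^esub> j" by auto
    obtain k where "B [^]\<^bsub>P\<^esub> i \<otimes>\<^bsub>P\<^esub> A [^]\<^bsub>P\<^esub> j \<otimes>\<^bsub>P\<^esub> B = B [^]\<^bsub>P\<^esub> Suc i \<otimes>\<^bsub>P\<^esub> A [^]\<^bsub>P\<^esub> (k::nat)"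
      by (rule P.inverting_pair_closed[OF AB m])
    then show ?thesis unfolding y by blast
  qed
  have NB: "y \<otimes>\<^bsub>P\<^esub> B [^]\<^bsub>P\<^esub> (n::nat) \<in> ?N" if y: "y \<in> ?N" for y n
  proof (induction n)
    case 0
    have "y \<in> carrier P" using y c by auto
    then show ?case using y by simp
  next
    case (Suc n)
    have "y \<in> carrier P" using y c by auto
    then have "y \<otimes>\<^bsub>P\<^esub> B [^]\<^bsub>P\<^esub> Suc n = (y \<otimes>\<^bsub>P\<^esub> B [^]\<^bsub>P\<^esub> n) \<otimes>\<^bsub>P\<^esub> B"
      using c by (simp add: P.m_assoc)
    then show ?case using NB1[OF Suc] by simp
  qed
  have iA: "inv\<^bsub>P\<^esub> A = A [^]\<^bsub>P\<^esub> (m - 1)"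
    using c m by (intro P.inv_equality) (auto simp flip: P.nat_pow_Suc)
  \<comment> \<open>B^(s m) = A^(r m) = 1, which expresses the inverse of B as a natural
    power.\<close>
  have "B [^]\<^bsub>P\<^esub> (s * m) = \<one>\<^bsub>P\<^esub>"
    using c by (metis P.nat_pow_one P.nat_pow_pow mult.commute)
  then have iB: "inv\<^bsub>P\<^esub> B = B [^]\<^bsub>P\<^esub> (s * m - 1)"
    using c m s by (intro P.inv_equality) (auto simp flip: P.nat_pow_Suc)
  have "word_class (inverting_rels m s r) w \<in> ?N" for w
  proof (induction w rule: rev_induct)
    case Nil
    have "word_class (inverting_rels m s r) [] = B [^]\<^bsub>P\<^esub> (0::nat) \<otimes>\<^bsub>P\<^esub> A [^]\<^bsub>P\<^esub> (0::nat)"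
      using P.one_closed by (simp add: presented_group_one[symmetric] flip: P_def)
    then show ?case by blast
  next
    case (snoc l w)
    obtain n :: nat where "word_class (inverting_rels m s r) [l] = A [^]\<^bsub>P\<^esub> n \<or>
        word_class (inverting_rels m s r) [l] = B [^]\<^bsub>P\<^esub> n"
    proof (cases l)
      case (Pos x)
      then show ?thesis using that[of 1] c by (cases x) (auto simp: A_def B_def)
    next
      case (Neg x)
      then show ?thesis
        using that[of "m - 1"] that[of "s * m - 1"] iA iB
        by (cases x) (auto simp: A_def B_def P_def presented_group_inv)
    qed
    then show ?case
      using NA[OF snoc, of n] NB[OF snoc, of n]
        presented_group_mult[of "inverting_rels m s r" w "[l]", folded P_def]
      by (elim disjE) (simp_all only:)
  qed
  then have "x \<in> ?N" using x by (auto simp: presented_group_carrier)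
  then obtain i j :: nat where "x = B [^]\<^bsub>P\<^esub> i \<otimes>\<^bsub>P\<^esub> A [^]\<^bsub>P\<^esub> j" by auto
  then show ?thesis
    using P.inverting_pair_reduce[OF AB m s, of i j thesis] that by simp
qed

text \<open>The normal form gives at most m s elements, and the exponent invariant keeps these m s
  words apart.\<close>

lemma order_presented_group:
  assumes m: "m > 0" and s: "s > 0" "even s" and r: "m dvd 2 * r"
  shows "order (presented_group (inverting_rels m s r)) = m * s"
    and "finite (carrier (presented_group (inverting_rels m s r)))"
proof -
  let ?R = "inverting_rels m s r"
  let ?P = "presented_group ?R"
  let ?f = "\<lambda>(i, j). word_class ?R (replicate i (Pos gen.b) @ replicate j (Pos gen.a))"
  have "inj_on ?f ({..<s} \<times> {..<m})"
  proof (rule inj_onI, clarify)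
    fix i j i' j' assume b: "i < s" "j < m" "i' < s" "j' < m"
      and "word_class ?R (replicate i (Pos gen.b) @ replicate j (Pos gen.a)) =
        word_class ?R (replicate i' (Pos gen.b) @ replicate j' (Pos gen.a))"
    then have "exp_cong m s r (int i, int j) (int i', int j')"
      unfolding word_class_eq_iff
      by (auto dest!: word_eq_exp_cong[OF s(2) r]
          simp: word_exp_append word_exp_replicate_a word_exp_replicate_b exp_mult_def)
    then obtain t where t: "int i' = int i + int s * t" "int m dvd int j' - int j + int r * t"
      by (auto simp: exp_cong_def)
    \<comment> \<open>Two exponents below \<open>s\<close> differ by less than \<open>s\<close>, so
      the multiple \<open>t\<close> vanishes.\<close>
    have "int s * t < int s * 1" "int s * (-1) < int s * t" using t(1) b by linarith+
    then have "t = 0" by (simp only: mult_less_cancel_left) (use s in auto)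
    moreover have "int j' - int j = 0" if "int m dvd int j' - int j"
      using b dvd_imp_le_int[OF _ that] by linarith
    ultimately show "i = i' \<and> j = j'" using t by simp
  qed
  moreover have im: "?f ` ({..<s} \<times> {..<m}) = carrier ?P"
  proof (intro equalityI subsetI)
    fix x assume "x \<in> carrier ?P"
    then obtain i j :: nat where "i < s" "j < m"
      "x = word_class ?R [Pos gen.b] [^]\<^bsub>?P\<^esub> i \<otimes>\<^bsub>?P\<^esub> word_class ?R [Pos gen.a] [^]\<^bsub>?P\<^esub> j"
      by (rule presented_group_normal_form[OF m s(1)])
    then have "x = ?f (i, j)" "(i, j) \<in> {..<s} \<times> {..<m}"
      by (simp_all add: presented_group_pow presented_group_mult)
    then show "x \<in> ?f ` ({..<s} \<times> {..<m})" by blast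
  qed (auto simp: presented_group_carrier)
  ultimately have "bij_betw ?f ({..<s} \<times> {..<m}) (carrier ?P)" by (simp add: bij_betw_def)
  then show "order ?P = m * s"
    unfolding order_def by (simp add: bij_betw_same_card[symmetric] card_cartesian_product)
  show "finite (carrier ?P)" unfolding im[symmetric] by simp
qed

section \<open>Recognising a presented group by evaluating words\<close>

fun letter_eval :: "('a, 'b) monoid_scheme \<Rightarrow> (gen \<Rightarrow> 'a) \<Rightarrow> gen letter \<Rightarrow> 'a" where
  "letter_eval G f (Pos x) = f x"
| "letter_eval G f (Neg x) = inv\<^bsub>G\<^esub> (f x)"

fun word_eval :: "('a, 'b) monoid_scheme \<Rightarrow> (gen \<Rightarrow> 'a) \<Rightarrow> gen letter list \<Rightarrow> 'a" where
  "word_eval G f [] = \<one>\<^bsub>G\<^esub>"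
| "word_eval G f (l # w) = letter_eval G f l \<otimes>\<^bsub>G\<^esub> word_eval G f w"

context group
begin

lemma letter_eval_closed: "range f \<subseteq> carrier G \<Longrightarrow> letter_eval G f l \<in> carrier G"
  by (cases l) auto

lemma word_eval_closed: "range f \<subseteq> carrier G \<Longrightarrow> word_eval G f w \<in> carrier G"
  by (induction w) (auto simp: letter_eval_closed)

lemma word_eval_append:
  "range f \<subseteq> carrier G \<Longrightarrow> word_eval G f (u @ v) = word_eval G f u \<otimes> word_eval G f v"
  by (induction u) (auto simp: letter_eval_closed word_eval_closed m_assoc)

lemma word_eval_replicate:
  assumes "range f \<subseteq> carrier G"
  shows "word_eval G f (replicate n (Pos x)) = f x [^] n"
proof (induction n)
  case (Suc n)
  have "f x \<in> carrier G" using assms by auto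
  with Suc show ?case
    by (metis nat_pow_Suc2 word_eval.simps(2) letter_eval.simps(1) replicate_Suc)
qed simp

lemma word_eval_word_eq:
  assumes f: "range f \<subseteq> carrier G"
    and R: "\<And>u v. (u, v) \<in> R \<Longrightarrow> word_eval G f u = word_eval G f v"
    and "word_eq R u v"
  shows "word_eval G f u = word_eval G f v"
  using assms(3)
proof (induction rule: word_eq.induct)
  case (Pos_Neg x)
  have "f x \<in> carrier G" using f by auto
  then show ?case by simp
next
  case (Neg_Pos x)
  have "f x \<in> carrier G" using f by auto
  then show ?case by simp
qed (auto simp: word_eval_append[OF f] R)

text \<open>Evaluation at A and B respects the relations, so it passes to classes of words. It is
  onto by \<open>gen\<close>, and a surjection between finite sets of the same size m s is
  injective.\<close>

lemma iso_presented_group: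
  assumes AB: "inverting_pair G m s r A B" and m: "m > 0" and s: "s > 0" "even s" and r: "m dvd 2 * r"
    and gen: "\<And>x. x \<in> carrier G \<Longrightarrow> \<exists>(i::nat) (j::nat). x = B [^] i \<otimes> A [^] j"
    and ord: "order G = m * s"
  shows "G \<cong> presented_group (inverting_rels m s r)"
proof -
  let ?R = "inverting_rels m s r"
  let ?P = "presented_group ?R"
  define f where "f x = (case x of gen.a \<Rightarrow> A | gen.b \<Rightarrow> B)" for x
  have c: "A \<in> carrier G" "B \<in> carrier G" "A [^] m = \<one>" "B [^] s = A [^] r" "A \<otimes> B = B \<otimes> inv A"
    using AB by (auto simp: inverting_pair_def)
  have f: "range f \<subseteq> carrier G" using c by (auto simp: f_def split: gen.splits)
  have fab: "f gen.a = A" "f gen.b = B" by (simp_all add: f_def)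
  have R: "word_eval G f u = word_eval G f v" if "(u, v) \<in> ?R" for u v
  proof -
    have "inv B \<otimes> (A \<otimes> B) = inv A" using c by (simp add: inv_solve_left')
    then show ?thesis using that c
      by (auto simp: inverting_rels_def word_eval_replicate[OF f] fab)
  qed
  \<comment> \<open>A class is evaluated at a chosen representative; by
    \<open>word_eval_word_eq\<close> every representative has the same value.\<close>
  define h where "h W = word_eval G f (SOME w. w \<in> W)" for W
  have h: "h (word_class ?R w) = word_eval G f w" for w
  proof -
    have "(SOME u. u \<in> word_class ?R w) \<in> word_class ?R w"
      by (rule someI[of _ w]) (simp add: word_class_def word_eq.refl)
    then have "word_eq ?R w (SOME u. u \<in> word_class ?R w)" by (simp add: word_class_def)
    then show ?thesis unfolding h_def using word_eval_word_eq[OF f R] by metis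
  qed
  have "h \<in> hom ?P G"
    by (rule homI)
       (auto simp: presented_group_carrier presented_group_mult h word_eval_closed[OF f] word_eval_append[OF f])
  moreover have im: "h ` carrier ?P = carrier G"
  proof (intro equalityI subsetI)
    fix x assume "x \<in> carrier G"
    then obtain i j :: nat where "x = B [^] i \<otimes> A [^] j" using gen by blast
    then have "x = h (word_class ?R (replicate i (Pos gen.b) @ replicate j (Pos gen.a)))"
      by (simp add: h word_eval_append[OF f] word_eval_replicate[OF f] fab)
    then show "x \<in> h ` carrier ?P" by (auto simp: presented_group_carrier)
  qed (auto simp: presented_group_carrier h word_eval_closed[OF f])
  moreover have "inj_on h (carrier ?P)"
    using order_presented_group[OF m s r] ord im by (intro eq_card_imp_inj_on) (auto simp: order_def)
  ultimately have "h \<in> iso ?P G" by (auto simp: iso_def bij_betw_def)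
  then have "?P \<cong> G" by (auto simp: is_iso_def)
  then show ?thesis by (rule group.iso_sym[OF group_presented_group])
qed

text \<open>Uniqueness of the exponents is a count: s m pairs are mapped onto a group with m s
  elements.\<close>

lemma iso_presented_group_inverting_pair:
  assumes iso: "G \<cong> presented_group (inverting_rels m s r)"
    and m: "m > 0" and s: "s > 0" "even s" and r: "m dvd 2 * r"
  obtains A B where "inverting_pair G m s r A B" "order G = m * s"
    "\<And>x. x \<in> carrier G \<Longrightarrow> \<exists>i<s. \<exists>j<m. x = B [^] i \<otimes> A [^] j"
    "\<And>i j i' j'. i < s \<Longrightarrow> j < m \<Longrightarrow> i' < s \<Longrightarrow> j' < m \<Longrightarrow>
       B [^] i \<otimes> A [^] j = B [^] i' \<otimes> A [^] j' \<Longrightarrow> i = i' \<and> j = (j'::nat)"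
proof -
  let ?R = "inverting_rels m s r"
  let ?P = "presented_group ?R"
  interpret P: group ?P by (rule group_presented_group)
  have "?P \<cong> G" using iso iso_sym by blast
  then obtain h where h: "h \<in> hom ?P G" "bij_betw h (carrier ?P) (carrier G)"
    by (auto simp: is_iso_def iso_def)
  interpret hom: group_hom ?P G h
    by (simp add: group_hom_def group_hom_axioms_def P.group_axioms group_axioms h)
  let ?A = "word_class ?R [Pos gen.a]" and ?B = "word_class ?R [Pos gen.b]"
  have AB: "inverting_pair ?P m s r ?A ?B" by (rule inverting_pair_presented)
  then have c: "?A \<in> carrier ?P" "?B \<in> carrier ?P" "?A [^]\<^bsub>?P\<^esub> m = \<one>\<^bsub>?P\<^esub>" "?B [^]\<^bsub>?P\<^esub> s = ?A [^]\<^bsub>?P\<^esub> r"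
      "?A \<otimes>\<^bsub>?P\<^esub> ?B = ?B \<otimes>\<^bsub>?P\<^esub> inv\<^bsub>?P\<^esub> ?A"
    by (auto simp: inverting_pair_def)
  have hp: "h (?B [^]\<^bsub>?P\<^esub> i \<otimes>\<^bsub>?P\<^esub> ?A [^]\<^bsub>?P\<^esub> j) = h ?B [^] i \<otimes> h ?A [^] j" for i j :: nat
    using c by (simp add: hom.hom_nat_pow)
  have pair: "inverting_pair G m s r (h ?A) (h ?B)"
    unfolding inverting_pair_def
  proof (intro conjI)
    show "h ?A [^] m = \<one>" using c(1,3) by (metis hom.hom_nat_pow hom.hom_one)
    show "h ?B [^] s = h ?A [^] r" using c(1,2,4) by (metis hom.hom_nat_pow)
    show "h ?A \<otimes> h ?B = h ?B \<otimes> inv (h ?A)"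
      using c(1,2,5) by (metis P.inv_closed hom.hom_inv hom.hom_mult)
  qed (use c in auto)
  have ord: "order G = m * s"
    using order_presented_group(1)[OF m s r] bij_betw_same_card[OF h(2)] by (simp add: order_def)
  let ?f = "\<lambda>(i, j). h ?B [^] i \<otimes> h ?A [^] j"
  have ex: "\<exists>i<s. \<exists>j<m. x = h ?B [^] i \<otimes> h ?A [^] j" if x: "x \<in> carrier G" for x
  proof -
    obtain y where y: "y \<in> carrier ?P" "x = h y" using h(2) x by (auto simp: bij_betw_def)
    obtain i j :: nat where "i < s" "j < m" "y = ?B [^]\<^bsub>?P\<^esub> i \<otimes>\<^bsub>?P\<^esub> ?A [^]\<^bsub>?P\<^esub> j"
      by (rule presented_group_normal_form[OF m s(1) y(1)])
    then show ?thesis using y hp by blast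
  qed
  have "?f ` ({..<s} \<times> {..<m}) = carrier G"
  proof (intro equalityI subsetI)
    fix x assume "x \<in> carrier G"
    then obtain i j where "i < s" "j < m" "x = h ?B [^] i \<otimes> h ?A [^] j" using ex by blast
    then have "x = ?f (i, j)" "(i, j) \<in> {..<s} \<times> {..<m}" by auto
    then show "x \<in> ?f ` ({..<s} \<times> {..<m})" by blast
  qed (use c in auto)
  then have inj: "inj_on ?f ({..<s} \<times> {..<m})"
    using ord by (intro eq_card_imp_inj_on) (simp_all add: order_def)
  show ?thesis
  proof (rule that[OF pair ord ex])
    fix i j i' j' :: nat
    assume "i < s" "j < m" "i' < s" "j' < m" "h ?B [^] i \<otimes> h ?A [^] j = h ?B [^] i' \<otimes> h ?A [^] j'"
    then show "i = i' \<and> j = j'" using inj_onD[OF inj, of "(i, j)" "(i', j')"] by simp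
  qed
qed

end

section \<open>The transversal probability of the groups in the list\<close>

context group
begin

lemma tp_half_I:
  assumes fin: "finite (carrier G)"
    and half: "\<And>H. subgroup H G \<Longrightarrow> \<not> H \<lhd> G \<Longrightarrow> transversal_prob G H = 1 / 2"
    and ex: "subgroup H0 G" "\<not> H0 \<lhd> G"
  shows "tp G = 1 / 2"
proof -
  have "{H. subgroup H G} \<subseteq> Pow (carrier G)" by (auto dest: subgroup.subset)
  then have "finite {H. subgroup H G}" using fin by (metis finite_Pow_iff finite_subset)
  then have "finite {transversal_prob G H | H. subgroup H G}" by simp
  moreover have "1 / 2 \<in> {transversal_prob G H | H. subgroup H G}" using half[OF ex] ex(1) by force
  moreover have "1 / 2 \<le> transversal_prob G H" if H: "subgroup H G" for H
  proof (cases "H \<lhd> G")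
    case True
    interpret subgroup_of_finite_group H G
      by (simp add: subgroup_of_finite_group_def subgroup_of_finite_group_axioms_def H group_axioms fin)
    show ?thesis using transversal_prob_normal[OF True] by simp
  qed (use half[OF H] in simp)
  ultimately show ?thesis unfolding tp_def by (intro Min_eqI) auto
qed

lemma tp_half_D:
  assumes fin: "finite (carrier G)" and tp: "tp G = 1 / 2"
  shows "\<And>H. subgroup H G \<Longrightarrow> \<not> H \<lhd> G \<Longrightarrow> even (card H)"
    and "\<And>H. subgroup H G \<Longrightarrow> \<not> H \<lhd> G \<Longrightarrow> order G = 3 * card H \<or> order G = 4 * card H"
    and "\<exists>H. subgroup H G \<and> \<not> H \<lhd> G"
proof -
  let ?S = "{transversal_prob G H | H. subgroup H G}"
  have "{H. subgroup H G} \<subseteq> Pow (carrier G)" by (auto dest: subgroup.subset)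
  then have "finite {H. subgroup H G}" using fin by (metis finite_Pow_iff finite_subset)
  then have finS: "finite ?S" by simp
  have sub: "subgroup_of_finite_group H G" if "subgroup H G" for H
    by (simp add: subgroup_of_finite_group_def subgroup_of_finite_group_axioms_def that group_axioms fin)
  have "transversal_prob G (carrier G) \<in> ?S" using subgroup_self by blast
  then have "Min ?S \<in> ?S" using finS by (intro Min_in) auto
  then obtain H where H: "subgroup H G" "transversal_prob G H = 1 / 2"
    using tp unfolding tp_def by auto
  have "\<not> H \<lhd> G" using subgroup_of_finite_group.transversal_prob_normal[OF sub[OF H(1)]] H(2) by auto
  then show "\<exists>H. subgroup H G \<and> \<not> H \<lhd> G" using H(1) by blast
  fix H assume H: "subgroup H G" "\<not> H \<lhd> G"
  have "Min ?S \<le> transversal_prob G H" using finS H(1) by (intro Min_le) auto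
  then have "transversal_prob G H \<ge> 1 / 2" using tp by (simp add: tp_def)
  then show "even (card H)" "order G = 3 * card H \<or> order G = 4 * card H"
    using subgroup_of_finite_group.nonnormal_ge_half[OF sub[OF H(1)] _ H(2)] by auto
qed

lemma subgroup_pow_card_eq_1:
  assumes fin: "finite (carrier G)" and H: "subgroup H G" "h \<in> H"
  shows "h [^] card H = \<one>"
proof -
  have "h [^]\<^bsub>G\<lparr>carrier := H\<rparr>\<^esub> card H = \<one>\<^bsub>G\<lparr>carrier := H\<rparr>\<^esub>"
    using group.pow_order_eq_1[OF subgroup.subgroup_is_group[OF H(1) group_axioms], of h] H(2)
    by (simp add: order_def)
  then show ?thesis by (simp flip: nat_pow_consistent)
qed

lemma ord_dvd_card_subgroup:
  assumes fin: "finite (carrier G)" and H: "subgroup H G" "h \<in> H"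
  shows "ord h dvd card H"
  using subgroup_pow_card_eq_1[OF assms] pow_eq_id[of h "card H"] subgroup.mem_carrier[OF H] by simp

lemma card_subgroup_dvd:
  assumes "finite (carrier G)" "subgroup H G"
  shows "card H dvd order G"
  using lagrange_finite[OF assms] by (metis dvd_triv_right)

lemma central_imp_normal:
  assumes H: "subgroup H G" and c: "\<And>h y. h \<in> H \<Longrightarrow> y \<in> carrier G \<Longrightarrow> h \<otimes> y = y \<otimes> h"
  shows "H \<lhd> G"
  unfolding normal_inv_iff
proof (intro conjI ballI H)
  fix x h assume x: "x \<in> carrier G" and h: "h \<in> H"
  then have "x \<otimes> h \<otimes> inv x = h"
    using c[OF h x] subgroup.mem_carrier[OF H h] by (simp add: m_assoc flip: c)
  then show "x \<otimes> h \<otimes> inv x \<in> H" using h by simp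
qed

lemma card_1_normal:
  assumes H: "subgroup H G" and "card H = 1" shows "H \<lhd> G"
proof -
  have "H = {\<one>}" using assms subgroup.one_closed[OF H] by (metis card_1_singletonE singletonD)
  then show ?thesis using one_is_normal by simp
qed

lemma full_card_normal:
  assumes fin: "finite (carrier G)" and H: "subgroup H G" and "card H = order G" shows "H \<lhd> G"
proof -
  have "H = carrier G" using assms subgroup.subset[OF H] by (intro card_subset_eq) (auto simp: order_def)
  then show ?thesis using normal_self by simp
qed

lemma index_2_normal:
  assumes fin: "finite (carrier G)" and H: "subgroup H G" and "order G = 2 * card H" shows "H \<lhd> G"
proof -
  interpret subgroup_of_finite_group H G
    by (simp add: subgroup_of_finite_group_def subgroup_of_finite_group_axioms_def H group_axioms fin)
  show ?thesis using normal_of_index_2 assms(3) .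
qed

text \<open>Subgroups of order 1, 4 and 8 are normal, which leaves order 2 and hence index
  4.\<close>

lemma transversal_prob_order_8:
  assumes fin: "finite (carrier G)" and ord: "order G = 8" and H: "subgroup H G" "\<not> H \<lhd> G"
  shows "transversal_prob G H = 1 / 2"
proof -
  interpret subgroup_of_finite_group H G
    by (simp add: subgroup_of_finite_group_def subgroup_of_finite_group_axioms_def H group_axioms fin)
  have "card H dvd 2 ^ 3" using card_subgroup_dvd[OF fin H(1)] ord by simp
  then obtain e where e: "e \<le> 3" "card H = 2 ^ e"
    using divides_primepow_nat[OF two_is_prime_nat] by blast
  moreover have "e \<noteq> 0" "e \<noteq> 2" "e \<noteq> 3"
    using e H card_1_normal[OF H(1)] full_card_normal[OF fin H(1)] index_2_normal[OF fin H(1)] ord by auto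
  ultimately have "e = 1" by linarith
  then show ?thesis using e ord by (intro nonnormal_index_4 H(2)) simp_all
qed

text \<open>Subgroups of order 1, 8 and 16 are normal. A subgroup of order 2 consists of elements of
  square 1, central by \<open>inv\<close>, so it is normal too. This leaves order 4 and index
  4.\<close>

lemma transversal_prob_order_16:
  assumes fin: "finite (carrier G)" and ord: "order G = 16"
    and inv: "\<And>c y. c \<in> carrier G \<Longrightarrow> c \<otimes> c = \<one> \<Longrightarrow> y \<in> carrier G \<Longrightarrow> c \<otimes> y = y \<otimes> c"
    and H: "subgroup H G" "\<not> H \<lhd> G"
  shows "transversal_prob G H = 1 / 2"
proof -
  interpret subgroup_of_finite_group H G
    by (simp add: subgroup_of_finite_group_def subgroup_of_finite_group_axioms_def H group_axioms fin)
  have "card H dvd 2 ^ 4" using card_subgroup_dvd[OF fin H(1)] ord by simp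
  then obtain e where e: "e \<le> 4" "card H = 2 ^ e"
    using divides_primepow_nat[OF two_is_prime_nat] by blast
  moreover have "e \<noteq> 1"
  proof
    assume "e = 1"
    have "H \<lhd> G"
    proof (rule central_imp_normal[OF H(1)], rule inv)
      fix h assume h: "h \<in> H"
      then show "h \<in> carrier G" by (rule mem_carrier)
      then show "h \<otimes> h = \<one>"
        using subgroup_pow_card_eq_1[OF fin H(1) h] e \<open>e = 1\<close> by (simp add: numeral_2_eq_2)
    qed
    then show False using H(2) by simp
  qed
  moreover have "e \<noteq> 0" "e \<noteq> 3" "e \<noteq> 4"
    using e H card_1_normal[OF H(1)] full_card_normal[OF fin H(1)] index_2_normal[OF fin H(1)] ord by auto
  ultimately have "e = 2" by linarith
  then show ?thesis using e ord by (intro nonnormal_index_4 H(2)) simp_all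
qed

end

section \<open>Subgroups of a group with unique normal forms\<close>

locale inverting_group = group G for G (structure) +
  fixes m s r :: nat and A B
  assumes m_pos: "m > 0" and s_pos: "s > 0"
    and pair: "inverting_pair G m s r A B" and order_eq: "order G = m * s"
    and ex: "\<And>x. x \<in> carrier G \<Longrightarrow> \<exists>i<s. \<exists>j<m. x = B [^] i \<otimes> A [^] j"
    and unique: "\<And>i j i' j'. i < s \<Longrightarrow> j < m \<Longrightarrow> i' < s \<Longrightarrow> j' < m \<Longrightarrow>
       B [^] i \<otimes> A [^] j = B [^] i' \<otimes> A [^] j' \<Longrightarrow> i = i' \<and> j = j'"
begin

lemma A_closed [simp]: "A \<in> carrier G" and B_closed [simp]: "B \<in> carrier G"
  and A_pow_m: "A [^] m = \<one>" and B_pow_s: "B [^] s = A [^] r" and A_B: "A \<otimes> B = B \<otimes> inv A"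
  using pair by (auto simp: inverting_pair_def)

lemma finite_carrier: "finite (carrier G)"
  using order_eq m_pos s_pos by (intro card_ge_0_finite) (simp add: order_def)

lemma form:
  assumes "x \<in> carrier G"
  obtains i j where "i < s" "j < m" "x = B [^] i \<otimes> A [^] (int j)"
  using ex[OF assms] by (metis int_pow_int)

lemmas mult_form = inverting_mult_form[OF A_closed B_closed A_B]

lemma A_pow_mod: "A [^] (n::nat) = A [^] (n mod m)"
proof -
  have "A [^] n = (A [^] m) [^] (n div m) \<otimes> A [^] (n mod m)"
    by (simp only: A_closed nat_pow_pow nat_pow_mult mult_div_mod_eq)
  then show ?thesis by (simp add: A_pow_m)
qed

lemma A_pow_eq_1:
  assumes "A [^] (n::nat) = \<one>" shows "m dvd n"
proof -
  have "A [^] (n mod m) = \<one>" using assms by (simp only: A_pow_mod[of n])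
  then show ?thesis using unique[of 0 "n mod m" 0 0] m_pos s_pos by auto
qed

text \<open>Modulo the powers of A the group is abelian: both products have normal forms with the
  same power of B. Moving the differing power of A to the front changes its sign when that power of
  B is odd. A subgroup containing A thus contains all commutators.\<close>

lemma commutator_in_A:
  assumes "x \<in> carrier G" "h \<in> carrier G"
  obtains e :: int where "x \<otimes> h = A [^] e \<otimes> (h \<otimes> x)"
proof -
  obtain i j :: nat where x: "x = B [^] i \<otimes> A [^] (int j)" using form[OF assms(1)] by blast
  obtain k l :: nat where h: "h = B [^] k \<otimes> A [^] (int l)" using form[OF assms(2)] by blast
  define p where "p = (if even k then int j else - int j) + int l"
  define q where "q = (if even i then int l else - int l) + int j"
  define e where "e = (if even (k + i) then p - q else q - p)"
  have xh: "x \<otimes> h = B [^] (k + i) \<otimes> A [^] p" and hx: "h \<otimes> x = B [^] (k + i) \<otimes> A [^] q"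
    unfolding x h mult_form p_def q_def by (simp_all add: add.commute)
  have "A [^] e \<otimes> (h \<otimes> x) = (B [^] (0::nat) \<otimes> A [^] e) \<otimes> (B [^] (k + i) \<otimes> A [^] q)"
    unfolding hx by simp
  also have "\<dots> = B [^] (0 + (k + i)) \<otimes> A [^] ((if even (k + i) then e else - e) + q)"
    by (rule mult_form)
  also have "\<dots> = x \<otimes> h" unfolding xh e_def by simp
  finally show ?thesis using that[of e] by simp
qed

lemma normal_if_A_mem:
  assumes H: "subgroup H G" and A: "A \<in> H"
  shows "H \<lhd> G"
  unfolding normal_inv_iff
proof (intro conjI ballI H)
  fix x h assume x: "x \<in> carrier G" and h: "h \<in> H"
  have hc: "h \<in> carrier G" using subgroup.mem_carrier[OF H h] .
  obtain e :: int where "x \<otimes> h = A [^] e \<otimes> (h \<otimes> x)" by (rule commutator_in_A[OF x hc])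
  then have "x \<otimes> h \<otimes> inv x = A [^] e \<otimes> h" using x hc by (simp add: m_assoc)
  moreover have "A [^] e \<in> H" using subgroup_int_pow_closed[OF H A] .
  ultimately show "x \<otimes> h \<otimes> inv x \<in> H" using h subgroup.m_closed[OF H] by simp
qed

text \<open>Even powers of B commute with A, and a power of A with square 1 equals its own inverse,
  so B fixes it.\<close>

lemma central_form:
  assumes i: "even i" and j: "A [^] (2 * j) = \<one>" and y: "y \<in> carrier G"
  shows "(B [^] (i::nat) \<otimes> A [^] (j::nat)) \<otimes> y = y \<otimes> (B [^] i \<otimes> A [^] j)"
proof -
  obtain k l :: nat where y: "y = B [^] k \<otimes> A [^] (int l)" using form[OF y] by blast
  have "A [^] (int j) \<otimes> A [^] (int j) = \<one>"
    using j by (simp add: int_pow_int nat_pow_mult mult_2)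
  then have "inv (A [^] int j) = A [^] (int j)" by (intro inv_equality) simp_all
  then have *: "A [^] (- int j) = A [^] (int j)" by (simp add: int_pow_neg)
  have "(B [^] i \<otimes> A [^] (int j)) \<otimes> y = B [^] (i + k) \<otimes> (A [^] (if even k then int j else - int j) \<otimes> A [^] (int l))"
    unfolding y mult_form by (simp add: int_pow_mult)
  also have "A [^] (if even k then int j else - int j) = A [^] (int j)" using * by simp
  also have "B [^] (i + k) \<otimes> (A [^] (int j) \<otimes> A [^] (int l)) = y \<otimes> (B [^] i \<otimes> A [^] (int j))"
    unfolding y mult_form using i by (simp add: int_pow_mult[symmetric] add.commute)
  finally show ?thesis by (simp only: int_pow_int)
qed

text \<open>An odd power of B inverts A^j, so the two factors A^j cancel.\<close>

lemma square_odd: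
  assumes "odd i"
  shows "(B [^] (i::nat) \<otimes> A [^] (j::nat)) \<otimes> (B [^] i \<otimes> A [^] j) = B [^] (2 * i)"
  using mult_form[of i "int j" i "int j"] assms by (simp add: int_pow_int mult_2)

lemma pow_even:
  assumes "even i"
  shows "(B [^] (i::nat) \<otimes> A [^] (j::nat)) [^] (n::nat) = B [^] (i * n) \<otimes> A [^] (j * n)"
proof -
  have "B [^] i \<otimes> A [^] j = A [^] j \<otimes> B [^] i"
    using inverting_commute[OF A_closed B_closed A_B, of "int j" i] assms by (simp add: int_pow_int)
  then have "(B [^] i \<otimes> A [^] j) [^] n = (B [^] i) [^] n \<otimes> (A [^] j) [^] n"
    by (intro pow_mult_distrib) auto
  then show ?thesis by (simp add: nat_pow_pow)
qed

text \<open>Conjugation by A turns B into B A^2, so normality would put A^2 into <B>. By uniqueness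
  of normal forms, a power of B that is a power of A is a power of A^r, and the assumption on
  \<open>r\<close> says that A^2 is none of these.\<close>

lemma generate_B_nonnormal:
  assumes m: "m > 2" and r: "\<And>q. r * q mod m \<noteq> 2"
  shows "\<not> generate G {B} \<lhd> G"
proof
  assume n: "generate G {B} \<lhd> G"
  have gen: "generate G {B} = {B [^] k | k. k \<in> (UNIV :: nat set)}"
    by (rule generate_pow_on_finite_carrier[OF finite_carrier B_closed])
  have "B \<in> generate G {B}" by (simp add: generate.incl)
  then have 1: "inv A \<otimes> B \<otimes> A \<in> generate G {B}" by (simp add: normal.inv_op_closed1[OF n])
  have "inv A \<otimes> B \<otimes> A = B \<otimes> (A \<otimes> A)"
  proof -
    have "inv A \<otimes> B = B \<otimes> A"
      using inverting_commute[OF A_closed B_closed A_B, of "-1" 1] by (simp add: int_pow_neg)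
    then show ?thesis by (simp add: m_assoc)
  qed
  with 1 have "inv B \<otimes> (B \<otimes> (A \<otimes> A)) \<in> generate G {B}"
    using normal_imp_subgroup[OF n] by (metis (no_types, lifting) \<open>B \<in> generate G {B}\<close> subgroup_def)
  then have "A \<otimes> A \<in> generate G {B}" by (simp add: m_assoc[symmetric])
  then obtain k :: nat where k: "A \<otimes> A = B [^] k" using gen by auto
  have "B [^] k = B [^] (k mod s) \<otimes> (B [^] s) [^] (k div s)"
    by (simp only: B_closed nat_pow_pow nat_pow_mult mod_mult_div_eq)
  also have "\<dots> = B [^] (k mod s) \<otimes> A [^] (r * (k div s) mod m)"
    by (simp add: B_pow_s nat_pow_pow flip: A_pow_mod)
  finally have "B [^] (0::nat) \<otimes> A [^] (2::nat) = B [^] (k mod s) \<otimes> A [^] (r * (k div s) mod m)"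
    using k by (simp add: numeral_2_eq_2)
  then show False using unique[of 0 2 "k mod s" "r * (k div s) mod m"] m s_pos r by auto
qed

lemma tp_half:
  assumes "m > 2" "\<And>q. r * q mod m \<noteq> 2"
    and "\<And>H. subgroup H G \<Longrightarrow> \<not> H \<lhd> G \<Longrightarrow> transversal_prob G H = 1 / 2"
  shows "tp G = 1 / 2"
  by (rule tp_half_I[OF finite_carrier assms(3) generate_is_subgroup generate_B_nonnormal[OF assms(1,2)]]) auto

lemma tp_D4:
  assumes "m = 4" "s = 2" "r = 0" shows "tp G = 1 / 2"
  using assms order_eq by (intro tp_half transversal_prob_order_8 finite_carrier) auto

text \<open>An element with an odd power of B squares to B^2 = A^4, which is not 1. So elements of
  square 1 are powers of A, and \<open>central_form\<close> applies to them.\<close>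

lemma tp_Q16:
  assumes "m = 8" "s = 2" "r = 4" shows "tp G = 1 / 2"
proof (rule tp_half)
  show "r * q mod m \<noteq> 2" for q using assms by simp presburger
  fix H assume H: "subgroup H G" "\<not> H \<lhd> G"
  show "transversal_prob G H = 1 / 2"
  proof (rule transversal_prob_order_16[OF finite_carrier _ _ H])
    fix c y assume c: "c \<in> carrier G" "c \<otimes> c = \<one>" and y: "y \<in> carrier G"
    obtain i j where ij: "i < s" "j < m" "c = B [^] i \<otimes> A [^] j" using ex[OF c(1)] by blast
    have "even i"
    proof (rule ccontr)
      assume o: "odd i"
      then have "i = 1" using ij assms by presburger
      then have "A [^] (4::nat) = \<one>" using square_odd[OF o, of j] c(2) ij(3) B_pow_s assms by simp
      then show False using A_pow_eq_1[of 4] assms by simp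
    qed
    then have "i = 0" using ij assms by presburger
    then have "A [^] (2 * j) = \<one>" using c(2) ij(3) by (simp add: nat_pow_mult mult_2)
    then show "c \<otimes> y = y \<otimes> c" unfolding ij(3) using central_form[OF \<open>even i\<close> _ y] by blast
  qed (use order_eq assms in simp)
qed (use assms in simp)

text \<open>An element with an odd power of B squares to B^2, because B^4 = 1, and B^2 is not 1. So
  elements of square 1 have an even power of B and are central.\<close>

lemma tp_C4_C4:
  assumes "m = 4" "s = 4" "r = 0" shows "tp G = 1 / 2"
proof (rule tp_half)
  fix H assume H: "subgroup H G" "\<not> H \<lhd> G"
  show "transversal_prob G H = 1 / 2"
  proof (rule transversal_prob_order_16[OF finite_carrier _ _ H])
    fix c y assume c: "c \<in> carrier G" "c \<otimes> c = \<one>" and y: "y \<in> carrier G"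
    obtain i j where ij: "i < s" "j < m" "c = B [^] i \<otimes> A [^] j" using ex[OF c(1)] by blast
    have B4: "B [^] (4::nat) = \<one>" using B_pow_s assms by simp
    have "even i"
    proof (rule ccontr)
      assume o: "odd i"
      then have "i = 1 \<or> i = 3" using ij assms by presburger
      moreover have "B [^] (6::nat) = B [^] (4::nat) \<otimes> B [^] (2::nat)" by (simp add: nat_pow_mult)
      ultimately have "B [^] (2::nat) = \<one>" using square_odd[OF o, of j] c(2) ij(3) B4 by auto
      then show False using unique[of 2 0 0 0] assms by simp
    qed
    then have "i = 0 \<or> i = 2" using ij assms by presburger
    then have "B [^] (i * 2) = \<one>" using B4 by auto
    moreover have "c [^] (2::nat) = \<one>" using c by (simp add: numeral_2_eq_2)
    ultimately have "A [^] (2 * j) = \<one>"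
      using pow_even[OF \<open>even i\<close>, of j 2] ij(3) by (simp add: mult.commute)
    then show "c \<otimes> y = y \<otimes> c" unfolding ij(3) using central_form[OF \<open>even i\<close> _ y] by blast
  qed (use order_eq assms in simp)
qed (use assms in auto)

text \<open>The square of B^i A^j is B^(2i), so the even powers of this element are those of B^i,
  and B^i has the order of B for odd i.\<close>

lemma C3_ord_odd:
  assumes "m = 3" "s = 2 ^ n" "n \<ge> 1" "r = 0" and i: "odd i" "i < s" and j: "j < m"
  shows "ord (B [^] i \<otimes> A [^] j) = 2 ^ n"
proof -
  let ?h = "B [^] i \<otimes> A [^] j"
  have B1: "B [^] (2 ^ n * k :: nat) = \<one>" for k :: nat
    using B_pow_s assms by (simp add: nat_pow_pow[symmetric])
  have sq: "?h [^] (2 * k) = B [^] (2 * i * k)" for k :: nat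
  proof -
    have "?h [^] (2::nat) = B [^] (2 * i)" using square_odd[OF i(1), of j] by (simp add: numeral_2_eq_2)
    then show ?thesis by (simp add: nat_pow_pow[symmetric])
  qed
  have "?h [^] (2 ^ n :: nat) = \<one>"
  proof -
    have "?h [^] (2 * 2 ^ (n - 1) :: nat) = B [^] (2 * i * 2 ^ (n - 1))" by (rule sq)
    also have "2 * i * 2 ^ (n - 1) = 2 ^ n * i" using assms by (cases n) auto
    also have "2 * 2 ^ (n - 1) = (2 :: nat) ^ n" using assms by (cases n) auto
    finally show ?thesis using B1 by simp
  qed
  then have "ord ?h dvd 2 ^ n" using pow_eq_id by simp
  then obtain e where e: "e \<le> n" "ord ?h = 2 ^ e"
    using divides_primepow_nat[OF two_is_prime_nat] by blast
  have "?h [^] (2 ^ (n - 1) :: nat) \<noteq> \<one>"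
  \<comment> \<open>For n = 1 the exponent 2^(n-1) is 1, which is odd, so \<open>sq\<close> does not
    cover it.\<close>
  proof (cases "n = 1")
    case True
    have "?h \<noteq> \<one>"
    proof
      assume "?h = \<one>"
      then have "?h = B [^] (0::nat) \<otimes> A [^] (0::nat)" by simp
      then have "i = 0" using unique[OF i(2) j s_pos m_pos] by blast
      then show False using i(1) by simp
    qed
    then show ?thesis using True by simp
  next
    case False
    then obtain k where k: "n = Suc (Suc k)" using assms(3) by (metis One_nat_def Suc_le_D not0_implies_Suc)
    obtain i' where i': "i = 2 * i' + 1" using i(1) by (elim oddE)
    have "?h [^] (2 * 2 ^ k :: nat) = B [^] (2 * i * 2 ^ k)" by (rule sq)
    also have "2 * i * 2 ^ k = 2 ^ n * i' + 2 ^ (n - 1)" by (simp add: k i' algebra_simps)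
    also have "B [^] (2 ^ n * i' + 2 ^ (n - 1)) = B [^] (2 ^ (n - 1) :: nat)"
      using B1 by (simp add: nat_pow_mult[symmetric])
    also have "\<dots> \<noteq> \<one>"
    proof
      assume "B [^] (2 ^ (n - 1) :: nat) = \<one>"
      then have "B [^] (2 ^ (n - 1) :: nat) \<otimes> A [^] (0::nat) = B [^] (0::nat) \<otimes> A [^] (0::nat)" by simp
      moreover have "2 ^ (n - 1) < s" using assms by simp
      ultimately have "(2 ^ (n - 1) :: nat) = 0" using unique[OF _ m_pos s_pos m_pos] by blast
      then show False by simp
    qed
    finally show ?thesis by (simp add: k)
  qed
  then have "\<not> ord ?h dvd 2 ^ (n - 1)" using pow_eq_id by simp
  then have "\<not> e \<le> n - 1" using e by (metis le_imp_power_dvd)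
  then have "e = n" using e by linarith
  then show ?thesis using e by simp
qed

text \<open>A non-normal H contains a non-central element B^i A^j. For even i its 2^n-th power would
  be a nontrivial power of A, so H would contain A and be normal. For odd i its order is 2^n; as H
  is a proper subgroup in a group of order 3 * 2^n, it has index 3.\<close>

lemma tp_C3:
  assumes ms: "m = 3" "s = 2 ^ n" "n \<ge> 1" "r = 0" shows "tp G = 1 / 2"
proof (rule tp_half)
  fix H assume H: "subgroup H G" "\<not> H \<lhd> G"
  interpret subgroup_of_finite_group H G
    by (simp add: subgroup_of_finite_group_def subgroup_of_finite_group_axioms_def H group_axioms finite_carrier)
  obtain h y where h: "h \<in> H" and y: "y \<in> carrier G" "h \<otimes> y \<noteq> y \<otimes> h"
    using central_imp_normal[OF H(1)] H(2) by blast
  obtain i j where ij: "i < s" "j < m" "h = B [^] i \<otimes> A [^] j" using ex[OF mem_carrier[OF h]] by blast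
  have "odd i"
  proof (rule ccontr)
    assume "\<not> odd i"
    then have ev: "even i" by simp
    have "h [^] (2 ^ n :: nat) \<in> H" using subgroup_int_pow_closed[OF H(1) h, of "int (2 ^ n)"] by (simp only: int_pow_int)
    moreover have "B [^] (i * 2 ^ n) = \<one>"
      using B_pow_s ms by (simp add: nat_pow_pow[symmetric] mult.commute[of i])
    ultimately have AH: "A [^] (j * 2 ^ n) \<in> H" using pow_even[OF ev, of j "2 ^ n"] ij(3) by simp
    have "j \<noteq> 0"
    proof
      assume "j = 0"
      then have "A [^] (2 * j) = \<one>" by simp
      then show False using central_form[OF ev _ y(1), of j] y(2) ij(3) by blast
    qed
    then have "j = 1 \<or> j = 2" using ij ms by linarith
    moreover have "\<not> 3 dvd (2::nat) ^ n" by (induction n) (simp_all, presburger)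
    ultimately have "\<not> 3 dvd j * 2 ^ n" by (elim disjE) (simp_all, presburger)
    then have "j * 2 ^ n mod 3 = 1 \<or> j * 2 ^ n mod 3 = 2" by presburger
    then have "A \<in> H"
    proof
      assume "j * 2 ^ n mod 3 = 1"
      then show ?thesis using AH A_pow_mod[of "j * 2 ^ n"] ms by simp
    next
      assume "j * 2 ^ n mod 3 = 2"
      then have A2: "A [^] (2::nat) \<in> H" using AH A_pow_mod[of "j * 2 ^ n"] ms by simp
      have "A [^] (2::nat) \<otimes> A [^] (2::nat) = A [^] (4 mod 3 :: nat)"
        using A_pow_mod[of 4] ms by (simp add: nat_pow_mult)
      then show ?thesis using subgroup.m_closed[OF H(1) A2 A2] by simp
    qed
    then show False using normal_if_A_mem[OF H(1)] H(2) by blast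
  qed
  then have "2 ^ n dvd card H"
    using C3_ord_odd[OF ms _ ij(1,2)] ord_dvd_card_subgroup[OF finite_carrier H(1) h] ij(3) by simp
  then obtain q where q: "card H = 2 ^ n * q" ..
  have "card H dvd 3 * 2 ^ n" using card_subgroup_dvd[OF finite_carrier H(1)] order_eq ms by simp
  then have "q dvd 3" by (simp add: q mult.commute)
  moreover from this have "q = 0 \<or> q = 1 \<or> q = 2 \<or> q = 3" using dvd_imp_le[of q 3] by linarith
  ultimately have "q = 1 \<or> q = 3" by auto
  moreover have "q \<noteq> 3" using full_card_normal[OF finite_carrier H(1)] H(2) q order_eq ms by (auto simp: mult.commute)
  ultimately have "order G = 3 * card H" using q order_eq ms by simp
  then show "transversal_prob G H = 1 / 2" using nonnormal_index_3[OF H(2)] by simp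
qed (use ms in auto)

end

section \<open>Transfer to the four presented families\<close>

context group
begin

lemma inverting_groupI:
  assumes "G \<cong> presented_group (inverting_rels m s r)"
    and "m > 0" "s > 0" "even s" "m dvd 2 * r"
  obtains A B where "inverting_group G m s r A B"
proof (rule iso_presented_group_inverting_pair[OF assms])
  fix A B
  assume "inverting_pair G m s r A B" "order G = m * s"
    "\<And>x. x \<in> carrier G \<Longrightarrow> \<exists>i<s. \<exists>j<m. x = B [^] i \<otimes> A [^] j"
    "\<And>i j i' j'. i < s \<Longrightarrow> j < m \<Longrightarrow> i' < s \<Longrightarrow> j' < m \<Longrightarrow>
       B [^] i \<otimes> A [^] j = B [^] i' \<otimes> A [^] j' \<Longrightarrow> i = i' \<and> j = j'"
  then have "inverting_group G m s r A B"
    using assms by unfold_locales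
  then show thesis by (rule that)
qed

end

lemma C3_semidirect_C2pow_eq: "C3_semidirect_C2pow n = presented_group (inverting_rels 3 (2 ^ n) 0)"
  and D4_eq: "D4 = presented_group (inverting_rels 4 2 0)"
  and Q16_eq: "Q16 = presented_group (inverting_rels 8 2 4)"
  and C4_semidirect_C4_eq: "C4_semidirect_C4 = presented_group (inverting_rels 4 4 0)"
  by (simp_all add: C3_semidirect_C2pow_def D4_def Q16_def C4_semidirect_C4_def inverting_rels_def)

lemma (in group) classification_imp_tp_half:
  assumes "(\<exists>n\<ge>1. G \<cong> C3_semidirect_C2pow n) \<or> G \<cong> D4 \<or> G \<cong> Q16 \<or> G \<cong> C4_semidirect_C4"
  shows "tp G = 1 / 2"
  using assms
proof (elim disjE exE conjE)
  fix n :: nat assume n: "1 \<le> n" "G \<cong> C3_semidirect_C2pow n"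
  have pres: "G \<cong> presented_group (inverting_rels 3 (2 ^ n) 0)" using n(2) by (simp only: C3_semidirect_C2pow_eq)
  show ?thesis
  proof (rule inverting_groupI[OF pres])
    fix A B assume "inverting_group G 3 (2 ^ n) 0 A B"
    then show ?thesis by (rule inverting_group.tp_C3) (use n in auto)
  qed (use n in auto)
next
  assume "G \<cong> D4"
  then have pres: "G \<cong> presented_group (inverting_rels 4 2 0)" by (simp only: D4_eq)
  show ?thesis
  proof (rule inverting_groupI[OF pres])
    fix A B assume "inverting_group G 4 2 0 A B"
    then show ?thesis by (rule inverting_group.tp_D4) auto
  qed auto
next
  assume "G \<cong> Q16"
  then have pres: "G \<cong> presented_group (inverting_rels 8 2 4)" by (simp only: Q16_eq)
  show ?thesis
  proof (rule inverting_groupI[OF pres])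
    fix A B assume "inverting_group G 8 2 4 A B"
    then show ?thesis by (rule inverting_group.tp_Q16) auto
  qed auto
next
  assume "G \<cong> C4_semidirect_C4"
  then have pres: "G \<cong> presented_group (inverting_rels 4 4 0)" by (simp only: C4_semidirect_C4_eq)
  show ?thesis
  proof (rule inverting_groupI[OF pres])
    fix A B assume "inverting_group G 4 4 0 A B"
    then show ?thesis by (rule inverting_group.tp_C4_C4) auto
  qed auto
qed

section \<open>Groups all of whose non-normal subgroups have index 3 or 4\<close>

lemma nat_odd_part: "n > 0 \<Longrightarrow> \<exists>k q. n = 2 ^ k * q \<and> odd (q::nat)"
proof (induction n rule: less_induct)
  case (less n)
  show ?case
  proof (cases "even n")
    case True
    then obtain n' where n': "n = 2 * n'" by (elim evenE)
    then obtain k q where "n' = 2 ^ k * q" "odd q" using less.IH[of n'] less.prems by auto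
    then show ?thesis using n' by (intro exI[of _ "Suc k"] exI[of _ q]) simp
  next
    case False
    then show ?thesis by (intro exI[of _ 0] exI[of _ n]) simp
  qed
qed

section \<open>Generated subgroups and normality\<close>

context group
begin

text \<open>Allows invariance under conjugation to be checked on generators.\<close>

lemma conj_preimage_subgroup:
  assumes N: "subgroup N G" and g: "g \<in> carrier G"
  shows "subgroup {w \<in> carrier G. g \<otimes> w \<otimes> inv g \<in> N} G"
proof (rule subgroupI)
  have "g \<otimes> \<one> \<otimes> inv g \<in> N" using g subgroup.one_closed[OF N] by simp
  then show "{w \<in> carrier G. g \<otimes> w \<otimes> inv g \<in> N} \<noteq> {}" by auto
  fix u assume u: "u \<in> {w \<in> carrier G. g \<otimes> w \<otimes> inv g \<in> N}"
  have "inv (g \<otimes> u \<otimes> inv g) = g \<otimes> inv u \<otimes> inv g" using u g by (simp add: inv_mult_group m_assoc)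
  moreover have "inv (g \<otimes> u \<otimes> inv g) \<in> N" using u subgroup.m_inv_closed[OF N] by blast
  ultimately show "inv u \<in> {w \<in> carrier G. g \<otimes> w \<otimes> inv g \<in> N}" using u by simp
  fix v assume v: "v \<in> {w \<in> carrier G. g \<otimes> w \<otimes> inv g \<in> N}"
  have "(g \<otimes> u \<otimes> inv g) \<otimes> (g \<otimes> v \<otimes> inv g) = g \<otimes> (u \<otimes> v) \<otimes> inv g"
    using u v g by (simp add: m_assoc flip: m_assoc[of "inv g" g])
  moreover have "(g \<otimes> u \<otimes> inv g) \<otimes> (g \<otimes> v \<otimes> inv g) \<in> N"
    using u v subgroup.m_closed[OF N] by blast
  ultimately show "u \<otimes> v \<in> {w \<in> carrier G. g \<otimes> w \<otimes> inv g \<in> N}" using u v by simp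
qed auto

text \<open>Allows commutation with \<open>g\<close> to be checked on generators.\<close>

lemma centralizer_subgroup:
  assumes g: "g \<in> carrier G"
  shows "subgroup {w \<in> carrier G. g \<otimes> w = w \<otimes> g} G"
proof (rule subgroupI)
  show "{w \<in> carrier G. g \<otimes> w = w \<otimes> g} \<noteq> {}" using g by (auto intro!: exI[of _ \<one>])
  fix u assume u: "u \<in> {w \<in> carrier G. g \<otimes> w = w \<otimes> g}"
  then have "inv u \<otimes> (g \<otimes> u) \<otimes> inv u = inv u \<otimes> (u \<otimes> g) \<otimes> inv u" by simp
  moreover have uc: "u \<in> carrier G" using u by simp
  then have "inv u \<otimes> (g \<otimes> u) \<otimes> inv u = inv u \<otimes> g" using g by (simp add: m_assoc)
  moreover have "inv u \<otimes> (u \<otimes> g) \<otimes> inv u = g \<otimes> inv u" using g uc by (simp add: m_assoc[symmetric])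
  ultimately have "inv u \<otimes> g = g \<otimes> inv u" by simp
  then show "inv u \<in> {w \<in> carrier G. g \<otimes> w = w \<otimes> g}" using u by simp
  fix v assume v: "v \<in> {w \<in> carrier G. g \<otimes> w = w \<otimes> g}"
  then have vc: "v \<in> carrier G" by simp
  have "g \<otimes> (u \<otimes> v) = (g \<otimes> u) \<otimes> v" using uc vc g by (simp add: m_assoc)
  also have "g \<otimes> u = u \<otimes> g" using u by simp
  also have "u \<otimes> g \<otimes> v = u \<otimes> (g \<otimes> v)" using uc vc g by (simp add: m_assoc)
  also have "g \<otimes> v = v \<otimes> g" using v by simp
  also have "u \<otimes> (v \<otimes> g) = (u \<otimes> v) \<otimes> g" using uc vc g by (simp add: m_assoc)
  finally show "u \<otimes> v \<in> {w \<in> carrier G. g \<otimes> w = w \<otimes> g}" using u v by simp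
qed auto

lemma subgroup_nat_pow_closed:
  assumes "subgroup H G" "h \<in> H" shows "h [^] (k :: nat) \<in> H"
  using subgroup_int_pow_closed[OF assms, of "int k"] by (simp only: int_pow_int)

lemma generate_one_normalI:
  assumes x: "x \<in> carrier G" and c: "\<And>g. g \<in> carrier G \<Longrightarrow> g \<otimes> x \<otimes> inv g \<in> generate G {x}"
  shows "generate G {x} \<lhd> G"
proof -
  have N: "subgroup (generate G {x}) G" using x by (simp add: generate_is_subgroup)
  have "generate G {x} \<subseteq> {w \<in> carrier G. g \<otimes> w \<otimes> inv g \<in> generate G {x}}" if "g \<in> carrier G" for g
    using x c[OF that] by (intro generate_subgroup_incl conj_preimage_subgroup N that) auto
  then show ?thesis unfolding normal_inv_iff using N by blast
qed

lemma generate_one_central_normal: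
  assumes x: "x \<in> carrier G" and c: "\<And>g. g \<in> carrier G \<Longrightarrow> x \<otimes> g = g \<otimes> x"
  shows "generate G {x} \<lhd> G"
proof (rule generate_one_normalI[OF x])
  fix g assume g: "g \<in> carrier G"
  have "g \<otimes> x \<otimes> inv g = x" using x g c[OF g] by (simp add: m_assoc flip: c)
  then show "g \<otimes> x \<otimes> inv g \<in> generate G {x}" by (simp add: generate.incl)
qed

text \<open>If every <h> with h in H is normal, then each conjugate of h stays in <h>, hence in
  H.\<close>

lemma nonnormal_cyclic:
  assumes H: "subgroup H G" "\<not> H \<lhd> G"
  obtains x where "x \<in> H" "\<not> generate G {x} \<lhd> G"
proof -
  have "\<exists>x\<in>H. \<not> generate G {x} \<lhd> G"
  proof (rule ccontr)
    assume "\<not> (\<exists>x\<in>H. \<not> generate G {x} \<lhd> G)"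
    then have n: "generate G {x} \<lhd> G" if "x \<in> H" for x using that by blast
    have "H \<lhd> G" unfolding normal_inv_iff
    proof (intro conjI ballI H(1))
      fix g h assume g: "g \<in> carrier G" and h: "h \<in> H"
      have "g \<otimes> h \<otimes> inv g \<in> generate G {h}"
        using n[OF h] g unfolding normal_inv_iff by (simp add: generate.incl)
      then show "g \<otimes> h \<otimes> inv g \<in> H" using generate_subgroup_incl[OF _ H(1), of "{h}"] h by blast
    qed
    then show False using H(2) by simp
  qed
  then show ?thesis using that by blast
qed

lemma finite_submonoid_subgroup:
  assumes fin: "finite (carrier G)" and U: "U \<subseteq> carrier G" "\<one> \<in> U"
    and closed: "\<And>u v. u \<in> U \<Longrightarrow> v \<in> U \<Longrightarrow> u \<otimes> v \<in> U"
  shows "subgroup U G"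
proof (rule subgroupI)
  fix u assume u: "u \<in> U"
  have p: "u [^] n \<in> U" for n :: nat by (induction n) (use U u closed in auto)
  have uc: "u \<in> carrier G" using U u by blast
  have "order G > 0" using fin uc by (auto simp: order_def card_gt_0_iff)
  then have "u [^] (order G - 1) \<otimes> u = u [^] order G"
    by (metis Suc_pred nat_pow_Suc One_nat_def)
  then have "inv u = u [^] (order G - 1)"
    using uc pow_order_eq_1[OF uc] by (intro inv_equality) auto
  then show "inv u \<in> U" using p by simp
qed (use assms in auto)

lemma inverting_products_subgroup:
  assumes fin: "finite (carrier G)" and AB: "A \<in> carrier G" "B \<in> carrier G" "A \<otimes> B = B \<otimes> inv A"
  shows "subgroup {B [^] i \<otimes> A [^] j | (i::nat) (j::int). True} G" (is "subgroup ?U G")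
    and "A \<in> {B [^] i \<otimes> A [^] j | (i::nat) (j::int). True}"
    and "B \<in> {B [^] i \<otimes> A [^] j | (i::nat) (j::int). True}"
proof -
  show "subgroup ?U G"
  proof (rule finite_submonoid_subgroup[OF fin])
    show "?U \<subseteq> carrier G" using AB by auto
    have "\<one> = B [^] (0::nat) \<otimes> A [^] (0::int)" by simp
    then show "\<one> \<in> ?U" by blast
    fix u v assume "u \<in> ?U" "v \<in> ?U"
    then obtain i k :: nat and j l :: int where "u = B [^] i \<otimes> A [^] j" "v = B [^] k \<otimes> A [^] l" by blast
    then show "u \<otimes> v \<in> ?U" using inverting_mult_form[OF AB] by blast
  qed
  have "A = B [^] (0::nat) \<otimes> A [^] (1::int)" using AB by simp
  then show "A \<in> ?U" by blast
  have "B = B [^] (1::nat) \<otimes> A [^] (0::int)" using AB by simp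
  then show "B \<in> ?U" by blast
qed

text \<open>The products B^i A^j form a subgroup containing both generators, hence all of G; integer
  exponents of A are then reduced modulo m.\<close>

lemma iso_presented_group_gen:
  assumes fin: "finite (carrier G)" and AB: "inverting_pair G m s r A B"
    and m: "m > 0" and s: "s > 0" "even s" and r: "m dvd 2 * r"
    and gen: "\<And>M. subgroup M G \<Longrightarrow> A \<in> M \<Longrightarrow> B \<in> M \<Longrightarrow> M = carrier G"
    and ord: "order G = m * s"
  shows "G \<cong> presented_group (inverting_rels m s r)"
proof (rule iso_presented_group[OF AB m s r _ ord])
  fix x assume x: "x \<in> carrier G"
  have c: "A \<in> carrier G" "B \<in> carrier G" "A \<otimes> B = B \<otimes> inv A" "A [^] m = \<one>"
    using AB by (auto simp: inverting_pair_def)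
  have "{B [^] i \<otimes> A [^] j | (i::nat) (j::int). True} = carrier G"
    by (intro gen inverting_products_subgroup fin c)
  then obtain i :: nat and j :: int where ij: "x = B [^] i \<otimes> A [^] j" using x by blast
  have "A [^] j = (A [^] int m) [^] (j div int m) \<otimes> A [^] (j mod int m)"
    using c(1) by (simp only: int_pow_pow int_pow_mult[symmetric] mult_div_mod_eq)
  also have "A [^] int m = \<one>" using c(4) by (simp only: int_pow_int)
  also have "\<one> [^] (j div int m) \<otimes> A [^] (j mod int m) = A [^] (int (nat (j mod int m)))"
    using c m by simp
  finally have "x = B [^] i \<otimes> A [^] (nat (j mod int m))" using ij by (simp only: int_pow_int)
  then show "\<exists>(i::nat) (j::nat). x = B [^] i \<otimes> A [^] j" by blast
qed

text \<open>This recognises the dihedral group, with \<alpha> as rotation and t as reflection. An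
  element that does not commute with t and does not square to 1 has order 4, since order 8 would put
  t into <\<alpha>>. Then <\<alpha>> has index 2, so t conjugates \<alpha> to some \<alpha>^k, and k
  = 0, 1, 2 are excluded in turn.\<close>

lemma dihedral_of_order_8:
  assumes fin: "finite (carrier G)" and ord: "order G = 8"
    and t: "t \<in> carrier G" "t \<otimes> t = \<one>" and z: "z \<in> carrier G" "t \<otimes> z \<noteq> z \<otimes> t"
  obtains \<alpha> where "\<alpha> \<in> carrier G" "\<alpha> \<otimes> t = t \<otimes> inv \<alpha>" "\<alpha> \<otimes> \<alpha> \<noteq> \<one>" "\<alpha> [^] (4::nat) = \<one>" "t \<noteq> \<alpha>"
    "\<And>M. subgroup M G \<Longrightarrow> \<alpha> \<in> M \<Longrightarrow> t \<in> M \<Longrightarrow> M = carrier G"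
proof -
  have "\<exists>\<alpha>\<in>carrier G. \<alpha> \<otimes> \<alpha> \<noteq> \<one> \<and> t \<otimes> \<alpha> \<noteq> \<alpha> \<otimes> t"
  \<comment> \<open>If z is an involution as well, z t replaces it: the product of two non-commuting
    involutions does not square to 1.\<close>
  proof (cases "z \<otimes> z = \<one>")
    case True
    have zt: "z \<otimes> t \<in> carrier G" using z t by simp
    have "z \<otimes> t \<otimes> (z \<otimes> t) \<noteq> \<one>"
    proof
      assume "z \<otimes> t \<otimes> (z \<otimes> t) = \<one>"
      then have "inv (z \<otimes> t) = z \<otimes> t" using zt by (intro inv_equality)
      moreover have "inv z = z" "inv t = t" using True t z by (auto intro: inv_equality)
      ultimately show False using z t by (simp add: inv_mult_group)
    qed
    moreover have "t \<otimes> (z \<otimes> t) \<noteq> z \<otimes> t \<otimes> t"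
      using z t by (metis m_assoc m_closed r_cancel)
    ultimately show ?thesis using zt by blast
  qed (use z in blast)
  then obtain \<alpha> where \<alpha>: "\<alpha> \<in> carrier G" "\<alpha> \<otimes> \<alpha> \<noteq> \<one>" "t \<otimes> \<alpha> \<noteq> \<alpha> \<otimes> t" by blast
  let ?N = "generate G {\<alpha>}"
  have N: "subgroup ?N G" using \<alpha> by (simp add: generate_is_subgroup)
  have Npow: "?N = {\<alpha> [^] k | k. k \<in> (UNIV :: nat set)}"
    by (rule generate_pow_on_finite_carrier[OF fin \<alpha>(1)])
  have tN: "t \<notin> ?N"
  proof
    assume "t \<in> ?N"
    then obtain k :: nat where "t = \<alpha> [^] k" using Npow by blast
    then show False using \<alpha> by (metis nat_pow_comm nat_pow_eone)
  qed
  have "ord \<alpha> dvd 2 ^ 3" using ord_dvd_group_order[OF \<alpha>(1)] ord by simp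
  then obtain e where e: "e \<le> 3" "ord \<alpha> = 2 ^ e"
    using divides_primepow_nat[OF two_is_prime_nat] by blast
  have cardN: "card ?N = 2 ^ e" using generate_pow_card[OF \<alpha>(1)] e by simp
  have "e \<noteq> 3"
  proof
    assume "e = 3"
    then have "?N = carrier G"
      using cardN ord fin subgroup.subset[OF N] by (intro card_subset_eq) (auto simp: order_def)
    then show False using tN t by simp
  qed
  moreover have "\<not> e \<le> 1"
  proof
    assume "e \<le> 1"
    then have "ord \<alpha> dvd 2" using e le_imp_power_dvd[of e 1 "2::nat"] by simp
    then have "\<alpha> [^] (2::nat) = \<one>" using \<alpha> pow_eq_id by simp
    then show False using \<alpha> by (simp add: numeral_2_eq_2)
  qed
  ultimately have e2: "e = 2" using e by linarith
  then have \<alpha>4: "\<alpha> [^] (4::nat) = \<one>" using \<alpha> e pow_eq_id by simp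
  have "?N \<lhd> G" using index_2_normal[OF fin N] cardN e2 ord by simp
  then have "inv t \<otimes> \<alpha> \<otimes> t \<in> ?N" by (rule normal.inv_op_closed1) (use t in \<open>simp_all add: generate.incl\<close>)
  then obtain k :: nat where "inv t \<otimes> \<alpha> \<otimes> t = \<alpha> [^] k" using Npow by blast
  moreover have "\<alpha> [^] k = \<alpha> [^] (k mod 4)"
  proof -
    have "\<alpha> [^] k = (\<alpha> [^] (4::nat)) [^] (k div 4) \<otimes> \<alpha> [^] (k mod 4)"
      using \<alpha>(1) by (simp only: nat_pow_pow nat_pow_mult mult_div_mod_eq)
    then show ?thesis using \<alpha> \<alpha>4 by simp
  qed
  ultimately have conj: "inv t \<otimes> \<alpha> \<otimes> t = \<alpha> [^] (k mod 4)" by simp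
  have at: "\<alpha> \<otimes> t = t \<otimes> \<alpha> [^] (k mod 4)"
  proof -
    have "t \<otimes> (inv t \<otimes> \<alpha> \<otimes> t) = \<alpha> \<otimes> t" using \<alpha> t by (simp add: m_assoc[symmetric])
    then show ?thesis using conj by simp
  qed
  have "k mod 4 \<noteq> 0"
  proof
    assume "k mod 4 = 0"
    then have "\<alpha> \<otimes> t = \<one> \<otimes> t" using at t by simp
    then have "\<alpha> = \<one>" using \<alpha> t by (simp only: r_cancel one_closed)
    then show False using \<alpha> by simp
  qed
  moreover have "k mod 4 \<noteq> 1"
  proof
    assume "k mod 4 = 1"
    then show False using at \<alpha> by simp
  qed
  moreover have "k mod 4 \<noteq> 2"
  proof
    assume k2: "k mod 4 = 2"
    \<comment> \<open>For k = 2 the conjugate of \<alpha>^2 would be \<alpha>^4 = 1.\<close>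
    have "\<alpha> \<otimes> (\<alpha> \<otimes> t) = t \<otimes> (\<alpha> [^] (2::nat) \<otimes> \<alpha> [^] (2::nat))"
    proof -
      have at2: "\<alpha> \<otimes> t = t \<otimes> \<alpha> [^] (2::nat)" using at k2 by simp
      have "\<alpha> \<otimes> (\<alpha> \<otimes> t) = \<alpha> \<otimes> (t \<otimes> \<alpha> [^] (2::nat))" by (simp only: at2)
      also have "\<dots> = (\<alpha> \<otimes> t) \<otimes> \<alpha> [^] (2::nat)" using \<alpha>(1) t(1) by (simp add: m_assoc)
      also have "\<dots> = t \<otimes> \<alpha> [^] (2::nat) \<otimes> \<alpha> [^] (2::nat)" by (simp only: at2)
      also have "\<dots> = t \<otimes> (\<alpha> [^] (2::nat) \<otimes> \<alpha> [^] (2::nat))" using \<alpha>(1) t(1) by (simp add: m_assoc)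
      finally show ?thesis .
    qed
    also have "\<alpha> [^] (2::nat) \<otimes> \<alpha> [^] (2::nat) = \<one>" using \<alpha> \<alpha>4 by (simp add: nat_pow_mult)
    finally have "(\<alpha> \<otimes> \<alpha>) \<otimes> t = \<one> \<otimes> t" using \<alpha> t by (simp add: m_assoc)
    then have "\<alpha> \<otimes> \<alpha> = \<one>" using \<alpha>(1) t(1) by (simp only: r_cancel one_closed m_closed)
    then show False using \<alpha> by simp
  qed
  ultimately have k3: "k mod 4 = 3" using mod_less_divisor[of 4 k] by linarith
  have "\<alpha> [^] (3::nat) \<otimes> \<alpha> = \<one>" using \<alpha>4 by (simp add: eval_nat_numeral)
  then have "inv \<alpha> = \<alpha> [^] (3::nat)" using \<alpha> by (intro inv_equality) auto
  then have at': "\<alpha> \<otimes> t = t \<otimes> inv \<alpha>" using at k3 by simp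
  show ?thesis
  proof (rule that[OF \<alpha>(1) at' \<alpha>(2) \<alpha>4])
    show "t \<noteq> \<alpha>" using \<alpha> by blast
    fix M assume M: "subgroup M G" "\<alpha> \<in> M" "t \<in> M"
    have sub: "?N \<subseteq> M" using M by (intro generate_subgroup_incl) auto
    have finM: "finite M" using subgroup.subset[OF M(1)] fin finite_subset by blast
    have "?N \<noteq> M" using tN M by blast
    then have "4 < card M" using psubset_card_mono[OF finM, of ?N] sub cardN e2 by auto
    moreover have "card M dvd 2 ^ 3" using card_subgroup_dvd[OF fin M(1)] ord by simp
    then obtain f where f: "f \<le> 3" "card M = 2 ^ f"
      using divides_primepow_nat[OF two_is_prime_nat] by blast
    ultimately have "\<not> f \<le> 2" using power_increasing[of f 2 "2::nat"] by auto
    then have "f = 3" using f by linarith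
    then show "M = carrier G"
      using f ord fin subgroup.subset[OF M(1)] by (intro card_subset_eq) (auto simp: order_def)
  qed
qed

text \<open>Let <x> be non-normal, x of order 2^k q with q odd. The element x^(2^k) has odd order q,
  so it generates a normal subgroup by \<open>even\<close>. If <x^q> were normal too, so would be
  <x>, because x is a product of powers of both elements by Bezout. Hence x^q is the element
  sought.\<close>

lemma exists_nonnormal_2_element:
  assumes fin: "finite (carrier G)"
    and even: "\<And>H. subgroup H G \<Longrightarrow> \<not> H \<lhd> G \<Longrightarrow> even (card H)"
    and ex: "subgroup H G" "\<not> H \<lhd> G"
  obtains x k where "x \<in> carrier G" "\<not> generate G {x} \<lhd> G" "ord x = 2 ^ k" "k \<ge> 1"
proof -
  obtain x where x: "x \<in> H" "\<not> generate G {x} \<lhd> G" by (rule nonnormal_cyclic[OF ex])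
  then have xc: "x \<in> carrier G" using subgroup.mem_carrier[OF ex(1)] by blast
  obtain k q where kq: "ord x = 2 ^ k * q" "odd q"
    using nat_odd_part[of "ord x"] ord_ge_1[OF fin xc] by auto
  have q0: "q \<noteq> 0" using kq by (cases q) auto
  let ?y = "x [^] q" and ?z = "x [^] (2 ^ k :: nat)"
  have oy: "ord ?y = 2 ^ k" using ord_pow[OF xc, of q] kq q0 by simp
  have oz: "ord ?z = q" using ord_pow[OF xc, of "2 ^ k"] kq by simp
  have nz: "generate G {?z} \<lhd> G"
  proof (rule ccontr)
    assume "\<not> generate G {?z} \<lhd> G"
    then have "even (card (generate G {?z}))" using xc by (intro even generate_is_subgroup) auto
    then show False using generate_pow_card[of ?z] xc oz kq by simp
  qed
  have "\<not> generate G {?y} \<lhd> G"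
  proof
    assume ny: "generate G {?y} \<lhd> G"
    let ?X = "generate G {x}"
    have X: "subgroup ?X G" using xc by (simp add: generate_is_subgroup)
    have yz: "?y \<in> ?X" "?z \<in> ?X" by (auto intro: subgroup_nat_pow_closed[OF X] generate.incl)
    have "coprime (int q) (int (2 ^ k))" using kq(2) by simp
    then obtain u v where uv: "u * int q + v * int (2 ^ k) = 1"
      using bezout_int[of "int q" "int (2 ^ k)"] by (auto simp: coprime_iff_gcd_eq_1)
    have xuv: "x = ?y [^] u \<otimes> ?z [^] v"
    proof -
      have "?y [^] u = x [^] (int q * u)" "?z [^] v = x [^] (int (2 ^ k) * v)"
        using xc by (simp_all only: int_pow_pow int_pow_int[symmetric])
      then have "?y [^] u \<otimes> ?z [^] v = x [^] (int q * u + int (2 ^ k) * v)"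
        using xc by (simp only: int_pow_mult)
      also have "int q * u + int (2 ^ k) * v = 1" using uv by (simp only: mult.commute)
      finally show ?thesis using xc by simp
    qed
    have "?X \<lhd> G"
    proof (rule generate_one_normalI[OF xc])
      fix g assume g: "g \<in> carrier G"
      let ?M = "{w \<in> carrier G. g \<otimes> w \<otimes> inv g \<in> ?X}"
      have M: "subgroup ?M G" by (rule conj_preimage_subgroup[OF X g])
      have "generate G {?y} \<subseteq> ?X" "generate G {?z} \<subseteq> ?X"
        using yz by (auto intro!: generate_subgroup_incl[OF _ X])
      moreover have "g \<otimes> ?y \<otimes> inv g \<in> generate G {?y}" "g \<otimes> ?z \<otimes> inv g \<in> generate G {?z}"
        using ny nz g unfolding normal_inv_iff by (simp_all add: generate.incl)
      ultimately have "?y \<in> ?M" "?z \<in> ?M" using xc by auto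
      then have "?y [^] u \<otimes> ?z [^] v \<in> ?M"
        by (intro subgroup.m_closed[OF M] subgroup_int_pow_closed[OF M])
      then have "x \<in> ?M" using xuv by simp
      then show "g \<otimes> x \<otimes> inv g \<in> ?X" by simp
    qed
    then show False using x by simp
  qed
  moreover have "k \<ge> 1"
  proof (rule ccontr)
    assume "\<not> k \<ge> 1"
    then have "?y = \<one>" using oy ord_eq_1[of ?y] xc by simp
    then have "generate G {?y} = {\<one>}" using generate_pow_card[of ?y] generate.one[of G "{?y}"] oy \<open>\<not> k \<ge> 1\<close> xc
      by (metis card_1_singletonE less_one linorder_not_less nat_pow_closed power_0 singletonD)
    then show False using calculation one_is_normal by simp
  qed
  ultimately show ?thesis using that[of ?y k] oy xc by simp
qed

text \<open>A subgroup of order 3 is normal because its order is odd. Its generator A does not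
  commute with x: both generate G by their orders, so x would be central and <x> normal. Hence x
  conjugates A to its inverse.\<close>

lemma classify_order_3_2pow:
  assumes fin: "finite (carrier G)"
    and even: "\<And>H. subgroup H G \<Longrightarrow> \<not> H \<lhd> G \<Longrightarrow> even (card H)"
    and x: "x \<in> carrier G" "\<not> generate G {x} \<lhd> G" "ord x = 2 ^ k" "k \<ge> 1"
    and ord: "order G = 3 * 2 ^ k"
  shows "G \<cong> C3_semidirect_C2pow k"
proof -
  have "\<exists>H. subgroup H G \<and> card H = 3 ^ 1"
    by (rule sylow_thm[of 3 G 1 "2 ^ k"]) (use ord fin group_axioms in simp_all)
  then obtain H where H: "subgroup H G" "card H = 3" by auto
  then have nH: "H \<lhd> G" using even[OF H(1)] by fastforce
  have "\<one> \<in> H" using subgroup.one_closed[OF H(1)] .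
  have "H \<noteq> {\<one>}" using H(2) by auto
  then obtain A where A: "A \<in> H" "A \<noteq> \<one>" using \<open>\<one> \<in> H\<close> by blast
  have Ac: "A \<in> carrier G" using subgroup.mem_carrier[OF H(1) A(1)] .
  have A3: "A [^] (3::nat) = \<one>" using subgroup_pow_card_eq_1[OF fin H(1) A(1)] H(2) by simp
  then have "ord A dvd 3" using Ac pow_eq_id by simp
  moreover from this have "ord A = 0 \<or> ord A = 1 \<or> ord A = 2 \<or> ord A = 3" using dvd_imp_le[of "ord A" 3] by linarith
  moreover have "ord A \<noteq> 1" using ord_eq_1[OF Ac] A(2) by simp
  ultimately have oA: "ord A = 3" by auto
  have full: "M = carrier G" if M: "subgroup M G" "A \<in> M" "x \<in> M" for M
  proof -
    have "3 dvd card M" "2 ^ k dvd card M"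
      using ord_dvd_card_subgroup[OF fin M(1)] M(2,3) oA x(3) by metis+
    moreover have "coprime (3::nat) (2 ^ k)" by simp
    ultimately have "order G dvd card M" using ord by (simp add: divides_mult)
    then have "card M = card (carrier G)"
      using card_subgroup_dvd[OF fin M(1)] by (simp add: order_def dvd_antisym)
    then show ?thesis using subgroup.subset[OF M(1)] fin by (intro card_subset_eq)
  qed
  have ncomm: "x \<otimes> A \<noteq> A \<otimes> x"
  proof
    assume "x \<otimes> A = A \<otimes> x"
    then have "{w \<in> carrier G. x \<otimes> w = w \<otimes> x} = carrier G"
      using x Ac by (intro full centralizer_subgroup) auto
    then have "x \<otimes> g = g \<otimes> x" if "g \<in> carrier G" for g using that by blast
    then show False using generate_one_central_normal[OF x(1)] x(2) by blast
  qed
  have Hsub: "{\<one>, A, inv A} \<subseteq> H" using \<open>\<one> \<in> H\<close> A subgroup.m_inv_closed[OF H(1)] by auto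
  have "A \<noteq> inv A"
  proof
    assume "A = inv A"
    then have "A \<otimes> A = \<one>" using Ac by (metis r_inv)
    then have "A [^] (2::nat) = \<one>" using Ac by (simp add: numeral_2_eq_2)
    then show False using pow_eq_id[OF Ac, of 2] oA by simp
  qed
  moreover have "inv A \<noteq> \<one>" using A(2) Ac by (metis inv_inv inv_one)
  ultimately have "card {\<one>, A, inv A} = 3" using A(2) by (simp add: A(2)[symmetric] not_sym)
  moreover have "finite H" using H(2) by (intro card_ge_0_finite) simp
  ultimately have Heq: "H = {\<one>, A, inv A}" using Hsub H(2) by (metis card_subset_eq)
  have conj: "inv x \<otimes> A \<otimes> x \<in> H" using normal.inv_op_closed1[OF nH x(1) A(1)] .
  have Ax: "A \<otimes> x = x \<otimes> (inv x \<otimes> A \<otimes> x)" using Ac x(1) by (simp add: m_assoc[symmetric])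
  have "inv x \<otimes> A \<otimes> x \<noteq> \<one>"
  proof
    assume "inv x \<otimes> A \<otimes> x = \<one>"
    then have "A \<otimes> x = \<one> \<otimes> x" using Ax x(1) by simp
    then have "A = \<one>" using Ac x(1) by (simp only: r_cancel one_closed)
    then show False using A(2) by simp
  qed
  moreover have "inv x \<otimes> A \<otimes> x \<noteq> A" using Ax ncomm by auto
  ultimately have "A \<otimes> x = x \<otimes> inv A" using conj Heq Ax by auto
  then have "inverting_pair G 3 (2 ^ k) 0 A x"
    using Ac x A3 pow_eq_id[OF x(1), of "2 ^ k"] by (simp add: inverting_pair_def)
  then show ?thesis unfolding C3_semidirect_C2pow_eq
    by (rule iso_presented_group_gen[OF fin]) (use full ord x(4) in auto)
qed

end

section \<open>Index 4: the groups of order 4 * 2^k\<close>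

context group
begin

text \<open>The element w = A^4 lies in the central subgroup K = <x^2> and is also inverted by x, so
  w^2 = 1. The case w = 1 leads to \<open>D4\<close> (k = 1) and \<open>C4_semidirect_C4\<close> (k
  = 2), the other case to \<open>Q16\<close> (k = 2). For k \<ge> 3 an element built from A and a
  square root in K of the involution of <x> contradicts \<open>small\<close>.\<close>

lemma classify_inverted_2group:
  assumes fin: "finite (carrier G)" and x: "x \<in> carrier G" "ord x = 2 ^ k" "k \<ge> 1"
    and ord: "order G = 4 * 2 ^ k"
    and A: "A \<in> carrier G" "A \<otimes> x = x \<otimes> inv A"
    and A4: "A [^] (4::nat) \<in> generate G {x [^] (2::nat)}"
    and A2: "A \<otimes> A \<notin> generate G {x [^] (2::nat)}"
    and central: "\<And>c g. c \<in> generate G {x [^] (2::nat)} \<Longrightarrow> g \<in> carrier G \<Longrightarrow> c \<otimes> g = g \<otimes> c"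
    and gen: "\<And>M. subgroup M G \<Longrightarrow> A \<in> M \<Longrightarrow> x \<in> M \<Longrightarrow> M = carrier G"
    and small: "\<And>c. c \<in> carrier G \<Longrightarrow> ord c < 2 ^ k \<Longrightarrow> generate G {c} \<lhd> G"
  shows "G \<cong> D4 \<or> G \<cong> Q16 \<or> G \<cong> C4_semidirect_C4"
proof -
  let ?K = "generate G {x [^] (2::nat)}"
  have K: "subgroup ?K G" using x by (simp add: generate_is_subgroup)
  have Kc: "c \<in> carrier G" if "c \<in> ?K" for c using subgroup.mem_carrier[OF K that] .
  have Kpow: "?K = {(x [^] (2::nat)) [^] i | i. i \<in> (UNIV :: nat set)}"
    using x by (intro generate_pow_on_finite_carrier fin) simp
  have x1: "x [^] n = \<one> \<longleftrightarrow> 2 ^ k dvd n" for n :: nat using pow_eq_id[OF x(1)] x(2) by simp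
  have iA: "A [^] j \<otimes> x = x \<otimes> A [^] (- j)" for j :: int
    using inverting_commute[OF A(1) x(1) A(2), of j 1] x(1) by simp
  define w where "w = A [^] (4::nat)"
  have wK: "w \<in> ?K" using A4 by (simp add: w_def)
  have wc: "w \<in> carrier G" using Kc[OF wK] .
  have ww: "w \<otimes> w = \<one>"
  proof -
    have "x \<otimes> w = w \<otimes> x" using central[OF wK x(1)] by simp
    also have "w \<otimes> x = x \<otimes> inv w"
      using iA[of 4] A(1) int_pow_int[of G A 4] by (simp add: w_def int_pow_neg)
    finally have "w = inv w" using x(1) wc by simp
    then show ?thesis using wc by (metis r_inv)
  qed
  have A2c: "A \<otimes> A = A [^] (2::nat)" using A(1) by (simp add: numeral_2_eq_2)
  have A8: "A [^] (8::nat) = \<one>" using ww A(1) by (simp add: w_def nat_pow_mult)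
  have xpow: "x [^] (2 ^ k :: nat) = \<one>" by (simp add: x1)
  \<comment> \<open>The root is x^(2^(k-2)); for k \<ge> 3 its exponent is even, so it lies in
    K.\<close>
  have quarter: "\<exists>s\<in>?K. s \<otimes> s = x [^] (2 ^ (k - 1) :: nat)" if k3: "k \<ge> 3"
  proof -
    obtain l where l: "k = Suc (Suc (Suc l))" using k3 by (metis add_2_eq_Suc' le_add_diff_inverse2 numeral_3_eq_3 add_Suc_right)
    have "(x [^] (2::nat)) [^] (2 ^ l :: nat) \<in> ?K" by (intro subgroup_nat_pow_closed[OF K] generate.incl) simp
    moreover have "(x [^] (2::nat)) [^] (2 ^ l :: nat) \<otimes> (x [^] (2::nat)) [^] (2 ^ l :: nat) = x [^] (2 ^ (k - 1) :: nat)"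
      using x(1) by (simp add: nat_pow_pow nat_pow_mult l)
    ultimately show ?thesis by blast
  qed
  have half: "x [^] (2 ^ (k - 1) :: nat) \<noteq> \<one>"
  proof
    assume "x [^] (2 ^ (k - 1) :: nat) = \<one>"
    then have "(2::nat) ^ k dvd 2 ^ (k - 1)" by (simp only: x1)
    then have "(2::nat) ^ k \<le> 2 ^ (k - 1)" by (rule dvd_imp_le) simp
    then show False using x(3) by (cases k) auto
  qed
  have half2: "x [^] (2 ^ (k - 1) :: nat) \<otimes> x [^] (2 ^ (k - 1) :: nat) = \<one>"
  proof -
    have "2 ^ (k - 1) + 2 ^ (k - 1) = (2 ^ k :: nat)" using x(3) by (cases k) auto
    then show ?thesis using x(1) xpow by (simp add: nat_pow_mult)
  qed
  show ?thesis
  proof (cases "w = \<one>")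
    case True
    then have A41: "A [^] (4::nat) = \<one>" by (simp add: w_def)
    have "\<not> k \<ge> 3"
    proof
      assume k3: "k \<ge> 3"
      obtain s where s: "s \<in> ?K" "s \<otimes> s = x [^] (2 ^ (k - 1) :: nat)" using quarter[OF k3] by blast
      have sc: "s \<in> carrier G" using Kc[OF s(1)] .
      \<comment> \<open>Here c^4 = 1, so \<open>small\<close> makes <c> normal, while x conjugates c
        to inv A s. Equating this with c^j puts A^(j+1) into K. As A^2 is not in K, j is 3 modulo 4,
        and then s = s^3 contradicts s^2 \<noteq> 1.\<close>
      let ?c = "A \<otimes> s"
      have cc: "?c \<in> carrier G" using A sc by simp
      have s4: "s [^] (4::nat) = \<one>"
      proof -
        have "s [^] (4::nat) = (s \<otimes> s) \<otimes> (s \<otimes> s)" using sc by (simp add: eval_nat_numeral m_assoc)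
        then show ?thesis using s half2 by simp
      qed
      have comm: "A \<otimes> s = s \<otimes> A" using central[OF s(1) A(1)] by simp
      have c4: "?c [^] (4::nat) = \<one>"
        using pow_mult_distrib[OF comm A(1) sc, of 4] A41 s4 by simp
      then have "ord ?c dvd 4" using pow_eq_id[OF cc] by simp
      then have "ord ?c \<le> 4" by (rule dvd_imp_le) simp
      also have "(4::nat) < 2 ^ 3" by simp
      also have "(2::nat) ^ 3 \<le> 2 ^ k" using k3 by (intro power_increasing) auto
      finally have n: "generate G {?c} \<lhd> G" by (rule small[OF cc])
      have "inv x \<otimes> ?c \<otimes> x \<in> generate G {?c}"
        by (rule normal.inv_op_closed1[OF n x(1)]) (simp add: generate.incl)
      moreover have "inv x \<otimes> ?c \<otimes> x = inv A \<otimes> s"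
      proof -
        have "?c \<otimes> x = A \<otimes> (s \<otimes> x)" using A(1) sc x(1) by (simp add: m_assoc)
        also have "s \<otimes> x = x \<otimes> s" by (rule central[OF s(1) x(1)])
        also have "A \<otimes> (x \<otimes> s) = (A \<otimes> x) \<otimes> s" using A(1) sc x(1) by (simp add: m_assoc)
        also have "A \<otimes> x = x \<otimes> inv A" by (rule A(2))
        finally have "?c \<otimes> x = x \<otimes> (inv A \<otimes> s)" using A(1) sc x(1) by (simp add: m_assoc)
        moreover have "inv x \<otimes> ?c \<otimes> x = inv x \<otimes> (?c \<otimes> x)" using cc x(1) by (simp add: m_assoc)
        ultimately show ?thesis using A(1) sc x(1) by (simp add: m_assoc[symmetric])
      qed
      moreover have "generate G {?c} = {?c [^] j | j. j \<in> (UNIV :: nat set)}"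
        by (rule generate_pow_on_finite_carrier[OF fin cc])
      ultimately obtain j :: nat where "inv A \<otimes> s = ?c [^] j" by auto
      moreover have "?c [^] j = ?c [^] (j mod 4)"
      proof -
        have "?c [^] j = (?c [^] (4::nat)) [^] (j div 4) \<otimes> ?c [^] (j mod 4)"
          using cc by (simp only: nat_pow_pow nat_pow_mult mult_div_mod_eq)
        then show ?thesis using cc c4 by simp
      qed
      moreover have "?c [^] (j mod 4) = A [^] (j mod 4) \<otimes> s [^] (j mod 4)"
        by (rule pow_mult_distrib[OF comm A(1) sc])
      ultimately have eq: "inv A \<otimes> s = A [^] (j mod 4) \<otimes> s [^] (j mod 4)" by simp
      have "s = A \<otimes> (inv A \<otimes> s)" using A(1) sc by (simp add: m_assoc[symmetric])
      also have "\<dots> = A [^] Suc (j mod 4) \<otimes> s [^] (j mod 4)"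
        using A(1) sc by (simp only: eq nat_pow_Suc2 m_assoc nat_pow_closed)
      finally have eq: "s = A [^] Suc (j mod 4) \<otimes> s [^] (j mod 4)" .
      have AK: "A [^] Suc (j mod 4) \<in> ?K"
      proof -
        have "A [^] Suc (j mod 4) = s \<otimes> inv (s [^] (j mod 4))"
          using eq A(1) sc by (metis inv_solve_right nat_pow_closed)
        then show ?thesis
          using s(1) subgroup.m_closed[OF K] subgroup.m_inv_closed[OF K] subgroup_nat_pow_closed[OF K] by simp
      qed
      have "j mod 4 = 3"
      proof (rule ccontr)
        assume "j mod 4 \<noteq> 3"
        then consider "j mod 4 = 0" | "j mod 4 = 1" | "j mod 4 = 2"
          using mod_less_divisor[of 4 j] by linarith
        then show False
        proof cases
          case 1
          then have "A \<in> ?K" using AK A(1) by simp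
          then show False using A2 subgroup.m_closed[OF K] by blast
        next
          case 2
          then show False using AK A2 A(1) by simp
        next
          case 3
          have "A [^] (3::nat) \<otimes> A = \<one>" using A41 by (simp add: eval_nat_numeral)
          then have "inv A = A [^] (3::nat)" using A(1) by (intro inv_equality) auto
          then have "inv A \<in> ?K" using AK 3 by (simp add: numeral_3_eq_3)
          then have "A \<in> ?K" using subgroup.m_inv_closed[OF K] A(1) by force
          then show False using A2 subgroup.m_closed[OF K] by blast
        qed
      qed
      then have "Suc (j mod 4) = 4" by simp
      then have "A [^] Suc (j mod 4) = \<one>" using A41 by (simp only:)
      then have "s = s [^] (3::nat)" using eq sc \<open>j mod 4 = 3\<close> by (metis l_one nat_pow_closed)
      also have "\<dots> = s \<otimes> (s \<otimes> s)" using sc by (simp add: numeral_3_eq_3 m_assoc)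
      finally have "s \<otimes> s = \<one>" using sc by (metis l_cancel m_closed one_closed r_one)
      then show False using s half by simp
    qed
    then have "k = 1 \<or> k = 2" using x(3) by linarith
    then show ?thesis
    proof
      assume k: "k = 1"
      have "inverting_pair G 4 2 0 A x"
        using A x(1) A41 xpow k by (simp add: inverting_pair_def)
      then have "G \<cong> D4" unfolding D4_eq
        by (rule iso_presented_group_gen[OF fin]) (use gen ord k in auto)
      then show ?thesis by simp
    next
      assume k: "k = 2"
      have "inverting_pair G 4 4 0 A x"
        using A x(1) A41 xpow k by (simp add: inverting_pair_def)
      then have "G \<cong> C4_semidirect_C4" unfolding C4_semidirect_C4_eq
        by (rule iso_presented_group_gen[OF fin]) (use gen ord k in auto)
      then show ?thesis by simp
    qed
  next
    case False
    obtain i :: nat where i: "w = x [^] (2 * i)" using wK Kpow x(1) by (auto simp: nat_pow_pow)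
    have "w \<otimes> w = x [^] (2 * i + 2 * i)" unfolding i using x(1) by (simp add: nat_pow_mult)
    then have "x [^] (2 * i + 2 * i) = \<one>" using ww by simp
    then have "2 ^ k dvd 2 * i + 2 * i" by (simp only: x1)
    then have "2 * 2 ^ (k - 1) dvd 2 * (2 * i)" using x(3) by (cases k) auto
    then have "2 ^ (k - 1) dvd 2 * i" by (simp only: nat_mult_dvd_cancel_disj) simp
    then obtain l where l: "2 * i = 2 ^ (k - 1) * l" ..
    have wl: "w = (x [^] (2 ^ (k - 1) :: nat)) [^] l" using i l x(1) by (simp add: nat_pow_pow)
    \<comment> \<open>A nontrivial element of square 1 in the cyclic group <x> is its unique
      involution.\<close>
    have weq: "w = x [^] (2 ^ (k - 1) :: nat)"
    proof -
      let ?h = "x [^] (2 ^ (k - 1) :: nat)"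
      have hc: "?h \<in> carrier G" using x by simp
      have h2: "?h [^] (2::nat) = \<one>" using half2 hc by (simp add: numeral_2_eq_2)
      have "odd l"
      proof (rule ccontr)
        assume "\<not> odd l"
        then obtain l' where "l = 2 * l'" by (auto elim: evenE)
        then have "w = (?h [^] (2::nat)) [^] l'" using wl hc by (simp add: nat_pow_pow)
        then show False using h2 False by simp
      qed
      then obtain l' where "l = 2 * l' + 1" by (elim oddE)
      then have "w = (?h [^] (2::nat)) [^] l' \<otimes> ?h [^] (1::nat)"
        using wl hc by (simp only: nat_pow_pow nat_pow_mult)
      then show ?thesis using h2 hc by simp
    qed
    have "k \<noteq> 1"
    proof
      assume "k = 1"
      then have "w = x [^] (2 ^ k * i)" using i by simp
      then show False using False x1[of "2 ^ k * i"] by simp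
    qed
    moreover have "\<not> k \<ge> 3"
    proof
      assume k3: "k \<ge> 3"
      obtain s where s: "s \<in> ?K" "s \<otimes> s = w" using quarter[OF k3] weq by auto
      have sc: "s \<in> carrier G" using Kc[OF s(1)] .
      let ?B = "A \<otimes> A"
      \<comment> \<open>Now s^2 = w = A^4, so c = A^2 s squares to w^2 = 1 and <c> is normal by
        \<open>small\<close>. Its conjugate inv (A^2) s under x must be 1 or c: the first puts A^2
        into K, the second gives w = 1.\<close>
      let ?c = "?B \<otimes> s"
      have Bc: "?B \<in> carrier G" using A by simp
      have cc: "?c \<in> carrier G" using A sc by simp
      have comm: "?B \<otimes> s = s \<otimes> ?B" using central[OF s(1) Bc] by simp
      have BB: "?B \<otimes> ?B = w" using A(1) by (simp add: w_def eval_nat_numeral m_assoc)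
      have c2: "?c [^] (2::nat) = \<one>"
      proof -
        have "?c [^] (2::nat) = ?B [^] (2::nat) \<otimes> s [^] (2::nat)" by (rule pow_mult_distrib[OF comm Bc sc])
        also have "\<dots> = w \<otimes> w" using BB s(2) Bc sc by (simp add: numeral_2_eq_2)
        finally show ?thesis using ww by simp
      qed
      then have "ord ?c dvd 2" using pow_eq_id[OF cc] by simp
      then have "ord ?c \<le> 2" by (rule dvd_imp_le) simp
      also have "(2::nat) < 2 ^ 3" by simp
      also have "(2::nat) ^ 3 \<le> 2 ^ k" using k3 by (intro power_increasing) auto
      finally have n: "generate G {?c} \<lhd> G" by (rule small[OF cc])
      have "inv x \<otimes> ?c \<otimes> x \<in> generate G {?c}"
        by (rule normal.inv_op_closed1[OF n x(1)]) (simp add: generate.incl)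
      moreover have "inv x \<otimes> ?c \<otimes> x = inv ?B \<otimes> s"
      proof -
        have Bx: "?B \<otimes> x = x \<otimes> inv ?B"
          using iA[of 2] A(1) int_pow_int[of G A 2] by (simp add: A2c int_pow_neg)
        have "?c \<otimes> x = ?B \<otimes> (s \<otimes> x)" using Bc sc x(1) by (simp add: m_assoc)
        also have "s \<otimes> x = x \<otimes> s" by (rule central[OF s(1) x(1)])
        also have "?B \<otimes> (x \<otimes> s) = (?B \<otimes> x) \<otimes> s" using Bc sc x(1) by (simp add: m_assoc)
        also have "?B \<otimes> x = x \<otimes> inv ?B" by (rule Bx)
        finally have cx: "?c \<otimes> x = x \<otimes> (inv ?B \<otimes> s)" using Bc sc x(1) by (simp add: m_assoc)
        have "inv x \<otimes> ?c \<otimes> x = inv x \<otimes> (?c \<otimes> x)" using cc x(1) by (simp only: m_assoc inv_closed)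
        also have "\<dots> = inv x \<otimes> (x \<otimes> (inv ?B \<otimes> s))" by (simp only: cx)
        also have "\<dots> = (inv x \<otimes> x) \<otimes> (inv ?B \<otimes> s)" using Bc sc x(1) by (simp only: m_assoc inv_closed m_closed)
        finally show ?thesis using Bc sc x(1) by simp
      qed
      moreover have "generate G {?c} = {?c [^] j | j. j \<in> (UNIV :: nat set)}"
        by (rule generate_pow_on_finite_carrier[OF fin cc])
      ultimately obtain j :: nat where "inv ?B \<otimes> s = ?c [^] j" by auto
      moreover have "?c [^] j = ?c [^] (j mod 2)"
      proof -
        have "?c [^] j = (?c [^] (2::nat)) [^] (j div 2) \<otimes> ?c [^] (j mod 2)"
          using cc by (simp only: nat_pow_pow nat_pow_mult mult_div_mod_eq)
        then show ?thesis using cc c2 by simp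
      qed
      ultimately have eq: "inv ?B \<otimes> s = ?c [^] (j mod 2)" by simp
      have sB: "s = ?B \<otimes> (inv ?B \<otimes> s)"
      proof -
        have "?B \<otimes> (inv ?B \<otimes> s) = (?B \<otimes> inv ?B) \<otimes> s" using Bc sc by (simp only: m_assoc inv_closed)
        then show ?thesis using Bc sc by simp
      qed
      show False
      proof (cases "j mod 2 = 0")
        case True
        then have "s = ?B" using sB eq Bc by simp
        then show False using A2 s(1) by simp
      next
        case False
        then have "j mod 2 = 1" by simp
        then have "inv ?B \<otimes> s = ?B \<otimes> s" using eq cc by simp
        then have "s = ?B \<otimes> (?B \<otimes> s)" using sB by simp
        also have "\<dots> = (?B \<otimes> ?B) \<otimes> s" using Bc sc by (simp only: m_assoc)
        finally have "\<one> \<otimes> s = w \<otimes> s" using BB sc by simp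
        then have "w = \<one>" using sc wc by (metis r_cancel one_closed)
        then show False using \<open>w \<noteq> \<one>\<close> by simp
      qed
    qed
    ultimately have k: "k = 2" using x(3) by linarith
    \<comment> \<open>For k = 2 the equation for w reads A^4 = x^2, the quaternion relation.\<close>
    have "inverting_pair G 8 2 4 A x"
      using A x(1) A8 weq k by (simp add: inverting_pair_def w_def)
    then have "G \<cong> Q16" unfolding Q16_eq
      by (rule iso_presented_group_gen[OF fin]) (use gen ord k in auto)
    then show ?thesis by simp
  qed
qed

lemma classify_order_4_2pow:
  assumes fin: "finite (carrier G)"
    and nonnormal: "\<And>H. subgroup H G \<Longrightarrow> \<not> H \<lhd> G \<Longrightarrow> card H = 2 ^ k"
    and x: "x \<in> carrier G" "\<not> generate G {x} \<lhd> G" "ord x = 2 ^ k" "k \<ge> 1"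
    and ord: "order G = 4 * 2 ^ k"
  shows "G \<cong> D4 \<or> G \<cong> Q16 \<or> G \<cong> C4_semidirect_C4"
proof -
  let ?X = "generate G {x}" and ?K = "generate G {x [^] (2::nat)}"
  have X: "subgroup ?X G" using x by (simp add: generate_is_subgroup)
  have K: "subgroup ?K G" using x by (simp add: generate_is_subgroup)
  have Kc: "c \<in> carrier G" if "c \<in> ?K" for c using subgroup.mem_carrier[OF K that] .
  have Kpow: "?K = {(x [^] (2::nat)) [^] i | i. i \<in> (UNIV :: nat set)}"
    using x by (intro generate_pow_on_finite_carrier fin) simp
  have KX: "?K \<subseteq> ?X"
    by (intro generate_subgroup_incl[OF _ X]) (auto intro: subgroup_nat_pow_closed[OF X] generate.incl)
  obtain l where l: "k = Suc l" using x(4) by (cases k) auto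
  have "ord (x [^] (2::nat)) = 2 ^ l" using ord_pow[OF x(1), of 2] x(3) l by simp
  then have cardK: "card ?K = 2 ^ l" using generate_pow_card[of "x [^] (2::nat)"] x(1) by simp
  have nK: "?K \<lhd> G" using nonnormal[OF K] cardK l by fastforce
  \<comment> \<open>A non-normal H contains a non-normal cyclic subgroup; both have order 2^k, so
    they coincide.\<close>
  have cyclic: "\<exists>y\<in>H. H = generate G {y} \<and> ord y = 2 ^ k" if H: "subgroup H G" "\<not> H \<lhd> G" for H
  proof -
    obtain y where y: "y \<in> H" "\<not> generate G {y} \<lhd> G" by (rule nonnormal_cyclic[OF H])
    have yc: "y \<in> carrier G" using subgroup.mem_carrier[OF H(1) y(1)] .
    have "card (generate G {y}) = 2 ^ k" using yc y by (intro nonnormal generate_is_subgroup) auto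
    moreover have "card H = 2 ^ k" by (rule nonnormal[OF H])
    moreover have "generate G {y} \<subseteq> H" using y by (intro generate_subgroup_incl H(1)) auto
    moreover have "finite H" using subgroup.subset[OF H(1)] fin finite_subset by blast
    ultimately have "generate G {y} = H" by (metis card_subset_eq)
    then show ?thesis using y generate_pow_card[OF yc] \<open>card H = 2 ^ k\<close> by auto
  qed
  \<comment> \<open>The quotient enters through a surjection with kernel K, which keeps coset
    arithmetic out of the argument below.\<close>
  obtain Q :: "'a set monoid" and \<pi> where hom: "group_hom G Q \<pi>"
    and surj: "carrier Q = \<pi> ` carrier G"
    and ker: "\<And>g. g \<in> carrier G \<Longrightarrow> \<pi> g = \<one>\<^bsub>Q\<^esub> \<longleftrightarrow> g \<in> ?K"
    and cardQ: "order Q * card ?K = order G"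
  proof
    let ?Q = "G Mod ?K" and ?\<pi> = "\<lambda>g. ?K #> g"
    have "group ?Q" by (rule normal.factorgroup_is_group[OF nK])
    then show "group_hom G ?Q ?\<pi>"
      by (simp add: group_hom_def group_hom_axioms_def group_axioms normal.r_coset_hom_Mod[OF nK])
    show "carrier ?Q = ?\<pi> ` carrier G" by (rule carrier_FactGroup)
    show "?\<pi> g = \<one>\<^bsub>?Q\<^esub> \<longleftrightarrow> g \<in> ?K" if "g \<in> carrier G" for g
      using coset_join1[OF _ that K] coset_join2[OF that K] subgroup.subset[OF K] by auto
    show "order ?Q * card ?K = order G"
      using lagrange_finite[OF fin K] by (simp add: order_def FactGroup_def)
  qed
  interpret Q: group Q using hom by (simp add: group_hom_def)
  interpret \<pi>: group_hom G Q \<pi> by (rule hom)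
  have eqK: "g \<otimes> inv h \<in> ?K" if "\<pi> g = \<pi> h" "g \<in> carrier G" "h \<in> carrier G" for g h
  proof -
    have "\<pi> (g \<otimes> inv h) = \<pi> g \<otimes>\<^bsub>Q\<^esub> inv\<^bsub>Q\<^esub> \<pi> h"
      using that by (simp only: \<pi>.hom_mult \<pi>.hom_inv inv_closed)
    also have "\<dots> = \<one>\<^bsub>Q\<^esub>" using that \<pi>.hom_closed by (simp only: Q.r_inv)
    finally have "\<pi> (g \<otimes> inv h) = \<one>\<^bsub>Q\<^esub>" .
    moreover have "g \<otimes> inv h \<in> carrier G" using that by simp
    ultimately show ?thesis using ker[of "g \<otimes> inv h"] by (simp only:)
  qed
  have finQ: "finite (carrier Q)" using surj fin by simp
  have ordQ: "order Q = 8"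
  proof -
    show ?thesis using cardQ cardK ord l by simp
  qed
  define t where "t = \<pi> x"
  have tQ: "t \<in> carrier Q" unfolding t_def using x(1) by (rule \<pi>.hom_closed)
  have tt: "t \<otimes>\<^bsub>Q\<^esub> t = \<one>\<^bsub>Q\<^esub>"
  proof -
    have "t \<otimes>\<^bsub>Q\<^esub> t = \<pi> (x \<otimes> x)" unfolding t_def using x(1) by (simp only: \<pi>.hom_mult)
    moreover have "x \<otimes> x \<in> ?K"
      using generate.incl[of "x [^] (2::nat)" "{x [^] (2::nat)}" G] x(1) by (simp add: numeral_2_eq_2)
    ultimately show ?thesis using ker x(1) by (metis m_closed)
  qed
  \<comment> \<open>If t were central in Q, the conjugates of x would lie in K x, which is part of
    <x>, and <x> would be normal.\<close>
  have "\<exists>z\<in>carrier Q. t \<otimes>\<^bsub>Q\<^esub> z \<noteq> z \<otimes>\<^bsub>Q\<^esub> t"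
  proof (rule ccontr)
    assume neg: "\<not> ?thesis"
    have "?X \<lhd> G"
    proof (rule generate_one_normalI[OF x(1)])
      fix g assume g: "g \<in> carrier G"
      have "\<pi> (g \<otimes> x) = \<pi> g \<otimes>\<^bsub>Q\<^esub> t" "\<pi> (x \<otimes> g) = t \<otimes>\<^bsub>Q\<^esub> \<pi> g"
        unfolding t_def using g x(1) by (simp_all only: \<pi>.hom_mult)
      then have "\<pi> (g \<otimes> x) = \<pi> (x \<otimes> g)" using neg \<pi>.hom_closed[OF g] by metis
      then have "(g \<otimes> x) \<otimes> inv (x \<otimes> g) \<in> ?K" using g x(1) by (intro eqK) auto
      then have "(g \<otimes> x \<otimes> inv g) \<otimes> inv x \<in> ?X" using KX g x(1) by (auto simp: inv_mult_group m_assoc)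
      moreover have "x \<in> ?X" by (simp add: generate.incl)
      ultimately have "(g \<otimes> x \<otimes> inv g) \<otimes> inv x \<otimes> x \<in> ?X" by (rule subgroup.m_closed[OF X])
      then show "g \<otimes> x \<otimes> inv g \<in> ?X" using g x(1) by (simp add: m_assoc)
    qed
    then show False using x(2) by simp
  qed
  then obtain z where z: "z \<in> carrier Q" "t \<otimes>\<^bsub>Q\<^esub> z \<noteq> z \<otimes>\<^bsub>Q\<^esub> t" by blast
  obtain \<alpha> where \<alpha>: "\<alpha> \<in> carrier Q" "\<alpha> \<otimes>\<^bsub>Q\<^esub> t = t \<otimes>\<^bsub>Q\<^esub> inv\<^bsub>Q\<^esub> \<alpha>" "\<alpha> \<otimes>\<^bsub>Q\<^esub> \<alpha> \<noteq> \<one>\<^bsub>Q\<^esub>"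
      "\<alpha> [^]\<^bsub>Q\<^esub> (4::nat) = \<one>\<^bsub>Q\<^esub>" "t \<noteq> \<alpha>"
      "\<And>M. subgroup M Q \<Longrightarrow> \<alpha> \<in> M \<Longrightarrow> t \<in> M \<Longrightarrow> M = carrier Q"
    by (rule Q.dihedral_of_order_8[OF finQ ordQ tQ tt z]) blast
  have gen: "M = carrier G" if M: "subgroup M G" "A \<in> M" "x \<in> M" and A: "\<pi> A = \<alpha>" for M A
  proof -
    have "subgroup (\<pi> ` M) Q" by (rule \<pi>.subgroup_img_is_subgroup[OF M(1)])
    then have im: "\<pi> ` M = carrier Q" using \<alpha>(6) M A t_def by blast
    have KM: "?K \<subseteq> M"
      using M(3) by (intro generate_subgroup_incl M(1)) (auto intro: subgroup_nat_pow_closed[OF M(1)])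
    have "g \<in> M" if g: "g \<in> carrier G" for g
    proof -
      obtain h where h: "h \<in> M" "\<pi> g = \<pi> h" using im g surj by blast
      have hc: "h \<in> carrier G" using subgroup.mem_carrier[OF M(1) h(1)] .
      have "g \<otimes> inv h \<in> M" using eqK[OF h(2) g hc] KM by blast
      then have "g \<otimes> inv h \<otimes> h \<in> M" using h(1) by (rule subgroup.m_closed[OF M(1)])
      then show ?thesis using g hc by (simp add: m_assoc)
    qed
    then show ?thesis using subgroup.subset[OF M(1)] by blast
  qed
  \<comment> \<open>A reflection from the class other than that of t. Conjugation by t sends it to
    \<alpha> t = t inv \<alpha>, which differs from \<beta>, so the preimage of {1, \<beta>} is not
    normal.\<close>
  define \<beta> where "\<beta> = t \<otimes>\<^bsub>Q\<^esub> \<alpha>"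
  have \<beta>Q: "\<beta> \<in> carrier Q" unfolding \<beta>_def using tQ \<alpha>(1) by (rule Q.m_closed)
  have \<beta>\<beta>: "\<beta> \<otimes>\<^bsub>Q\<^esub> \<beta> = \<one>\<^bsub>Q\<^esub>"
  proof -
    have "\<beta> \<otimes>\<^bsub>Q\<^esub> \<beta> = t \<otimes>\<^bsub>Q\<^esub> (\<alpha> \<otimes>\<^bsub>Q\<^esub> t) \<otimes>\<^bsub>Q\<^esub> \<alpha>"
      unfolding \<beta>_def using tQ \<alpha>(1) by (simp only: Q.m_assoc Q.m_closed)
    also have "\<dots> = t \<otimes>\<^bsub>Q\<^esub> t \<otimes>\<^bsub>Q\<^esub> (inv\<^bsub>Q\<^esub> \<alpha> \<otimes>\<^bsub>Q\<^esub> \<alpha>)"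
      unfolding \<alpha>(2) using tQ \<alpha>(1) by (simp only: Q.m_assoc Q.m_closed Q.inv_closed)
    also have "\<dots> = \<one>\<^bsub>Q\<^esub>" using tQ \<alpha>(1) by (simp only: tt Q.l_inv Q.l_one Q.one_closed)
    finally show ?thesis .
  qed
  let ?Y = "{g \<in> carrier G. \<pi> g \<in> {\<one>\<^bsub>Q\<^esub>, \<beta>}}"
  have Y: "subgroup ?Y G"
  proof (rule finite_submonoid_subgroup[OF fin])
    show "\<one> \<in> ?Y" using \<pi>.hom_one by simp
    fix u v assume uv: "u \<in> ?Y" "v \<in> ?Y"
    then have "\<pi> (u \<otimes> v) = \<pi> u \<otimes>\<^bsub>Q\<^esub> \<pi> v" by (simp only: \<pi>.hom_mult mem_Collect_eq)
    moreover have "\<one>\<^bsub>Q\<^esub> \<otimes>\<^bsub>Q\<^esub> \<beta> = \<beta>" "\<beta> \<otimes>\<^bsub>Q\<^esub> \<one>\<^bsub>Q\<^esub> = \<beta>" "\<one>\<^bsub>Q\<^esub> \<otimes>\<^bsub>Q\<^esub> \<one>\<^bsub>Q\<^esub> = \<one>\<^bsub>Q\<^esub>"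
      using \<beta>Q by (simp_all only: Q.l_one Q.r_one Q.one_closed)
    moreover have "\<pi> u = \<one>\<^bsub>Q\<^esub> \<or> \<pi> u = \<beta>" "\<pi> v = \<one>\<^bsub>Q\<^esub> \<or> \<pi> v = \<beta>" using uv by blast+
    ultimately have "\<pi> (u \<otimes> v) \<in> {\<one>\<^bsub>Q\<^esub>, \<beta>}" using \<beta>\<beta> by (elim disjE) (simp_all only: insert_iff simp_thms)
    then show "u \<otimes> v \<in> ?Y" using uv by simp
  qed auto
  have "\<alpha> \<in> \<pi> ` carrier G" using \<alpha>(1) by (simp only: surj)
  then obtain a0 where a0: "a0 \<in> carrier G" "\<pi> a0 = \<alpha>" by blast
  have "\<not> ?Y \<lhd> G"
  proof
    assume nY: "?Y \<lhd> G"
    have "\<pi> (x \<otimes> a0) = \<beta>" unfolding \<beta>_def t_def using x(1) a0 by (simp only: \<pi>.hom_mult)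
    then have "x \<otimes> a0 \<in> ?Y" using x(1) a0 by simp
    then have "inv x \<otimes> (x \<otimes> a0) \<otimes> x \<in> ?Y" by (rule normal.inv_op_closed1[OF nY x(1)])
    moreover have "inv x \<otimes> (x \<otimes> a0) \<otimes> x = a0 \<otimes> x" using x(1) a0(1) by (simp add: m_assoc[symmetric])
    ultimately have "\<pi> (a0 \<otimes> x) \<in> {\<one>\<^bsub>Q\<^esub>, \<beta>}" by simp
    moreover have "\<pi> (a0 \<otimes> x) = \<alpha> \<otimes>\<^bsub>Q\<^esub> t" unfolding t_def using x(1) a0 by (simp only: \<pi>.hom_mult)
    ultimately have "\<alpha> \<otimes>\<^bsub>Q\<^esub> t = \<one>\<^bsub>Q\<^esub> \<or> t \<otimes>\<^bsub>Q\<^esub> inv\<^bsub>Q\<^esub> \<alpha> = t \<otimes>\<^bsub>Q\<^esub> \<alpha>"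
      using \<alpha>(2) unfolding \<beta>_def by auto
    then show False
    proof
      assume "\<alpha> \<otimes>\<^bsub>Q\<^esub> t = \<one>\<^bsub>Q\<^esub>"
      then have "\<alpha> \<otimes>\<^bsub>Q\<^esub> t = t \<otimes>\<^bsub>Q\<^esub> t" using tt by simp
      then have "\<alpha> = t" using tQ \<alpha>(1) by (simp only: Q.r_cancel)
      then show False using \<alpha>(5) by simp
    next
      assume "t \<otimes>\<^bsub>Q\<^esub> inv\<^bsub>Q\<^esub> \<alpha> = t \<otimes>\<^bsub>Q\<^esub> \<alpha>"
      then have "inv\<^bsub>Q\<^esub> \<alpha> = \<alpha>" using tQ \<alpha>(1) by (simp only: Q.l_cancel Q.inv_closed)
      then show False using \<alpha>(1,3) Q.r_inv[OF \<alpha>(1)] by simp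
    qed
  qed
  then obtain y where y: "y \<in> ?Y" "ord y = 2 ^ k" using cyclic[OF Y] by blast
  have yc: "y \<in> carrier G" using y by simp
  have "y \<notin> ?K"
  proof
    assume "y \<in> ?K"
    then have "2 ^ k dvd card ?K" using ord_dvd_card_subgroup[OF fin K] y(2) by metis
    then have "(2::nat) ^ k \<le> 2 ^ l" using cardK by (intro dvd_imp_le) auto
    then show False using l by simp
  qed
  then have \<pi>y: "\<pi> y = \<beta>" using y(1) ker[OF yc] by blast
  have yK: "y [^] (2::nat) \<in> ?K"
  proof -
    have "\<pi> (y \<otimes> y) = \<one>\<^bsub>Q\<^esub>" using yc \<pi>y \<beta>\<beta> by (simp only: \<pi>.hom_mult)
    then have "y \<otimes> y \<in> ?K" using ker yc by blast
    then show ?thesis using yc by (simp add: numeral_2_eq_2)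
  qed
  have oy2: "ord (y [^] (2::nat)) = 2 ^ l" using ord_pow[OF yc, of 2] y(2) l by simp
  \<comment> \<open>K thus consists of powers of x and also of powers of y, so both elements
    centralise it.\<close>
  have Ky: "?K = generate G {y [^] (2::nat)}"
  proof -
    have "card (generate G {y [^] (2::nat)}) = 2 ^ l" using generate_pow_card[of "y [^] (2::nat)"] yc oy2 by simp
    moreover have "generate G {y [^] (2::nat)} \<subseteq> ?K" using yK by (intro generate_subgroup_incl[OF _ K]) auto
    moreover have "finite ?K" using cardK by (intro card_ge_0_finite) simp
    ultimately show ?thesis using cardK by (metis card_subset_eq)
  qed
  have Kpowy: "?K = {(y [^] (2::nat)) [^] i | i. i \<in> (UNIV :: nat set)}"
    unfolding Ky using yc by (intro generate_pow_on_finite_carrier fin) simp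
  define a where "a = inv x \<otimes> y"
  have ac: "a \<in> carrier G" using x(1) yc by (simp add: a_def)
  have xa: "x \<otimes> a = y" using x(1) yc by (simp add: a_def m_assoc[symmetric])
  have \<pi>a: "\<pi> a = \<alpha>"
  proof -
    have "\<pi> a = inv\<^bsub>Q\<^esub> t \<otimes>\<^bsub>Q\<^esub> (t \<otimes>\<^bsub>Q\<^esub> \<alpha>)"
      unfolding a_def t_def using x(1) yc \<pi>y by (simp only: \<pi>.hom_mult \<pi>.hom_inv inv_closed \<beta>_def t_def)
    also have "\<dots> = (inv\<^bsub>Q\<^esub> t \<otimes>\<^bsub>Q\<^esub> t) \<otimes>\<^bsub>Q\<^esub> \<alpha>" using tQ \<alpha>(1) by (simp only: Q.m_assoc Q.inv_closed)
    also have "\<dots> = \<alpha>" using tQ \<alpha>(1) by (simp only: Q.l_inv Q.l_one)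
    finally show ?thesis .
  qed
  have central: "c \<otimes> g = g \<otimes> c" if c: "c \<in> ?K" and g: "g \<in> carrier G" for c g
  proof -
    have cc: "c \<in> carrier G" by (rule Kc[OF c])
    let ?C = "{w \<in> carrier G. c \<otimes> w = w \<otimes> c}"
    have C: "subgroup ?C G" by (rule centralizer_subgroup[OF cc])
    obtain i :: nat where i: "c = x [^] (2 * i)" using c Kpow x(1) by (auto simp: nat_pow_pow)
    obtain j :: nat where j: "c = y [^] (2 * j)" using c Kpowy yc by (auto simp: nat_pow_pow)
    have "x \<in> ?C" using x(1) i nat_pow_comm[OF x(1), of "2 * i" 1] by simp
    moreover have "y \<in> ?C" using yc j nat_pow_comm[OF yc, of "2 * j" 1] by simp
    ultimately have "a \<in> ?C" unfolding a_def
      by (intro subgroup.m_closed[OF C] subgroup.m_inv_closed[OF C])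
    then have "?C = carrier G" using gen[OF C] \<pi>a \<open>x \<in> ?C\<close> by blast
    then show ?thesis using g by blast
  qed
  \<comment> \<open>\<kappa> measures how far x is from inverting a. It lies in K because y = x a
    gives y^2 = x^2 \<kappa>.\<close>
  define \<kappa> where "\<kappa> = inv x \<otimes> a \<otimes> x \<otimes> a"
  have \<kappa>c: "\<kappa> \<in> carrier G" using x(1) ac by (simp add: \<kappa>_def)
  have \<kappa>y: "y \<otimes> y = x \<otimes> x \<otimes> \<kappa>"
  proof -
    have "x \<otimes> x \<otimes> \<kappa> = x \<otimes> (x \<otimes> inv x) \<otimes> a \<otimes> (x \<otimes> a)"
      unfolding \<kappa>_def using x(1) ac by (simp only: m_assoc m_closed inv_closed)
    also have "\<dots> = y \<otimes> y" using x(1) ac by (simp add: xa)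
    finally show ?thesis by simp
  qed
  have xxK: "x \<otimes> x \<in> ?K"
    using generate.incl[of "x [^] (2::nat)" "{x [^] (2::nat)}" G] x(1) by (simp add: numeral_2_eq_2)
  have "\<kappa> = inv (x \<otimes> x) \<otimes> (y \<otimes> y)"
    using \<kappa>y x(1) \<kappa>c yc by (metis inv_solve_left m_closed)
  moreover have "y \<otimes> y \<in> ?K" using yK yc by (simp add: numeral_2_eq_2)
  ultimately have \<kappa>K: "\<kappa> \<in> ?K"
    using xxK by (simp add: subgroup.m_closed[OF K] subgroup.m_inv_closed[OF K])
  \<comment> \<open>Replacing a by a inv \<sigma> with a central \<sigma> divides \<kappa> by
    \<sigma>^2, so a square root of \<kappa> in K is wanted.\<close>
  have "\<exists>\<sigma>\<in>?K. \<sigma> \<otimes> \<sigma> = \<kappa>"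
  proof (cases "l = 0")
    case True
    then have "?K = {\<one>}" using cardK generate.one[of G "{x [^] (2::nat)}"]
      by (metis card_1_singletonE power_0 singletonD)
    then show ?thesis using \<kappa>K by auto
  next
    case False
    then obtain l' where l': "l = Suc l'" by (cases l) auto
    obtain e :: nat where e: "\<kappa> = (x [^] (2::nat)) [^] e" using \<kappa>K Kpow by blast
    \<comment> \<open>For odd e, y^2 = x^(2 + 2e) would be a power of x^4 and have order less than
      2^l, although it generates K.\<close>
    have "even e"
    proof (rule ccontr)
      assume "\<not> even e"
      then obtain c where c: "e = 2 * c + 1" by (elim oddE)
      have "y [^] (2::nat) = x [^] (2::nat) \<otimes> \<kappa>" using \<kappa>y yc x(1) by (simp add: numeral_2_eq_2)
      then have "y [^] (2::nat) = x [^] (2 + 2 * e)"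
        unfolding e using x(1) by (simp only: nat_pow_pow nat_pow_mult)
      also have "2 + 2 * e = 4 * (c + 1)" by (simp add: c)
      finally have "y [^] (2::nat) = x [^] (4 * (c + 1))" .
      then have "(y [^] (2::nat)) [^] (2 ^ l' :: nat) = x [^] (2 ^ k * (c + 1))"
        using x(1) by (simp add: nat_pow_pow l l' algebra_simps)
      also have "\<dots> = \<one>" using pow_eq_id[OF x(1), of "2 ^ k * (c + 1)"] x(3) by simp
      finally have "ord (y [^] (2::nat)) dvd 2 ^ l'" using pow_eq_id yc by simp
      then have "(2::nat) ^ l \<le> 2 ^ l'" using oy2 by (intro dvd_imp_le) auto
      then show False using l' by simp
    qed
    then obtain f where f: "e = 2 * f" by (elim evenE)
    have "(x [^] (2::nat)) [^] f \<in> ?K" using Kpow by blast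
    moreover have "(x [^] (2::nat)) [^] f \<otimes> (x [^] (2::nat)) [^] f = \<kappa>"
      unfolding e f using x(1) by (simp add: nat_pow_mult mult_2)
    ultimately show ?thesis by blast
  qed
  then obtain \<sigma> where \<sigma>: "\<sigma> \<in> ?K" "\<sigma> \<otimes> \<sigma> = \<kappa>" by blast
  have \<sigma>c: "\<sigma> \<in> carrier G" by (rule Kc[OF \<sigma>(1)])
  have i\<sigma>: "inv \<sigma> \<in> ?K" by (rule subgroup.m_inv_closed[OF K \<sigma>(1)])
  define A where "A = a \<otimes> inv \<sigma>"
  have Ac: "A \<in> carrier G" using ac \<sigma>c by (simp add: A_def)
  have \<pi>A: "\<pi> A = \<alpha>"
  proof -
    have "\<pi> A = \<alpha> \<otimes>\<^bsub>Q\<^esub> \<pi> (inv \<sigma>)" unfolding A_def using ac \<sigma>c \<pi>a by (simp only: \<pi>.hom_mult inv_closed)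
    also have "\<pi> (inv \<sigma>) = \<one>\<^bsub>Q\<^esub>" using ker i\<sigma> \<sigma>c by blast
    finally show ?thesis using \<alpha>(1) by (simp only: Q.r_one)
  qed
  have AxA: "inv x \<otimes> A \<otimes> x \<otimes> A = \<one>"
  proof -
    let ?s = "inv \<sigma>"
    have sc: "?s \<in> carrier G" using \<sigma>c by simp
    have "inv x \<otimes> A \<otimes> x \<otimes> A = inv x \<otimes> a \<otimes> (?s \<otimes> (x \<otimes> a)) \<otimes> ?s"
      unfolding A_def using x(1) ac sc by (simp only: m_assoc m_closed inv_closed)
    also have "?s \<otimes> (x \<otimes> a) = (x \<otimes> a) \<otimes> ?s" using central[OF i\<sigma>] x(1) ac by simp
    also have "inv x \<otimes> a \<otimes> ((x \<otimes> a) \<otimes> ?s) \<otimes> ?s = \<kappa> \<otimes> (?s \<otimes> ?s)"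
      unfolding \<kappa>_def using x(1) ac sc by (simp only: m_assoc m_closed inv_closed)
    also have "?s \<otimes> ?s = inv \<kappa>" using \<sigma>(2) \<sigma>c by (metis inv_mult_group)
    finally show ?thesis using \<kappa>c by simp
  qed
  have Ax: "A \<otimes> x = x \<otimes> inv A"
  proof -
    have "inv A = inv x \<otimes> A \<otimes> x" by (rule inv_equality[OF AxA]) (use Ac x(1) in simp_all)
    then have "x \<otimes> inv A = x \<otimes> (inv x \<otimes> A \<otimes> x)" by simp
    also have "\<dots> = A \<otimes> x" using x(1) Ac by (simp add: m_assoc[symmetric])
    finally show ?thesis by simp
  qed
  show ?thesis
  proof (rule classify_inverted_2group[OF fin x(1,3,4) ord Ac Ax])
    show "A [^] (4::nat) \<in> ?K"
    proof -
      have "\<pi> (A [^] (4::nat)) = \<alpha> [^]\<^bsub>Q\<^esub> (4::nat)" using \<pi>.hom_nat_pow[OF Ac, of 4] \<pi>A by simp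
      then show ?thesis using \<alpha>(4) ker Ac by (metis nat_pow_closed)
    qed
    show "A \<otimes> A \<notin> ?K"
    proof
      assume "A \<otimes> A \<in> ?K"
      then have "\<pi> (A \<otimes> A) = \<one>\<^bsub>Q\<^esub>" using ker Ac by (metis m_closed)
      moreover have "\<pi> (A \<otimes> A) = \<alpha> \<otimes>\<^bsub>Q\<^esub> \<alpha>" using Ac \<pi>A by (simp only: \<pi>.hom_mult)
      ultimately show False using \<alpha>(3) by simp
    qed
    show "c \<otimes> g = g \<otimes> c" if "c \<in> ?K" "g \<in> carrier G" for c g using central[OF that] .
    show "M = carrier G" if "subgroup M G" "A \<in> M" "x \<in> M" for M using gen[OF that \<pi>A] .
    fix c assume c: "c \<in> carrier G" "ord c < 2 ^ k"
    show "generate G {c} \<lhd> G"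
    proof (rule ccontr)
      assume "\<not> generate G {c} \<lhd> G"
      then have "card (generate G {c}) = 2 ^ k" using c by (intro nonnormal generate_is_subgroup) auto
      then show False using generate_pow_card[OF c(1)] c(2) by simp
    qed
  qed
qed

lemma tp_half_imp_classification:
  assumes fin: "finite (carrier G)" and tp: "tp G = 1 / 2"
  shows "(\<exists>n\<ge>1. G \<cong> C3_semidirect_C2pow n) \<or> G \<cong> D4 \<or> G \<cong> Q16 \<or> G \<cong> C4_semidirect_C4"
proof -
  note even = tp_half_D(1)[OF fin tp] and index = tp_half_D(2)[OF fin tp]
  obtain H where H: "subgroup H G" "\<not> H \<lhd> G" using tp_half_D(3)[OF fin tp] by blast
  obtain x k where x: "x \<in> carrier G" "\<not> generate G {x} \<lhd> G" "ord x = 2 ^ k" "k \<ge> 1"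
    by (rule exists_nonnormal_2_element[OF fin even H])
  have "card (generate G {x}) = 2 ^ k" using generate_pow_card[OF x(1)] x(3) by simp
  moreover have "subgroup (generate G {x}) G" using x(1) by (simp add: generate_is_subgroup)
  ultimately consider "order G = 3 * 2 ^ k" | "order G = 4 * 2 ^ k" using index x(2) by metis
  then show ?thesis
  proof cases
    case 1
    then have "G \<cong> C3_semidirect_C2pow k" by (intro classify_order_3_2pow[OF fin even x])
    then show ?thesis using x(4) by blast
  next
    case 2
    \<comment> \<open>Index 3 would mean 3 |H| = 4 * 2^k, but 3 divides no power of 2. So every
      non-normal subgroup has index 4.\<close>
    have "card H = 2 ^ k" if H: "subgroup H G" "\<not> H \<lhd> G" for H
    proof -
      have "\<not> 3 dvd (2::nat) ^ k" by (induction k) (simp_all, presburger)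
      then have "4 * 2 ^ k \<noteq> 3 * card H" by presburger
      then show ?thesis using index[OF H] 2 by auto
    qed
    then show ?thesis using classify_order_4_2pow[OF fin _ x 2] by blast
  qed
qed

end

theorem corollary4p11:
  fixes G :: "('a, 'b) monoid_scheme"
  assumes "group G" and "finite (carrier G)"
  shows "tp G = 1 / 2 \<longleftrightarrow>
    (\<exists>n\<ge>1. G \<cong> C3_semidirect_C2pow n) \<or> G \<cong> D4 \<or> G \<cong> Q16 \<or> G \<cong> C4_semidirect_C4"
  using group.tp_half_imp_classification[OF assms] group.classification_imp_tp_half[OF assms(1)] by blast

end
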